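(* In the limit $\lambda\to0^+$, the total area $A^{\rm reg}(\lambda)$ of the islands of the regular periodic orbits of $F$ converges to the positive quantity $$A^{\rm reg}(0)=I(2,1,2)+\sum_{m=2}^{\infty}\bigl(I(m+1,m,m+1)+I(m,m-1,m-1)\bigr),$$ where $$I(a,b,c)=\frac{\pi}{4}\int_{\cot^{-1}(2a-1)}^{\cot^{-1}(2b-1)}\bigl((2c-1)\tan\eta-1\bigr)^2\Bigl(\frac{\pi}{4}-\eta\Bigr)\,d\eta .$$
   Context: For $\lambda>0$ small let $\Omega=[0,1)^2$, $F:\Omega\to\Omega$, $F(x,y)=(\lambda x-y+\iota(x,y),x)$, $\iota(x,y)=-\lfloor\lambda x-y\rfloor$, $G(x,y)=(y,x)$. Let $\mathcal Q(U,V)=U_xV_x+U_yV_y-\frac\lambda2(U_xV_y+U_yV_x)$; areas are taken in this metric. Put $\theta=\arcsin(\lambda/2)$, $N=\lfloor\frac{\pi}{8\theta}-\frac14\rfloor$, $M=\lfloor\frac{\pi}{4\theta}-\frac12\rfloor$, $c=(\frac1{2-\lambda},\frac1{2-\lambda})$. For $n\ge0$ let $\ell_n$ be the image of the line $y=1$ under $z\mapsto c+C^{4n}(z-c)$, $C=\begin{pmatrix}\lambda&-1\\1&0\end{pmatrix}$; $Q_0(n)=\ell_0\cap G(\ell_n)$, $Q_1(n)=\ell_1\cap G(\ell_n)$. For $1\le n\le N-1$, $\Lambda_n^{\rm in}$ is the quadrilateral with consecutive vertices $Q_0(n),Q_0(n-1),Q_1(n-1),Q_1(n)$. Let $P_0(m)=\left(\frac12\left(1+2\lambda+\frac{\tan\theta}{\tan(2m+1)\theta}\right),1\right)$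 for $1\le m\le M$; $P_1(m)=\left(\frac12\left(1+2\lambda-\lambda^2+\lambda^4+(1-3\lambda^2+\lambda^4)\frac{\tan\theta}{\tan(2m-1)\theta}\right),\,1+\frac{\lambda^3}2+\frac\lambda2(\lambda^2-2)\frac{\tan\theta}{\tan(2m-1)\theta}\right)$ for $2\le m\le M$; $P_1(0)=\left(1,\frac{2-\lambda-\lambda^2}{2-4\lambda^2+\lambda^4}\right)$, $P_1(1)=\left(1,\frac{2-2\lambda-4\lambda^2+\lambda^3+\lambda^4}{2-9\lambda^2+6\lambda^4-\lambda^6}\right)$. For $3\le m\le M$, $\Lambda_m^{\rm out}$ is the quadrilateral $[P_0(m),P_0(m-1),P_1(m-1),P_1(m)]$; $\Lambda_1^{\rm out}=[P_0(1),(1,1),P_1(0),P']$ with $P'=(1-2\lambda^2+6\lambda^3+\lambda^4-5\lambda^5+\lambda^7,\ 1-\lambda+3\lambda^2+\lambda^3-4\lambda^4+\lambda^6)$; $\Lambda_2^{\rm out}=[P_0(2),P_0(1),P'',P_1(1),P''',P_1(2)]$ with $D=1-6\lambda^2+5\lambda^4-\lambda^6$, $P''=\left(1,\frac{1-\lambda-3\lambda^2+\lambda^3+\lambda^4}{D}\right)$, $P'''=\left(\frac{1-6\lambda^2-3\lambda^3+11\lambda^4+4\lambda^5-12\lambda^6-\lambda^7+6\lambda^8-\lambda^{10}}{D},\frac{1-\lambda-4\lambda^2+3\lambda^3+4\lambda^4-7\lambda^5-\lambda^6+5\lambda^7-\lambda^9}{D}\right)$. A regular fixed point $Z(m,n)$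 ($1\le m\le M$, $1\le n\le N-1$) is a point of $\Lambda_m^{\rm out}\cap\Lambda_n^{\rm in}$ at which the segments $[P_0(m),P_1(m-1)]$ and $[Q_0(n-1),Q_1(n)]$ intersect (it is a fixed point of the return map induced by $F$ near the corner $(1,1)$). It is a periodic point of $F$ of period $t(m,n)=4(m+n)-1$, and its $F$-orbit is called a regular periodic orbit. Let $A_{m,n}$ be the area of the stability ellipse $\{z:\mathcal Q(z-Z,z-Z)\le(1-\lambda^2/4)r^2\}$, $Z=Z(m,n)$, where $r=\min\{x,1-x\}$ minimized over all points $(x,y)$ of the orbit; all points of the orbit carry congruent ellipses (islands). Then $A^{\rm reg}(\lambda)=\sum A_{m,n}\,t(m,n)$, the sum being over all pairs $(m,n)$ for which $Z(m,n)$ exists. *)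

theory Defs
  imports "HOL-Analysis.Analysis"
begin

type_synonym point = "real \<times> real"

text \<open>The map, the quadratic form, and the parameters.\<close>

definition Omega :: "point set" where
  "Omega = {0..<1} \<times> {0..<1}"

(* As a total function on the plane; it maps Omega into itself. *)
definition F :: "real \<Rightarrow> point \<Rightarrow> point" where
  "F lam = (\<lambda>(x, y). (lam * x - y + of_int (- \<lfloor>lam * x - y\<rfloor>), x))"

definition G :: "point \<Rightarrow> point" where
  "G = (\<lambda>(x, y). (y, x))"

definition Q :: "real \<Rightarrow> point \<Rightarrow> point \<Rightarrow> real" where
  "Q lam U V = fst U * fst V + snd U * snd V
     - lam / 2 * (fst U * snd V + snd U * fst V)"

(* Riemannian area of the flat metric Q: Lebesgue measure times the square root of the Gram
   determinant of the standard basis. *)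
definition area :: "real \<Rightarrow> point set \<Rightarrow> real" where
  "area lam S =
     sqrt (Q lam (1,0) (1,0) * Q lam (0,1) (0,1) - (Q lam (1,0) (0,1))\<^sup>2) * measure lborel S"

definition theta :: "real \<Rightarrow> real" where
  "theta lam = arcsin (lam / 2)"

(* For small positive lam both floors are nonnegative, so the conversion to nat is harmless. *)
definition N :: "real \<Rightarrow> nat" where
  "N lam = nat \<lfloor>pi / (8 * theta lam) - 1 / 4\<rfloor>"

definition M :: "real \<Rightarrow> nat" where
  "M lam = nat \<lfloor>pi / (4 * theta lam) - 1 / 2\<rfloor>"

definition centre :: "real \<Rightarrow> point" where
  "centre lam = (1 / (2 - lam), 1 / (2 - lam))"

definition C :: "real \<Rightarrow> point \<Rightarrow> point" where
  "C lam = (\<lambda>(x, y). (lam * x - y, x))"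

text \<open>Closed polygonal regions and their vertices.\<close>

(* The region with the given consecutive vertices: the closed polygonal line together with the
   bounded components of its complement. *)
definition polygon_boundary :: "point list \<Rightarrow> point set" where
  "polygon_boundary vs =
     (\<Union>i<length vs. closed_segment (vs ! i) (vs ! (Suc i mod length vs)))"

definition polygon :: "point list \<Rightarrow> point set" where
  "polygon vs = polygon_boundary vs \<union> inside (polygon_boundary vs)"

definition ell :: "real \<Rightarrow> nat \<Rightarrow> point set" where
  "ell lam n =
     (\<lambda>z. centre lam + (C lam ^^ (4 * n)) (z - centre lam)) ` {z. snd z = 1}"

definition Q0 :: "real \<Rightarrow> nat \<Rightarrow> point" where
  "Q0 lam n = (THE z. z \<in> ell lam 0 \<inter> G ` ell lam n)"

definition Q1 :: "real \<Rightarrow> nat \<Rightarrow> point" where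
  "Q1 lam n = (THE z. z \<in> ell lam 1 \<inter> G ` ell lam n)"

definition Lambda_in :: "real \<Rightarrow> nat \<Rightarrow> point set" where
  "Lambda_in lam n = polygon [Q0 lam n, Q0 lam (n - 1), Q1 lam (n - 1), Q1 lam n]"

(* When (2 m + 1) theta = pi / 2, tan is 0 by the library convention and so is the quotient
   below, which is the intended value since 1 / tan is to be read as cot. *)
definition P0 :: "real \<Rightarrow> nat \<Rightarrow> point" where
  "P0 lam m =
     ((1 + 2 * lam + tan (theta lam) / tan ((2 * real m + 1) * theta lam)) / 2, 1)"

definition P1 :: "real \<Rightarrow> nat \<Rightarrow> point" where
  "P1 lam m =
    (if m = 0 then (1, (2 - lam - lam^2) / (2 - 4 * lam^2 + lam^4))
     else if m = 1 then
       (1, (2 - 2 * lam - 4 * lam^2 + lam^3 + lam^4) / (2 - 9 * lam^2 + 6 * lam^4 - lam^6))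
     else
       ((1 + 2 * lam - lam^2 + lam^4
          + (1 - 3 * lam^2 + lam^4) * (tan (theta lam) / tan ((2 * real m - 1) * theta lam))) / 2,
        1 + lam^3 / 2
          + lam / 2 * (lam^2 - 2) * (tan (theta lam) / tan ((2 * real m - 1) * theta lam))))"

(* P', P'', P''' *)
definition Pa :: "real \<Rightarrow> point" where
  "Pa lam = (1 - 2 * lam^2 + 6 * lam^3 + lam^4 - 5 * lam^5 + lam^7,
             1 - lam + 3 * lam^2 + lam^3 - 4 * lam^4 + lam^6)"

definition D :: "real \<Rightarrow> real" where
  "D lam = 1 - 6 * lam^2 + 5 * lam^4 - lam^6"

definition Pb :: "real \<Rightarrow> point" where
  "Pb lam = (1, (1 - lam - 3 * lam^2 + lam^3 + lam^4) / D lam)"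

definition Pc :: "real \<Rightarrow> point" where
  "Pc lam =
    ((1 - 6 * lam^2 - 3 * lam^3 + 11 * lam^4 + 4 * lam^5 - 12 * lam^6 - lam^7 + 6 * lam^8
        - lam^10) / D lam,
     (1 - lam - 4 * lam^2 + 3 * lam^3 + 4 * lam^4 - 7 * lam^5 - lam^6 + 5 * lam^7
        - lam^9) / D lam)"

definition Lambda_out :: "real \<Rightarrow> nat \<Rightarrow> point set" where
  "Lambda_out lam m =
    (if m = 1 then polygon [P0 lam 1, (1, 1), P1 lam 0, Pa lam]
     else if m = 2 then
       polygon [P0 lam 2, P0 lam 1, Pb lam, P1 lam 1, Pc lam, P1 lam 2]
     else polygon [P0 lam m, P0 lam (m - 1), P1 lam (m - 1), P1 lam m])"

text \<open>Regular fixed points and their islands.\<close>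

(* The polygons are closed in the plane; a fixed point is moreover a point of the phase space. *)
definition regular_fixed_point :: "real \<Rightarrow> nat \<Rightarrow> nat \<Rightarrow> point \<Rightarrow> bool" where
  "regular_fixed_point lam m n z \<longleftrightarrow>
     z \<in> Omega \<and> z \<in> Lambda_out lam m \<inter> Lambda_in lam n \<and>
     z \<in> closed_segment (P0 lam m) (P1 lam (m - 1)) \<and>
     z \<in> closed_segment (Q0 lam (n - 1)) (Q1 lam n)"

definition Z :: "real \<Rightarrow> nat \<Rightarrow> nat \<Rightarrow> point" where
  "Z lam m n = (SOME z. regular_fixed_point lam m n z)"

definition period :: "nat \<Rightarrow> nat \<Rightarrow> nat" where
  "period m n = 4 * (m + n) - 1"

definition orbit :: "real \<Rightarrow> point \<Rightarrow> point set" where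
  "orbit lam z = range (\<lambda>k. (F lam ^^ k) z)"

definition island_radius :: "real \<Rightarrow> point \<Rightarrow> real" where
  "island_radius lam z = (INF (x, y) \<in> orbit lam z. min x (1 - x))"

definition island :: "real \<Rightarrow> point \<Rightarrow> point set" where
  "island lam z0 =
     {z. Q lam (z - z0) (z - z0) \<le> (1 - lam\<^sup>2 / 4) * (island_radius lam z0)\<^sup>2}"

definition regular_pairs :: "real \<Rightarrow> (nat \<times> nat) set" where
  "regular_pairs lam =
     {(m, n). 1 \<le> m \<and> m \<le> M lam \<and> 1 \<le> n \<and> n \<le> N lam - 1 \<and>
              (\<exists>z. regular_fixed_point lam m n z)}"

definition A_reg :: "real \<Rightarrow> real" where
  "A_reg lam =
     (\<Sum>(m, n) \<in> regular_pairs lam. area lam (island lam (Z lam m n)) * real (period m n))"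

text \<open>The limiting value.\<close>

definition arccot :: "real \<Rightarrow> real" where
  "arccot x = pi / 2 - arctan x"

(* Only used with a \<ge> b, so that the lower limit of integration does not exceed the upper. *)
definition I :: "real \<Rightarrow> real \<Rightarrow> real \<Rightarrow> real" where
  "I a b c = pi / 4 *
     integral {arccot (2 * a - 1)..arccot (2 * b - 1)}
       (\<lambda>eta. ((2 * c - 1) * tan eta - 1)\<^sup>2 * (pi / 4 - eta))"

definition limit_summand :: "nat \<Rightarrow> real" where
  "limit_summand m = I (real m + 1) (real m) (real m + 1) + I (real m) (real m - 1) (real m - 1)"

(* The index k + 2 makes the series start at m = 2. *)
definition A_reg_limit :: real where
  "A_reg_limit = I 2 1 2 + (\<Sum>k. limit_summand (k + 2))"

end

theory Submission
  imports Defs "HOL-Real_Asymp.Real_Asymp"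
begin

text \<open>Write \<open>lam = 2 sin \<theta>\<close>.  The linear part \<open>C\<close> is then a rotation by \<open>\<pi>/2 - \<theta>\<close> in suitable
  coordinates, so that \<open>C^4\<close> turns slowly, by \<open>- 4 \<theta>\<close>.  The first coordinates \<open>x\<^sub>t\<close> of an orbit of \<open>F\<close>
  satisfy \<open>x\<^sub>t\<^sub>+\<^sub>1 + x\<^sub>t\<^sub>-\<^sub>1 = lam x\<^sub>t + \<iota>\<^sub>t\<close> with \<open>\<iota>\<^sub>t \<in> {0, 1}\<close>, and the orbit is determined by its code \<open>\<iota>\<close>.
  On a regular orbit of parameters \<open>(m, n)\<close> the code is 1 for about \<open>4 n\<close> steps, during which the
  point turns around the centre, and then it alternates, with \<open>2 m - 1\<close> zeros at every other step.
  In each of the two phases the recurrence is solved by a constant or 2-periodic term plus a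
  cosine, and both solutions are symmetric under a time reversal.  Gluing them fixes the two
  amplitudes, and the result is an exact periodic solution of period \<open>4 (m + n) - 1\<close>
  (\<open>orbit_seq_recurrence\<close>, \<open>orbit_seq_closing\<close>).  The segments \<open>[P0 m, P1 (m-1)]\<close> and
  \<open>[Q0 (n-1), Q1 n]\<close> lie on the lines of points for which the orbit has the one or the other
  symmetry; the two lines meet in one point, and this identifies \<open>Z m n\<close> with a point of the exact
  solution (\<open>lines_meet_once\<close>).  In the first phase the values are monotone along each residue
  class of times modulo 4, in the second those near 0 oscillate with an amplitude that decreases
  towards the middle; so only two values compete for the distance \<open>r\<close> to the sides of the square
  (\<open>regular_orbit_radius\<close>).

  Let \<open>lam \<rightarrow> 0\<close> with \<open>m\<close> fixed and \<open>2 n \<theta> \<rightarrow> \<beta>\<close>, and put \<open>\<tau> = tan (\<pi>/4 - \<beta>)\<close>.  Stretched by \<open>1/lam\<close>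
  in the vertical direction, the two segments converge to segments that cross inside both if
  \<open>(2 m - 3) \<tau> < 1 < (2 m + 1) \<tau>\<close> and are disjoint if one of these inequalities is reversed.  In the
  first case \<open>r / lam\<close> tends to \<open>\<rho> = min ((2 m + 1) \<tau> - 1) (1 - (2 m - 3) \<tau>) / 4\<close> (\<open>regular_limit\<close>,
  \<open>nonregular_limit\<close>).  An island has area \<open>\<pi> (1 - lam\<^sup>2/4) r\<^sup>2\<close>, and \<open>lam\<close> times the period tends to
  \<open>4 \<beta>\<close>, so the islands of a fixed \<open>m\<close> contribute a Riemann sum for \<open>\<integral> 4 \<pi> \<beta> \<rho>\<^sup>2 d\<beta>\<close>.  The minimum
  changes its branch at \<open>cot \<eta> = 2 m - 1\<close>, where \<open>\<eta> = \<pi>/4 - \<beta>\<close>; this is why the limit is a sum of two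
  integrals \<open>I\<close>, except for \<open>m = 1\<close>, where \<open>\<beta> > 0\<close> leaves only the first branch.

  Sums and limits are interchanged by dominated convergence in \<open>\<beta>\<close> and by Tannery's theorem in \<open>m\<close>.
  Both need a bound for \<open>r\<close> that holds for all pairs, with \<open>m\<close> up to the order of \<open>1/lam\<close>.  It comes
  from the third iterate alone: \<open>F\<close> carries every regular fixed point in three steps to a distance of
  at most \<open>14 lam / m\<close> from a side of the square (\<open>island_radius_bound\<close>).  As the period is of the
  order of \<open>1/lam\<close> at most, the islands of a pair contribute at most a multiple of \<open>lam / m\<^sup>2\<close>, and there
  are fewer than \<open>1/lam\<close> values of \<open>n\<close>.\<close>

section \<open>The area of a stability ellipse\<close>

lemma Q_complete_square: "Q lam U U = (fst U - lam/2 * snd U)^2 + (1 - lam^2/4) * (snd U)^2"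
  by (simp add: Q_def power2_eq_square algebra_simps)

lemma gram_determinant:
  "Q lam (1,0) (1,0) * Q lam (0,1) (0,1) - (Q lam (1,0) (0,1))^2 = 1 - lam^2/4"
  by (simp add: Q_def power2_eq_square)

text \<open>A shear moves the horizontal slices without changing their length, so the slice at height \<open>y\<close> is
  as long as the slice of the round disc at height \<open>k * y\<close>; integrating over \<open>y\<close> gives the factor
  \<open>1 / k\<close>.\<close>
lemma emeasure_sheared_disc:
  fixes s k R :: real
  assumes "k > 0" "R \<ge> 0"
  shows "emeasure lborel {z :: real \<times> real. (fst z - s * snd z)^2 + (k * snd z)^2 \<le> R^2}
     = ennreal (pi * R^2 / k)"
proof -
  define h where "h y = emeasure lborel {x::real. x^2 + y^2 \<le> R^2}" for y :: real
  have cl: "closed {z :: real \<times> real. (fst z - s * snd z)^2 + (k * snd z)^2 \<le> R^2}" for s k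
    by (intro closed_Collect_le continuous_intros)
  have meas: "{z :: real \<times> real. (fst z - s * snd z)^2 + (k * snd z)^2 \<le> R^2} \<in> sets (lborel \<Otimes>\<^sub>M lborel)" for s k
    using borel_closed[OF cl[of s k]] unfolding lborel_prod by simp
  have slice: "emeasure lborel {x. (x - s * y)^2 + (k*y)^2 \<le> R^2} = h (k*y)" for s k y
  proof -
    have "h (k*y) = emeasure (distr lborel borel ((+) (- (s*y)))) {x::real. x^2 + (k*y)^2 \<le> R^2}"
      by (simp add: h_def lborel_distr_plus)
    also have "\<dots> = emeasure lborel {x. (x - s * y)^2 + (k*y)^2 \<le> R^2}"
    proof (subst emeasure_distr)
      show "{x::real. x^2 + (k*y)^2 \<le> R^2} \<in> sets borel"
        by (intro borel_closed closed_Collect_le continuous_intros)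
    qed (auto simp: vimage_def algebra_simps)
    finally show ?thesis by simp
  qed
  have gen: "emeasure lborel {z :: real \<times> real. (fst z - s * snd z)^2 + (k * snd z)^2 \<le> R^2}
      = (\<integral>\<^sup>+ y. h (k*y) \<partial>lborel)" for s k
  proof -
    have "emeasure lborel {z :: real \<times> real. (fst z - s * snd z)^2 + (k * snd z)^2 \<le> R^2} =
      (\<integral>\<^sup>+ y. emeasure lborel ((\<lambda>x. (x, y)) -` {z :: real \<times> real. (fst z - s * snd z)^2 + (k * snd z)^2 \<le> R^2}) \<partial>lborel)"
      using lborel_pair.emeasure_pair_measure_alt2[OF meas[of s k]] by (simp add: lborel_prod)
    then show ?thesis by (simp add: vimage_def slice)
  qed
  have hm: "h \<in> borel_measurable lborel"
  proof -
    have "(\<lambda>y. emeasure lborel ((\<lambda>x. (x, y)) -` {z :: real \<times> real. (fst z - 0 * snd z)^2 + (1 * snd z)^2 \<le> R^2})) \<in> borel_measurable lborel"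
      by (rule lborel_pair.measurable_emeasure_Pair2[OF meas])
    then show ?thesis by (simp add: h_def[abs_def] vimage_def)
  qed
  have disc: "(\<integral>\<^sup>+ y. h y \<partial>lborel) = ennreal (pi * R^2)"
  proof -
    have "{z :: real \<times> real. (fst z - 0 * snd z)^2 + (1 * snd z)^2 \<le> R^2} = cball 0 R"
      using assms by (auto simp: dist_norm norm_prod_def real_sqrt_le_iff real_le_lsqrt sqrt_le_D)
    then show ?thesis using gen[of 0 1] assms
      by (simp add: emeasure_cball unit_ball_vol_2 power2_eq_square)
  qed
  have "(\<integral>\<^sup>+ y. h y \<partial>lborel) = ennreal \<bar>k\<bar> * (\<integral>\<^sup>+ y. h (0 + k * y) \<partial>lborel)"
    by (rule nn_integral_real_affine) (use hm assms in auto)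
  then have e: "ennreal (pi * R^2) = ennreal k * (\<integral>\<^sup>+ y. h (k * y) \<partial>lborel)"
    using disc assms by simp
  have "ennreal (1/k) * ennreal (pi * R^2) = (ennreal (1/k) * ennreal k) * (\<integral>\<^sup>+ y. h (k * y) \<partial>lborel)"
    by (simp add: e mult.assoc)
  also have "ennreal (1/k) * ennreal k = 1" using assms by (simp flip: ennreal_mult)
  finally have "(\<integral>\<^sup>+ y. h (k * y) \<partial>lborel) = ennreal (1/k) * ennreal (pi * R^2)" by simp
  then show ?thesis using gen[of s k] assms by (simp flip: ennreal_mult)
qed

text \<open>In the metric of \<open>Q\<close> an island is a round disc; the square root of the Gram determinant in
  \<open>area\<close> cancels the distortion of the Euclidean area.\<close>
lemma area_island:
  assumes "0 < lam" "lam < 2"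
  shows "area lam (island lam z0) = pi * (1 - lam^2/4) * (island_radius lam z0)^2"
proof -
  define k where "k = sqrt (1 - lam^2/4)"
  have "lam * lam < 2 * 2" using assms by (intro mult_strict_mono) auto
  then have p: "1 - lam^2/4 > 0" by (simp add: power2_eq_square)
  then have k: "k > 0" "k^2 = 1 - lam^2/4" by (auto simp: k_def)
  define R where "R = k * \<bar>island_radius lam z0\<bar>"
  have R: "R \<ge> 0" "R^2 = (1 - lam^2/4) * (island_radius lam z0)^2" using k by (auto simp: R_def power_mult_distrib)
  let ?E = "{z :: real \<times> real. (fst z - lam/2 * snd z)^2 + (k * snd z)^2 \<le> R^2}"
  have isl: "island lam z0 = {z. z - z0 \<in> ?E}"
    by (auto simp: island_def Q_complete_square R(2) power_mult_distrib k(2))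
  have cl: "closed (island lam z0)"
    unfolding island_def Q_def by (intro closed_Collect_le continuous_intros)
  have "measure lborel (island lam z0) = measure (distr lborel borel ((+) z0)) (island lam z0)"
    by (simp add: lborel_distr_plus)
  also have "\<dots> = measure lborel ((+) z0 -` island lam z0)"
    by (subst measure_distr) (auto simp: borel_closed[OF cl])
  also have "(+) z0 -` island lam z0 = ?E" by (auto simp: isl)
  also have "measure lborel ?E = pi * R^2 / k"
    using emeasure_sheared_disc[OF k(1) R(1), of "lam/2"] k(1)
    unfolding measure_def by (simp del: times_divide_eq_left)
  finally have m: "measure lborel (island lam z0) = pi * R^2 / k" .
  show ?thesis unfolding area_def gram_determinant m using k(1) R(2)
    by (simp add: k_def[symmetric])
qed

section \<open>Locally convex polygons\<close>

text \<open>The oriented area of the parallelogram on \<open>u\<close> and \<open>v\<close>: it is negative if and only if \<open>v\<close> points to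
  the right of \<open>u\<close>, which is the sign for polygons that run clockwise.\<close>
definition cross :: "point \<Rightarrow> point \<Rightarrow> real" where
  "cross u v = fst u * snd v - snd u * fst v"

lemma cross_algebra:
  "cross u (v + w) = cross u v + cross u w" "cross u (v - w) = cross u v - cross u w"
  "cross u (t *\<^sub>R v) = t * cross u v" "cross u u = 0"
  by (simp_all add: cross_def algebra_simps)

lemma cross_sum_left: "(\<Sum>i\<in>A. cross (g i) q) = cross (\<Sum>i\<in>A. g i) q"
  by (simp add: cross_def fst_sum snd_sum sum_distrib_right sum_subtractf)

lemma parallel_if_cross_eq_0:
  assumes "cross e q = 0" "e \<noteq> 0"
  obtains t where "q = t *\<^sub>R e"
proof (cases "fst e = 0")
  case True
  then have "snd e \<noteq> 0" using assms(2) by (metis prod.collapse zero_prod_def)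
  then have "q = (snd q / snd e) *\<^sub>R e" using True assms(1) by (auto simp: cross_def prod_eq_iff)
  then show ?thesis using that by blast
next
  case False
  then have "q = (fst q / fst e) *\<^sub>R e" using assms(1)
    by (auto simp: cross_def prod_eq_iff field_simps)
  then show ?thesis using that by blast
qed

text \<open>A component of the complement of \<open>B\<close> that meets \<open>K\<close> cannot cross the frontier of \<open>K\<close>.\<close>
lemma bounded_subset_inside_frontier:
  fixes K B :: "'a :: euclidean_space set"
  assumes "bounded K" "frontier K \<subseteq> B"
  shows "K \<subseteq> B \<union> inside B"
proof
  fix p assume "p \<in> K"
  show "p \<in> B \<union> inside B"
  proof (cases "p \<in> B")
    case False
    let ?C = "connected_component_set (- B) p"
    have "?C \<inter> frontier K = {}"
      using connected_component_subset[of "- B" p] assms(2) by blast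
    moreover have "p \<in> ?C" using False by simp
    ultimately have "?C \<subseteq> K"
      using connected_Int_frontier[of ?C K] \<open>p \<in> K\<close> by blast
    then have "bounded ?C" using assms(1) bounded_subset by blast
    then show ?thesis using False by (simp add: inside_def)
  qed simp
qed

text \<open>The points to the right of all edges form a closed region \<open>K\<close>.  Its frontier lies on the lines
  through the edges, and a right turn at both ends of an edge cuts the line down to the edge itself.
  So \<open>K\<close> belongs to the polygon as soon as it is bounded.\<close>
lemma locally_convex_polygon:
  fixes vs :: "point list"
  defines "k \<equiv> length vs"
  defines "v \<equiv> \<lambda>i. vs ! (i mod length vs)"
  assumes turn: "\<And>i. i < length vs \<Longrightarrow> cross (v (Suc i) - v i) (v (i + 2) - v (Suc i)) < 0"
    and k: "0 < length vs"
    and p: "\<And>i. i < length vs \<Longrightarrow> cross (v (Suc i) - v i) (p - v i) \<le> 0"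
  shows "p \<in> polygon vs"
proof -
  let ?e = "\<lambda>i. v (Suc i) - v i"
  have k: "0 < k" using k by (simp add: k_def)
  have v_mod: "v (i mod k) = v i" "v (Suc (i mod k)) = v (Suc i)" "v (Suc (Suc (i mod k))) = v (Suc (Suc i))" for i
    by (simp_all add: v_def k_def mod_Suc_eq mod_Suc_Suc_eq)
  have turn: "cross (?e i) (?e (Suc i)) < 0" for i
  proof -
    have "i mod k < length vs" using k by (simp add: k_def)
    from turn[OF this] show ?thesis by (simp only: v_mod add_2_eq_Suc')
  qed
  define K where "K = {p. \<forall>i<k. cross (?e i) (p - v i) \<le> 0}"
  have K_all: "cross (?e i) (p - v i) \<le> 0" if "p \<in> K" for p i
  proof -
    have "cross (?e (i mod k)) (p - v (i mod k)) \<le> 0"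
      using that mod_less_divisor[OF k, of i] unfolding K_def mem_Collect_eq by blast
    then show ?thesis by (simp only: v_mod)
  qed
  have e_ne: "?e i \<noteq> 0" for i using turn[of i] by (auto simp: cross_def)
  \<comment> \<open>the boundary lines only contribute edges\<close>
  have edge: "p \<in> polygon_boundary vs" if pK: "p \<in> K" and zero: "cross (?e i) (p - v i) = 0" and ik: "i < k" for p i
  proof -
    obtain t where t: "p - v i = t *\<^sub>R ?e i"
      using parallel_if_cross_eq_0[OF zero e_ne] .
    define j where "j = i + (k - 1)"
    have "Suc j = i + k" using k by (simp add: j_def)
    then have j: "v (Suc j) = v i" by (simp add: v_def k_def)
    have "Suc (Suc j) = Suc i + k" using k by (simp add: j_def)
    then have j2: "v (Suc (Suc j)) = v (Suc i)"
      unfolding v_def k_def by (metis mod_add_self2)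
    have "cross (?e (Suc i)) (p - v (Suc i)) \<le> 0" by (rule K_all[OF pK])
    also have "p - v (Suc i) = (t - 1) *\<^sub>R ?e i" using t by (simp add: algebra_simps)
    also have "cross (?e (Suc i)) \<dots> = (1 - t) * cross (?e i) (?e (Suc i))"
      by (simp add: cross_def algebra_simps)
    finally have "(1 - t) * cross (?e i) (?e (Suc i)) \<le> 0" .
    then have "t \<le> 1" using turn[of i] by (simp add: mult_le_0_iff)
    have "cross (?e j) (p - v j) \<le> 0" by (rule K_all[OF pK])
    also have "p - v j = t *\<^sub>R ?e i + ?e j" using t j by (simp add: algebra_simps)
    also have "cross (?e j) \<dots> = t * cross (?e j) (?e (Suc j))"
      unfolding j j2 by (simp add: cross_def algebra_simps)
    finally have "t * cross (?e j) (?e (Suc j)) \<le> 0" .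
    then have "0 \<le> t" using turn[of j] by (simp add: mult_le_0_iff)
    have "p = (1 - t) *\<^sub>R v i + t *\<^sub>R v (Suc i)" using t by (simp add: algebra_simps)
    then have "p \<in> closed_segment (v i) (v (Suc i))"
      using \<open>t \<le> 1\<close> \<open>0 \<le> t\<close> by (auto simp: closed_segment_def)
    moreover have "v i = vs ! i" "v (Suc i) = vs ! (Suc i mod length vs)"
      using ik by (simp_all add: v_def k_def)
    ultimately show ?thesis using ik by (auto simp: polygon_boundary_def k_def)
  qed
  have cont: "continuous_on UNIV (\<lambda>p. cross (?e i) (p - v i))" for i
    unfolding cross_def by (intro continuous_intros)
  have closed: "closed K"
  proof -
    have "K = (\<Inter>i\<in>{..<k}. {p. cross (?e i) (p - v i) \<le> 0})" by (auto simp: K_def)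
    then show ?thesis by (auto intro!: closed_INT closed_Collect_le cont continuous_on_const)
  qed
  have "frontier K \<subseteq> polygon_boundary vs"
  proof
    fix p assume pf: "p \<in> frontier K"
    then have pK: "p \<in> K" using closed by (simp add: frontier_def)
    show "p \<in> polygon_boundary vs"
    proof (cases "\<exists>i<k. cross (?e i) (p - v i) = 0")
      case True
      then show ?thesis using edge[OF pK] by blast
    next
      case False
      let ?U = "\<Inter>i\<in>{..<k}. {p. cross (?e i) (p - v i) < 0}"
      have "open ?U" by (intro open_INT ballI open_Collect_less cont) auto
      moreover have "p \<in> ?U" using False K_all[OF pK] by (force simp: less_le)
      moreover have "?U \<subseteq> K" by (auto simp: K_def less_imp_le)
      ultimately have "p \<in> interior K" by (rule interiorI)
      then show ?thesis using pf by (simp add: frontier_def)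
    qed
  qed
  moreover have "bounded K"
  proof -
    \<comment> \<open>the edges sum to zero, so the sum of the defining functionals is constant\<close>
    have sum_e: "(\<Sum>i<k. ?e i) = 0"
      using sum_lessThan_telescope[of v k] by (simp add: v_def k_def)
    define S where "S = (\<Sum>i<k. cross (?e i) (v i))"
    have const: "(\<Sum>i<k. cross (?e i) (q - v i)) = - S" for q
    proof -
      have "(\<Sum>i<k. cross (?e i) (q - v i)) = (\<Sum>i<k. cross (?e i) q) - S"
        unfolding cross_algebra(2) sum_subtractf S_def ..
      also have "(\<Sum>i<k. cross (?e i) q) = cross (\<Sum>i<k. ?e i) q"
        by (rule cross_sum_left)
      finally show ?thesis by (simp add: sum_e cross_def)
    qed
    have bd: "\<bar>cross (?e i) (q - v i)\<bar> \<le> S" if "q \<in> K" for q i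
    proof -
      have "- cross (?e (i mod k)) (q - v (i mod k)) \<le> (\<Sum>i<k. - cross (?e i) (q - v i))"
        by (rule member_le_sum) (use K_all[OF that] k in auto)
      then have "- cross (?e i) (q - v i) \<le> S"
        by (simp only: v_mod sum_negf const minus_minus)
      then show ?thesis using K_all[OF that, of i] by simp
    qed
    let ?d = "\<bar>cross (?e 0) (?e 1)\<bar>"
    have d: "?d > 0" using turn[of 0] by simp
    define R where "R = (S + \<bar>cross (?e 0) (v 0)\<bar>) * norm (?e 1) + (S + \<bar>cross (?e 1) (v 1)\<bar>) * norm (?e 0)"
    have "norm q \<le> R / ?d" if "q \<in> K" for q
    proof -
      have "cross (?e 0) (?e 1) *\<^sub>R q = cross (?e 0) q *\<^sub>R ?e 1 - cross (?e 1) q *\<^sub>R ?e 0"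
        by (simp add: cross_def prod_eq_iff algebra_simps)
      then have "?d * norm q = norm (cross (?e 0) q *\<^sub>R ?e 1 - cross (?e 1) q *\<^sub>R ?e 0)"
        by (metis norm_scaleR)
      also have "\<dots> \<le> \<bar>cross (?e 0) q\<bar> * norm (?e 1) + \<bar>cross (?e 1) q\<bar> * norm (?e 0)"
        by (metis norm_scaleR norm_triangle_ineq4)
      also have "\<dots> \<le> R"
      proof -
        have "\<bar>cross (?e i) q\<bar> \<le> S + \<bar>cross (?e i) (v i)\<bar>" for i
          using bd[OF that, of i] unfolding cross_algebra by arith
        then show ?thesis
          unfolding R_def by (intro add_mono mult_right_mono) auto
      qed
      finally show ?thesis using d by (simp add: field_simps)
    qed
    then show ?thesis unfolding bounded_iff by blast
  qed
  moreover have "p \<in> K" using p by (simp add: K_def k_def)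
  ultimately show ?thesis
    using bounded_subset_inside_frontier unfolding polygon_def by blast
qed

lemma cross_nonpos_on_segment:
  assumes "p \<in> closed_segment x y" "cross e (x - w) \<le> 0" "cross e (y - w) \<le> 0"
  shows "cross e (p - w) \<le> 0"
proof -
  from assms(1) obtain t where t: "0 \<le> t" "t \<le> 1" "p = (1 - t) *\<^sub>R x + t *\<^sub>R y"
    by (auto simp: closed_segment_def)
  have "cross e (p - w) = (1 - t) * cross e (x - w) + t * cross e (y - w)"
    unfolding t(3) by (simp add: cross_def algebra_simps)
  also have "\<dots> \<le> 0"
    using t assms(2,3) by (intro add_nonpos_nonpos mult_nonneg_nonpos) auto
  finally show ?thesis .
qed

text \<open>With four right turns each vertex is to the right of all four edges, hence so is a diagonal.\<close>
lemma diagonal_in_polygon4: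
  assumes t: "cross (b - a) (c - b) < 0" "cross (c - b) (d - c) < 0"
    "cross (d - c) (a - d) < 0" "cross (a - d) (b - a) < 0"
    and p: "p \<in> closed_segment a c \<or> p \<in> closed_segment b d"
  shows "p \<in> polygon [a, b, c, d]"
proof (rule locally_convex_polygon)
  fix i assume "i < length [a, b, c, d]"
  then have i: "i = 0 \<or> i = 1 \<or> i = 2 \<or> i = 3" by auto
  show "cross ([a,b,c,d] ! (Suc i mod length [a,b,c,d]) - [a,b,c,d] ! (i mod length [a,b,c,d]))
      ([a,b,c,d] ! ((i + 2) mod length [a,b,c,d]) - [a,b,c,d] ! (Suc i mod length [a,b,c,d])) < 0"
    using i t by (elim disjE) simp_all
  have side: "cross e (p - w) \<le> 0"
    if "cross e (a - w) \<le> 0" "cross e (b - w) \<le> 0" "cross e (c - w) \<le> 0" "cross e (d - w) \<le> 0"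
    for e w
    using p that cross_nonpos_on_segment by metis
  have "cross (b - a) (p - a) \<le> 0" "cross (c - b) (p - b) \<le> 0"
    "cross (d - c) (p - c) \<le> 0" "cross (a - d) (p - d) \<le> 0"
    by (rule side; use t in \<open>simp add: cross_def algebra_simps\<close>)+
  then show "cross ([a,b,c,d] ! (Suc i mod length [a,b,c,d]) - [a,b,c,d] ! (i mod length [a,b,c,d]))
      (p - [a,b,c,d] ! (i mod length [a,b,c,d])) \<le> 0"
    using i by (elim disjE) simp_all
qed simp

text \<open>The right turns put \<open>a\<close> to the right of the edges that start or end in it and of the next edge on
  either side, and likewise \<open>d\<close>; the assumptions \<open>u\<close> are for the two remaining edges of each.\<close>
lemma diagonal_in_polygon6:
  assumes t: "cross (b - a) (c - b) < 0" "cross (c - b) (d - c) < 0"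
    "cross (d - c) (e - d) < 0" "cross (e - d) (f - e) < 0"
    "cross (f - e) (a - f) < 0" "cross (a - f) (b - a) < 0"
    and u: "cross (d - c) (a - c) \<le> 0" "cross (e - d) (a - d) \<le> 0"
      "cross (b - a) (d - a) \<le> 0" "cross (a - f) (d - f) \<le> 0"
    and p: "p \<in> closed_segment a d"
  shows "p \<in> polygon [a, b, c, d, e, f]"
proof (rule locally_convex_polygon)
  let ?L = "[a, b, c, d, e, f]"
  fix i assume "i < length ?L"
  then have i: "i = 0 \<or> i = 1 \<or> i = 2 \<or> i = 3 \<or> i = 4 \<or> i = 5" by auto
  show "cross (?L ! (Suc i mod length ?L) - ?L ! (i mod length ?L))
      (?L ! ((i + 2) mod length ?L) - ?L ! (Suc i mod length ?L)) < 0"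
    using i t by (elim disjE) simp_all
  have "cross (b - a) (p - a) \<le> 0" "cross (c - b) (p - b) \<le> 0"
    "cross (d - c) (p - c) \<le> 0" "cross (e - d) (p - d) \<le> 0" 
    "cross (f - e) (p - e) \<le> 0" "cross (a - f) (p - f) \<le> 0"
    by (rule cross_nonpos_on_segment[OF p]; use t u in \<open>simp add: cross_def algebra_simps\<close>)+
  then show "cross (?L ! (Suc i mod length ?L) - ?L ! (i mod length ?L))
      (p - ?L ! (i mod length ?L)) \<le> 0"
    using i by (elim disjE) simp_all
qed simp

section \<open>Periodic orbits in closed form\<close>

lemma F_step:
  assumes "x' = lam * x - y + of_int i" "0 \<le> x'" "x' < 1"
  shows "F lam (x, y) = (x', x)"
proof -
  have "\<lfloor>lam * x - y\<rfloor> = - i" using assms by (intro floor_unique) auto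
  then show ?thesis using assms by (simp add: F_def)
qed

text \<open>\<open>F\<close> maps a pair of consecutive values of the recurrence to the next pair as long as the values
  stay in \<open>[0, 1)\<close>, because the integer in the recurrence is then forced to be the one that \<open>F\<close> adds.\<close>
lemma orbit_of_periodic_sequence:
  fixes s :: "nat \<Rightarrow> real"
  assumes rec: "\<And>j. j < T \<Longrightarrow> \<exists>i::int. s (Suc (Suc j)) = lam * s (Suc j) - s j + of_int i"
    and range: "\<And>j. j < T \<Longrightarrow> 0 \<le> s j \<and> s j < 1"
    and closing: "s T = s 0" "s (Suc T) = s 1"
    and T: "1 < T" and p: "p < T"
  shows "orbit lam (s (Suc p), s p) = (\<lambda>j. (s (Suc j), s j)) ` {..<T}"
proof -
  define w where "w j = (s (Suc j), s j)" for j
  have bd: "0 \<le> s j \<and> s j < 1" if jT: "j \<le> Suc T" for j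
  proof -
    consider "j < T" | "j = T" | "j = Suc T" using jT by linarith
    then show ?thesis by cases (use range closing T in auto)
  qed
  have step: "F lam (w j) = w (Suc j)" if j: "j < T" for j
  proof -
    obtain i :: int where i: "s (Suc (Suc j)) = lam * s (Suc j) - s j + of_int i"
      using rec[OF j] by blast
    show ?thesis unfolding w_def by (rule F_step[OF i]) (use bd[of "Suc (Suc j)"] j in auto)
  qed
  have wT: "w T = w 0" using closing by (simp add: w_def)
  have iter: "(F lam ^^ k) (w p) = w ((p + k) mod T)" for k
  proof (induction k)
    case (Suc k)
    have "(F lam ^^ Suc k) (w p) = w (Suc ((p + k) mod T))"
      using step[of "(p + k) mod T"] Suc T by simp
    also have "\<dots> = w ((p + Suc k) mod T)"
      using wT by (simp add: mod_Suc)
    finally show ?case .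
  qed (use p in simp)
  have "orbit lam (w p) = w ` {..<T}"
  proof (intro equalityI subsetI)
    fix q assume "q \<in> w ` {..<T}"
    then obtain j where j: "j < T" "q = w j" by auto
    have "(p + (T - p + j)) mod T = j" using p j by simp
    then have "q = (F lam ^^ (T - p + j)) (w p)" using iter j by simp
    then show "q \<in> orbit lam (w p)" by (auto simp: orbit_def)
  qed (use T in \<open>auto simp: orbit_def iter\<close>)
  then show ?thesis by (simp add: w_def[abs_def])
qed

lemma island_radius_of_periodic_sequence:
  fixes s :: "nat \<Rightarrow> real"
  assumes rec: "\<And>j. j < T \<Longrightarrow> \<exists>i::int. s (Suc (Suc j)) = lam * s (Suc j) - s j + of_int i"
    and closing: "s T = s 0" "s (Suc T) = s 1"
    and T: "1 < T" and p: "p < T"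
    and r: "0 < r" "\<And>j. j < T \<Longrightarrow> r \<le> s j \<and> r \<le> 1 - s j"
    and att: "q < T" "s q = r \<or> 1 - s q = r"
  shows "island_radius lam (s (Suc p), s p) = r"
proof -
  have "orbit lam (s (Suc p), s p) = (\<lambda>j. (s (Suc j), s j)) ` {..<T}"
  proof (rule orbit_of_periodic_sequence[OF rec _ closing T p])
    show "0 \<le> s j \<and> s j < 1" if "j < T" for j using r(1) r(2)[OF that] by linarith
  qed
  then have "island_radius lam (s (Suc p), s p) = Inf ((\<lambda>j. min (s (Suc j)) (1 - s (Suc j))) ` {..<T})"
    by (simp add: island_radius_def image_image)
  also have "\<dots> = r"
  proof (rule cInf_eq_minimum)
    define q' where "q' = (if q = 0 then T - 1 else q - 1)"
    have "q' < T" "s (Suc q') = s q" using T att closing by (auto simp: q'_def)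
    moreover have "min (s q) (1 - s q) = r" using att r(2)[OF att(1)] by auto
    ultimately show "r \<in> (\<lambda>j. min (s (Suc j)) (1 - s (Suc j))) ` {..<T}" by force
  next
    fix x assume "x \<in> (\<lambda>j. min (s (Suc j)) (1 - s (Suc j))) ` {..<T}"
    then obtain j where j: "j < T" "x = min (s (Suc j)) (1 - s (Suc j))" by auto
    show "r \<le> x"
    proof (cases "Suc j = T")
      case True
      then show ?thesis using j r(2)[of 0] closing T by simp
    next
      case False
      then show ?thesis using j r(2)[of "Suc j"] by simp
    qed
  qed
  finally show ?thesis .
qed

text \<open>For \<open>lam = 2 sin th\<close> this is \<open>1 / (2 - lam)\<close>, the coordinate of the centre.\<close>
definition centre_coord :: "real \<Rightarrow> real" where "centre_coord th = (1 + sin th) / (2 * (cos th)^2)"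

text \<open>The first phase of the orbit is centred at the fixed point of the recurrence with code 1.  The
  sine in the denominator is, up to sign, that of half the total angle \<open>(4 (m + n) - 1) (\<pi>/2 - th)\<close>
  of one period.  The index \<open>j\<close> starts four steps before the fixed point, which is the pair of values
  at \<open>j = 4\<close> and \<open>j = 3\<close>, and the formula is symmetric under \<open>j \<mapsto> 4 n + 3 - j\<close>.\<close>
definition amplitude :: "real \<Rightarrow> nat \<Rightarrow> nat \<Rightarrow> real" where
  "amplitude th m n = cos ((2 * real m - 1) * th)
     / (2 * (cos th)^2 * sin (pi/4 + (2 * real n + 2 * real m - 1/2) * th))"

definition in_seq :: "real \<Rightarrow> nat \<Rightarrow> nat \<Rightarrow> nat \<Rightarrow> real" where
  "in_seq th m n j = centre_coord th + amplitude th m n * cos (real j * (pi/2 - th) + (pi/4 + (2 * real n + 3/2) * th))"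

text \<open>In the second phase the code alternates, and the 2-periodic solution of the recurrence takes the
  values \<open>sin th / (2 cos\<^sup>2 th)\<close>, which is of the order of \<open>lam\<close>, and \<open>1 / (2 cos\<^sup>2 th)\<close>.  The general
  solution adds a multiple of a cosine in the angle \<open>\<pi>/2 - th\<close>; evaluated at even and at odd steps
  from the centre of symmetry it becomes the alternating cosine of \<open>out_odd\<close> and the alternating sine
  of \<open>out_even\<close>.\<close>
definition out_amplitude :: "real \<Rightarrow> nat \<Rightarrow> nat \<Rightarrow> real" where
  "out_amplitude th m n = (sin th / (2 * (cos th)^2) + amplitude th m n * cos (pi/4 + (2 * real n + 3/2) * th))
     / cos ((2 * real m - 2) * th)"

definition out_even :: "real \<Rightarrow> nat \<Rightarrow> nat \<Rightarrow> nat \<Rightarrow> real" where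
  "out_even th m n k = sin th / (2 * (cos th)^2) + (-1)^k * out_amplitude th m n * sin ((2 * real m - 1 - 2 * real k) * th)"

definition out_odd :: "real \<Rightarrow> nat \<Rightarrow> nat \<Rightarrow> nat \<Rightarrow> real" where
  "out_odd th m n k = 1 / (2 * (cos th)^2) + (-1)^k * out_amplitude th m n * cos ((2 * real m - 2 - 2 * real k) * th)"

text \<open>The two phases overlap in the indices \<open>4 n + 2\<close> and \<open>4 n + 3\<close>, and again, modulo the period, in 0
  and 1; a second-order recurrence continues across such an overlap.\<close>
definition orbit_seq :: "real \<Rightarrow> nat \<Rightarrow> nat \<Rightarrow> nat \<Rightarrow> real" where
  "orbit_seq th m n j =
     (if j \<le> 4 * n + 3 then in_seq th m n j
      else if even j then out_even th m n ((j - (4 * n + 2)) div 2)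
      else out_odd th m n ((j - (4 * n + 3)) div 2))"

lemma centre_coord_eq:
  assumes "cos th \<noteq> 0"
  shows "centre_coord th * (2 - 2 * sin th) = 1"
proof -
  have "centre_coord th * (2 - 2 * sin th) = (1 - (sin th)^2) / (cos th)^2"
    by (simp add: centre_coord_def power2_eq_square algebra_simps add_divide_distrib diff_divide_distrib)
  then show ?thesis using assms by (simp add: cos_squared_eq[symmetric])
qed

lemma in_seq_rec:
  assumes "cos th \<noteq> 0"
  shows "in_seq th m n (Suc (Suc j)) = 2 * sin th * in_seq th m n (Suc j) - in_seq th m n j + 1"
proof -
  define A where "A = real (Suc j) * (pi/2 - th) + (pi/4 + (2 * real n + 3/2) * th)"
  have cA: "cos (A + (pi/2 - th)) + cos (A - (pi/2 - th)) = 2 * sin th * cos A"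
  proof -
    have "cos (pi/2 - th) = sin th" by (simp add: cos_diff)
    then show ?thesis unfolding cos_add[of A "pi/2 - th"] cos_diff[of A "pi/2 - th"] by simp
  qed
  have arg: "real (Suc (Suc j)) * (pi/2 - th) + (pi/4 + (2 * real n + 3/2) * th) = A + (pi/2 - th)"
    "real j * (pi/2 - th) + (pi/4 + (2 * real n + 3/2) * th) = A - (pi/2 - th)"
    by (simp_all add: A_def field_simps)
  have "in_seq th m n (Suc (Suc j)) + in_seq th m n j
      = 2 * centre_coord th + amplitude th m n * (cos (A + (pi/2 - th)) + cos (A - (pi/2 - th)))"
    unfolding in_seq_def arg by (simp only: distrib_left mult_2 add_ac)
  also have "\<dots> = 2 * sin th * (centre_coord th + amplitude th m n * cos A) + centre_coord th * (2 - 2 * sin th)"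
    unfolding cA by (simp only: algebra_simps)
  finally show ?thesis unfolding centre_coord_eq[OF assms] in_seq_def A_def by linarith
qed

text \<open>Four steps of the recurrence turn by \<open>2 \<pi> - 4 th\<close>, so within a residue class modulo 4 the angle
  moves slowly and monotonically.\<close>
lemma in_seq_mod4:
  "in_seq th m n (4*q) = centre_coord th + amplitude th m n * cos (pi/4 + (2 * real n + 3/2 - 4 * real q) * th)" (is ?A)
  "in_seq th m n (4*q+1) = centre_coord th - amplitude th m n * sin (pi/4 + (2 * real n + 1/2 - 4 * real q) * th)" (is ?B)
  "in_seq th m n (4*q+2) = centre_coord th - amplitude th m n * cos (pi/4 + (2 * real n - 1/2 - 4 * real q) * th)" (is ?C)
  "in_seq th m n (4*q+3) = centre_coord th + amplitude th m n * sin (pi/4 + (2 * real n - 3/2 - 4 * real q) * th)" (is ?D)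
proof -
  have per: "cos (x + real q * (2 * pi)) = cos x" for x :: real
    using cos_2npi[of q] sin_2npi[of q] by (simp add: cos_add mult_ac)
  have e: "real (4*q+i) * (pi/2 - th) + (pi/4 + (2 * real n + 3/2) * th)
     = (pi/4 + (2 * real n + 3/2 - real i - 4 * real q) * th + real i * (pi/2)) + real q * (2 * pi)" for i
    by (simp add: algebra_simps)
  have g: "in_seq th m n (4*q+i) = centre_coord th + amplitude th m n *
     cos (pi/4 + (2 * real n + 3/2 - real i - 4 * real q) * th + real i * (pi/2))" for i
    unfolding in_seq_def e per ..
  show ?A using g[of 0] by simp
  have h: "cos (x + pi/2) = - sin x" "cos (x + 2 * (pi/2)) = - cos x" "cos (x + 3 * (pi/2)) = sin x" for x :: real
  proof -
    show "cos (x + pi/2) = - sin x" "cos (x + 2 * (pi/2)) = - cos x" by (simp_all add: cos_add)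
    have e: "x + 3 * (pi/2) = (x + pi/2) + pi" by (simp add: field_simps)
    show "cos (x + 3 * (pi/2)) = sin x" unfolding e cos_add[of "x + pi/2" pi] by (simp add: cos_add)
  qed
  have e1: "2 * real n + 3/2 - 1 - 4 * real q = 2 * real n + 1/2 - 4 * real q" by simp
  show ?B using g[of 1] unfolding of_nat_1 mult_1_left e1 h(1)
    by (simp only: mult_minus_right add_uminus_conv_diff)
  have e2: "2 * real n + 3/2 - 2 - 4 * real q = 2 * real n - 1/2 - 4 * real q" by simp
  show ?C using g[of 2] unfolding of_nat_numeral e2 h(2)
    by (simp only: mult_minus_right add_uminus_conv_diff)
  have e3: "2 * real n + 3/2 - 3 - 4 * real q = 2 * real n - 3/2 - 4 * real q" by simp
  show ?D using g[of 3] unfolding of_nat_numeral e3 h(3) .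
qed

lemma out_rec:
  assumes "cos th \<noteq> 0"
  shows "out_even th m n (Suc k) = 2 * sin th * out_odd th m n k - out_even th m n k"
    and "out_odd th m n (Suc k) = 2 * sin th * out_even th m n (Suc k) - out_odd th m n k + 1"
proof -
  define x where "x = (2 * real m - 2 - 2 * real k) * th"
  have x: "(2 * real m - 1 - 2 * real k) * th = x + th"
    "(2 * real m - 1 - 2 * real (Suc k)) * th = x - th"
    "(2 * real m - 2 - 2 * real (Suc k)) * th = (x - th) - th"
    by (simp_all add: x_def algebra_simps)
  have c2: "cos ((x - th) - th) = 2 * cos th * cos (x - th) - cos x"
    using cos_add[of "x - th" th] cos_diff[of "x - th" th] by simp
  have s: "sin (x - th) = sin x * cos th - cos x * sin th" "sin (x + th) = sin x * cos th + cos x * sin th"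
    by (simp_all add: sin_diff sin_add)
  show "out_even th m n (Suc k) = 2 * sin th * out_odd th m n k - out_even th m n k"
    unfolding out_even_def out_odd_def x x_def[symmetric] s by (simp add: algebra_simps)
  have c3: "cos x - cos ((x - th) - th) = - 2 * sin th * sin (x - th)"
    using cos_add[of "x - th" th] cos_diff[of "x - th" th] by simp
  have o: "2 * (1 / (2 * (cos th)^2)) = 2 * sin th * (sin th / (2 * (cos th)^2)) + 1"
    using assms sin_squared_eq[of th] by (simp add: field_simps power2_eq_square)
  have "out_odd th m n k + out_odd th m n (Suc k) = 2 * (1 / (2 * (cos th)^2)) +
     (-1)^k * out_amplitude th m n * (cos x - cos ((x - th) - th))"
    unfolding out_odd_def x x_def[symmetric] by (simp add: algebra_simps)
  also have "\<dots> = 2 * sin th * out_even th m n (Suc k) + 1"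
    unfolding o c3 out_even_def x by (simp add: algebra_simps)
  finally show "out_odd th m n (Suc k) = 2 * sin th * out_even th m n (Suc k) - out_odd th m n k + 1" by simp
qed

text \<open>The two gluing conditions at one overlap are linear in the two amplitudes.  The definition of
  \<open>out_amplitude\<close> solves the first one, and \<open>amplitude\<close> is the value for which the second one holds as
  well.\<close>
lemma glue_identity:
  assumes "cos th \<noteq> 0" "cos ((2 * real m - 2) * th) \<noteq> 0"
    "sin (pi/4 + (2 * real n + 2 * real m - 1/2) * th) \<noteq> 0"
  shows "centre_coord th - amplitude th m n * sin (pi/4 + (2 * real n + 1/2) * th)
    = sin th / (2 * (cos th)^2) + out_amplitude th m n * sin ((2 * real m - 1) * th)"
proof -
  define X where "X = (2 * real m - 2) * th"
  define Y where "Y = pi/4 + (2 * real n + 1/2) * th"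
  define W where "W = X + Y + th"
  have e: "(2 * real m - 1) * th = X + th" "pi/4 + (2 * real n + 3/2) * th = Y + th"
    "pi/4 + (2 * real n + 2 * real m - 1/2) * th = W"
    by (simp_all add: W_def X_def Y_def algebra_simps)
  have A: "amplitude th m n * (cos X * sin Y + sin (X + th) * cos (Y + th)) = cos (X + th) / (2 * cos th)"
  proof -
    have "cos X * sin Y + sin (X + th) * cos (Y + th) = sin W * cos th"
    proof -
      have s2: "sin th * sin th = 1 - cos th * cos th" using sin_squared_eq[of th] by (simp add: power2_eq_square)
      have "sin W * cos th = (sin (X + th) * cos Y + cos (X + th) * sin Y) * cos th"
        using sin_add[of "X + th" Y] by (simp add: W_def algebra_simps)
      also have "\<dots> = sin (X + th) * (cos Y * cos th) + (cos (X + th) * cos th) * sin Y" by (simp add: algebra_simps)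
      also have "cos Y * cos th = cos (Y + th) + sin Y * sin th" by (simp add: cos_add)
      also have "cos (X + th) * cos th = cos X - sin (X + th) * sin th"
        using cos_diff[of "X + th" th] by simp
      finally show ?thesis by (simp add: algebra_simps)
    qed
    then show ?thesis using assms unfolding amplitude_def e X_def[symmetric]
      by (simp add: field_simps power2_eq_square)
  qed
  have B: "cos X - sin th * sin (X + th) = cos th * cos (X + th)"
    using cos_diff[of "X + th" th] by (simp add: algebra_simps)
  have cX: "cos X \<noteq> 0" using assms by (simp add: X_def)
  have bbX: "out_amplitude th m n * cos X = sin th / (2 * (cos th)^2) + amplitude th m n * cos (Y + th)"
    using cX by (simp add: out_amplitude_def e X_def[symmetric])
  have "(centre_coord th - amplitude th m n * sin Y - sin th / (2 * (cos th)^2) - out_amplitude th m n * sin (X + th)) * cos X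
     = (1 / (2 * (cos th)^2)) * (cos X - sin th * sin (X + th))
       - amplitude th m n * (cos X * sin Y + sin (X + th) * cos (Y + th))"
  proof -
    have "(centre_coord th - amplitude th m n * sin Y - sin th / (2 * (cos th)^2) - out_amplitude th m n * sin (X + th)) * cos X
      = (centre_coord th - sin th / (2 * (cos th)^2)) * cos X - amplitude th m n * sin Y * cos X - (out_amplitude th m n * cos X) * sin (X + th)"
      by (simp add: algebra_simps)
    also have "centre_coord th - sin th / (2 * (cos th)^2) = 1 / (2 * (cos th)^2)"
      by (simp add: centre_coord_def add_divide_distrib)
    finally show ?thesis unfolding bbX by (simp add: algebra_simps diff_divide_distrib)
  qed
  also have "\<dots> = 0" unfolding A B using assms by (simp add: power2_eq_square)
  finally show ?thesis using cX unfolding e Y_def[symmetric] by simp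
qed


lemma orbit_seq_low: "j \<le> 4 * n + 3 \<Longrightarrow> orbit_seq th m n j = in_seq th m n j"
  by (simp add: orbit_seq_def)

lemma orbit_seq_high:
  assumes "orbit_seq th m n (4 * n + 2) = out_even th m n 0" "orbit_seq th m n (4 * n + 3) = out_odd th m n 0"
  shows "orbit_seq th m n (4 * n + 2 + 2 * k) = out_even th m n k" "orbit_seq th m n (4 * n + 3 + 2 * k) = out_odd th m n k"
proof -
  show "orbit_seq th m n (4 * n + 2 + 2 * k) = out_even th m n k"
  proof (cases "k = 0")
    case False
    have "(4 * n + 2 + 2 * k - (4 * n + 2)) div 2 = k" by simp
    then show ?thesis using False by (simp add: orbit_seq_def)
  qed (use assms in simp)
  show "orbit_seq th m n (4 * n + 3 + 2 * k) = out_odd th m n k"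
  proof (cases "k = 0")
    case False
    have "(4 * n + 3 + 2 * k - (4 * n + 3)) div 2 = k" by simp
    then show ?thesis using False by (simp add: orbit_seq_def)
  qed (use assms in simp)
qed

lemma out_odd_0:
  assumes "cos ((2 * real m - 2) * th) \<noteq> 0"
  shows "out_odd th m n 0 = centre_coord th + amplitude th m n * cos (pi/4 + (2 * real n + 3/2) * th)"
proof -
  have "out_amplitude th m n * cos ((2 * real m - 2) * th)
      = sin th / (2 * (cos th)^2) + amplitude th m n * cos (pi/4 + (2 * real n + 3/2) * th)"
    using assms by (simp add: out_amplitude_def)
  then show ?thesis by (simp add: out_odd_def centre_coord_def add_divide_distrib)
qed

lemma orbit_seq_junction:
  assumes "cos th \<noteq> 0" "cos ((2 * real m - 2) * th) \<noteq> 0"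
    "sin (pi/4 + (2 * real n + 2 * real m - 1/2) * th) \<noteq> 0"
  shows "orbit_seq th m n (4 * n + 2) = out_even th m n 0" "orbit_seq th m n (4 * n + 3) = out_odd th m n 0"
    "in_seq th m n 0 = out_odd th m n 0" "in_seq th m n 1 = out_even th m n 0"
proof -
  have refl: "cos (pi/4 + (x - 4 * real n) * th) = sin (pi/4 + (4 * real n - x) * th)"
    "sin (pi/4 + (x - 4 * real n) * th) = cos (pi/4 + (4 * real n - x) * th)" for x
    using cos_sin_eq[of "pi/4 + (x - 4 * real n) * th"] sin_cos_eq[of "pi/4 + (x - 4 * real n) * th"]
    by (simp_all add: algebra_simps)
  have E: "out_even th m n 0 = centre_coord th - amplitude th m n * sin (pi/4 + (2 * real n + 1/2) * th)"
    using glue_identity[OF assms] by (simp add: out_even_def)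
  have e: "4 * real n - (2 * real n - 1/2) = 2 * real n + 1/2" "4 * real n - (2 * real n - 3/2) = 2 * real n + 3/2"
    by simp_all
  have "in_seq th m n (4 * n + 2) = centre_coord th - amplitude th m n * sin (pi/4 + (2 * real n + 1/2) * th)"
    "in_seq th m n (4 * n + 3) = centre_coord th + amplitude th m n * cos (pi/4 + (2 * real n + 3/2) * th)"
    unfolding in_seq_mod4(3,4) refl e by simp_all
  then show "orbit_seq th m n (4 * n + 2) = out_even th m n 0" "orbit_seq th m n (4 * n + 3) = out_odd th m n 0"
    unfolding E out_odd_0[OF assms(2)] by (simp_all add: orbit_seq_def)
  show "in_seq th m n 0 = out_odd th m n 0" "in_seq th m n 1 = out_even th m n 0"
    using in_seq_mod4(1,2)[of th m n 0] unfolding E out_odd_0[OF assms(2)] by simp_all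
qed

lemma orbit_seq_recurrence:
  assumes "cos th \<noteq> 0" "cos ((2 * real m - 2) * th) \<noteq> 0"
    "sin (pi/4 + (2 * real n + 2 * real m - 1/2) * th) \<noteq> 0"
  shows "\<exists>i::int. orbit_seq th m n (Suc (Suc j)) = 2 * sin th * orbit_seq th m n (Suc j) - orbit_seq th m n j + of_int i"
proof -
  note high = orbit_seq_high[OF orbit_seq_junction(1,2)[OF assms]]
  have "j \<le> 4 * n + 1 \<or> (\<exists>k. j = 4 * n + 2 + 2 * k) \<or> (\<exists>k. j = 4 * n + 3 + 2 * k)"
    by presburger
  then consider "j \<le> 4 * n + 1" | k where "j = 4 * n + 2 + 2 * k" | k where "j = 4 * n + 3 + 2 * k"
    by blast
  then show ?thesis
  proof cases
    case 1
    then show ?thesis using in_seq_rec[OF assms(1), of m n j] by (intro exI[of _ 1]) (simp add: orbit_seq_low)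
  next
    case (2 k)
    then have "Suc j = 4 * n + 3 + 2 * k" "Suc (Suc j) = 4 * n + 2 + 2 * Suc k" by simp_all
    then show ?thesis using 2 out_rec(1)[OF assms(1), of m n k] high
      by (intro exI[of _ 0]) (metis add.right_neutral of_int_0)
  next
    case (3 k)
    then have "Suc j = 4 * n + 2 + 2 * Suc k" "Suc (Suc j) = 4 * n + 3 + 2 * Suc k" by simp_all
    then show ?thesis using 3 out_rec(2)[OF assms(1), of m n k] high
      by (intro exI[of _ 1]) (metis of_int_1)
  qed
qed

text \<open>Both phases are symmetric, so the overlap at the end of the period mirrors the one at
  \<open>4 n + 2, 4 n + 3\<close>.\<close>
lemma orbit_seq_closing:
  assumes "cos th \<noteq> 0" "cos ((2 * real m - 2) * th) \<noteq> 0"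
    "sin (pi/4 + (2 * real n + 2 * real m - 1/2) * th) \<noteq> 0" "1 \<le> m"
  shows "orbit_seq th m n (4 * (m + n) - 1) = orbit_seq th m n 0" "orbit_seq th m n (Suc (4 * (m + n) - 1)) = orbit_seq th m n 1"
proof -
  note J = orbit_seq_junction[OF assms(1-3)]
  note high = orbit_seq_high[OF J(1,2)]
  define k where "k = m - 1"
  have m: "m = Suc k" using assms(4) by (simp add: k_def)
  have i: "4 * (m + n) - 1 = 4 * n + 3 + 2 * (2 * k)" "Suc (4 * (m + n) - 1) = 4 * n + 2 + 2 * Suc (2 * k)"
    by (simp_all add: m)
  have "out_odd th m n (2 * k) = out_odd th m n 0"
  proof -
    have "(2 * real m - 2 - 2 * real (2 * k)) * th = - ((2 * real m - 2) * th)" by (simp add: m algebra_simps)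
    then have "cos ((2 * real m - 2 - 2 * real (2 * k)) * th) = cos ((2 * real m - 2) * th)" by simp
    then show ?thesis by (simp add: out_odd_def)
  qed
  then show "orbit_seq th m n (4 * (m + n) - 1) = orbit_seq th m n 0"
    unfolding i high by (simp add: orbit_seq_def J(3))
  have "out_even th m n (Suc (2 * k)) = out_even th m n 0"
  proof -
    have "(2 * real m - 1 - 2 * real (Suc (2 * k))) * th = - ((2 * real m - 1) * th)" by (simp add: m algebra_simps)
    then have "sin ((2 * real m - 1 - 2 * real (Suc (2 * k))) * th) = - sin ((2 * real m - 1) * th)" by simp
    then show ?thesis by (simp add: out_even_def)
  qed
  then show "orbit_seq th m n (Suc (4 * (m + n) - 1)) = orbit_seq th m n 1"
    unfolding i high by (simp add: orbit_seq_def J(4)[simplified])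
qed

text \<open>As the angle stays within a quadrant, two of the residue classes lie above the centre and two
  below, each is monotone, and the extreme values are attained at the indices 3 and 1.\<close>
lemma in_seq_bounds:
  assumes th: "0 < th" and a: "0 \<le> amplitude th m n" and small: "(2 * real n + 3/2) * th \<le> pi/4"
    and j: "j \<le> 4 * n + 3"
  shows "in_seq th m n 1 \<le> in_seq th m n j \<or> centre_coord th \<le> in_seq th m n j"
    and "in_seq th m n j \<le> in_seq th m n 3 \<or> in_seq th m n j \<le> centre_coord th"
proof -
  define q where "q = j div 4"
  have rng: "0 \<le> pi/4 + y * th \<and> pi/4 + y * th \<le> pi/2" if "\<bar>y\<bar> \<le> 2 * real n + 3/2" for y
  proof -
    have "\<bar>y * th\<bar> \<le> (2 * real n + 3/2) * th" using that th by (simp add: abs_mult mult_right_mono)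
    then have "\<bar>y * th\<bar> \<le> pi/4" using small by linarith
    then show ?thesis by linarith
  qed
  have sn: "0 \<le> sin (pi/4 + y * th)" "0 \<le> cos (pi/4 + y * th)" if "\<bar>y\<bar> \<le> 2 * real n + 3/2" for y
    using rng[OF that] by (auto intro!: sin_ge_zero cos_ge_zero)
  have mono: "sin (pi/4 + y * th) \<le> sin (pi/4 + x * th)"
    if "\<bar>y\<bar> \<le> 2 * real n + 3/2" "\<bar>x\<bar> \<le> 2 * real n + 3/2" "y \<le> x" for x y
    using rng[OF that(1)] rng[OF that(2)] that(3) th
    by (intro sin_monotone_2pi_le) (auto simp: mult_right_mono)
  have cos_neg: "cos (pi/4 + y * th) = sin (pi/4 + (-y) * th)" for y
    using cos_sin_eq[of "pi/4 + y * th"] by (simp add: algebra_simps)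
  have "j = 4*q \<or> j = 4*q+1 \<or> j = 4*q+2 \<or> j = 4*q+3" unfolding q_def by presburger
  then consider "j = 4*q" | "j = 4*q+1" | "j = 4*q+2" | "j = 4*q+3" by blast
  then have "(in_seq th m n 1 \<le> in_seq th m n j \<or> centre_coord th \<le> in_seq th m n j) \<and>
     (in_seq th m n j \<le> in_seq th m n 3 \<or> in_seq th m n j \<le> centre_coord th)"
  proof cases
    case 1
    then have q: "real q \<le> real n" using j by simp
    have "cos (pi/4 + (2 * real n + 3/2 - 4 * real q) * th) \<le> sin (pi/4 + (2 * real n - 3/2) * th)"
      unfolding cos_neg by (rule mono) (use q in auto)
    moreover have "0 \<le> cos (pi/4 + (2 * real n + 3/2 - 4 * real q) * th)"
      by (rule sn) (use q in auto)
    ultimately show ?thesis using a in_seq_mod4(1)[of th m n q] in_seq_mod4(4)[of th m n 0] 1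
      by (simp add: mult_left_mono)
  next
    case 2
    then have q: "real q \<le> real n" using j by simp
    have "sin (pi/4 + (2 * real n + 1/2 - 4 * real q) * th) \<le> sin (pi/4 + (2 * real n + 1/2) * th)"
      by (rule mono) (use q in auto)
    moreover have "0 \<le> sin (pi/4 + (2 * real n + 1/2 - 4 * real q) * th)"
      by (rule sn) (use q in auto)
    ultimately show ?thesis using a in_seq_mod4(2)[of th m n q] in_seq_mod4(2)[of th m n 0] 2
      by (simp add: mult_left_mono)
  next
    case 3
    then have q: "real q \<le> real n" using j by simp
    have "cos (pi/4 + (2 * real n - 1/2 - 4 * real q) * th) \<le> sin (pi/4 + (2 * real n + 1/2) * th)"
      unfolding cos_neg by (rule mono) (use q in auto)
    moreover have "0 \<le> cos (pi/4 + (2 * real n - 1/2 - 4 * real q) * th)"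
      by (rule sn) (use q in auto)
    ultimately show ?thesis using a in_seq_mod4(3)[of th m n q] in_seq_mod4(2)[of th m n 0] 3
      by (simp add: mult_left_mono)
  next
    case 4
    then have q: "real q \<le> real n" using j by simp
    have "sin (pi/4 + (2 * real n - 3/2 - 4 * real q) * th) \<le> sin (pi/4 + (2 * real n - 3/2) * th)"
      by (rule mono) (use q in auto)
    moreover have "0 \<le> sin (pi/4 + (2 * real n - 3/2 - 4 * real q) * th)"
      by (rule sn) (use q in auto)
    ultimately show ?thesis using a in_seq_mod4(4)[of th m n q] in_seq_mod4(4)[of th m n 0] 4
      by (simp add: mult_left_mono)
  qed
  then show "in_seq th m n 1 \<le> in_seq th m n j \<or> centre_coord th \<le> in_seq th m n j"
    "in_seq th m n j \<le> in_seq th m n 3 \<or> in_seq th m n j \<le> centre_coord th" by auto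
qed

text \<open>The sines decrease in modulus from both ends to the middle, with alternating signs.  The two
  largest ones, at \<open>k = 0\<close> and \<open>k = 2 m - 1\<close>, enter with a plus sign, so the smallest value belongs to
  the next one, \<open>k = 1\<close>; for \<open>m = 1\<close> the two ends have the same value.\<close>
lemma out_even_min:
  assumes th: "0 < th" and b: "0 \<le> out_amplitude th m n" and m: "1 \<le> m" and small: "(2 * real m - 1) * th \<le> pi/2"
    and k: "k < 2 * m"
  shows "out_even th m n 1 \<le> out_even th m n k"
proof -
  have S: "- sin ((2 * real m - 3) * th) \<le> (-1)^k * sin ((2 * real m - 1 - 2 * real k) * th)"
  proof -
    define x where "x = 2 * real m - 1 - 2 * real k"
    have le: "- sin ((2 * real m - 3) * th) \<le> sin (y * th) \<and> - sin ((2 * real m - 3) * th) \<le> - sin (y * th)"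
      if "\<bar>y\<bar> \<le> 2 * real m - 3" for y
    proof -
      have 1: "\<bar>y * th\<bar> \<le> (2 * real m - 3) * th" using that th by (simp add: abs_mult mult_right_mono)
      have 2: "(2 * real m - 3) * th \<le> pi/2" using small th by (smt (verit) mult_right_mono)
      have "sin (y * th) \<le> sin ((2 * real m - 3) * th)"
        by (rule sin_monotone_2pi_le) (use 1 2 in linarith)+
      moreover have "sin (- (y * th)) \<le> sin ((2 * real m - 3) * th)"
        by (rule sin_monotone_2pi_le) (use 1 2 in linarith)+
      ultimately show ?thesis by simp
    qed
    have extreme: "- sin ((2 * real m - 3) * th) \<le> sin ((2 * real m - 1) * th)"
    proof -
      have "(2 * real m - 3) * th \<le> (2 * real m - 1) * th" "- ((2 * real m - 1) * th) \<le> (2 * real m - 3) * th"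
        using th m by (simp_all add: mult_right_mono algebra_simps) 
      then have "sin (- ((2 * real m - 1) * th)) \<le> sin ((2 * real m - 3) * th)"
        using small by (intro sin_monotone_2pi_le) linarith+
      then show ?thesis by simp
    qed
    consider "k = 0" | "k = 2 * m - 1" | "1 \<le> k" "k \<le> 2 * m - 2" using k by linarith
    then show ?thesis
    proof cases
      case 1
      then show ?thesis using extreme by simp
    next
      case 2
      then have "real k = 2 * real m - 1" "odd k" using m by (auto simp: of_nat_diff)
      moreover from this have "(2 * real m - 1 - 2 * real k) * th = - ((2 * real m - 1) * th)"
      proof -
        have "2 * real m - 1 - 2 * real k = - (2 * real m - 1)" using \<open>real k = 2 * real m - 1\<close> by simp
        then show ?thesis by (simp only: mult_minus_left)
      qed
      ultimately show ?thesis using extreme by simp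
    next
      case 3
      then have "real k \<le> 2 * real m - 2" "1 \<le> real k" by linarith+
      then have "\<bar>2 * real m - 1 - 2 * real k\<bar> \<le> 2 * real m - 3" by linarith
      from le[OF this] show ?thesis by (cases "even k") auto
    qed
  qed
  have "- (out_amplitude th m n * sin ((2 * real m - 3) * th)) \<le> (-1)^k * out_amplitude th m n * sin ((2 * real m - 1 - 2 * real k) * th)"
    using mult_left_mono[OF S b] by (simp add: mult_ac)
  then show ?thesis by (simp add: out_even_def algebra_simps)
qed

text \<open>The value closest to 1 is \<open>in_seq 3\<close>, the second coordinate of the fixed point, and the value
  closest to 0 is \<open>out_even 1\<close>.  The last assumptions say that all values that are not close to 0 or
  1 are harmless.\<close>
lemma regular_orbit_radius:
  fixes th :: real and m n :: nat
  defines "r \<equiv> min (1 - in_seq th m n 3) (out_even th m n 1)"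
  assumes mn: "1 \<le> m" "1 \<le> n" and th: "0 < th"
    and small: "(2 * real n + 3/2) * th \<le> pi/4" "2 * real m * th < pi/2"
    and a: "0 \<le> amplitude th m n" and s0: "sin (pi/4 + (2 * real n + 2 * real m - 1/2) * th) \<noteq> 0"
    and b: "0 \<le> out_amplitude th m n"
    and r: "0 < r" "r \<le> centre_coord th" "centre_coord th \<le> 1 - r"
      "r \<le> 1 / (2 * (cos th)^2) - out_amplitude th m n" "1 / (2 * (cos th)^2) + out_amplitude th m n \<le> 1 - r"
  shows "island_radius (2 * sin th) (in_seq th m n 4, in_seq th m n 3) = r"
    and "in_seq th m n 4 \<in> {0..<1}" "in_seq th m n 3 \<in> {0..<1}"
proof -
  have mth: "0 \<le> (2 * real m - 2) * th" "(2 * real m - 2) * th < pi/2" "(2 * real m - 1) * th < pi/2" "th < pi/2"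
  proof -
    have "th \<le> real m * th" using th mn by simp
    moreover have "2 * (real m * th) < pi/2" using small(2) by (simp add: mult.assoc)
    moreover have "(2 * real m - 2) * th = 2 * (real m * th) - 2 * th" "(2 * real m - 1) * th = 2 * (real m * th) - th"
      by (simp_all add: algebra_simps)
    ultimately show "0 \<le> (2 * real m - 2) * th" "(2 * real m - 2) * th < pi/2" "(2 * real m - 1) * th < pi/2" "th < pi/2"
      using th by linarith+
  qed
  have c0: "cos th \<noteq> 0" using cos_gt_zero[of th] th mth by auto
  have cm: "cos ((2 * real m - 2) * th) \<noteq> 0" using cos_gt_zero_pi[of "(2 * real m - 2) * th"] mth by linarith
  note A = c0 cm s0
  note J = orbit_seq_junction[OF A]
  note high = orbit_seq_high[OF J(1,2)]
  let ?T = "4 * (m + n) - 1"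
  have r1: "r \<le> 1 - in_seq th m n 3" "r \<le> out_even th m n 1" by (simp_all add: r_def)
  have E0: "out_even th m n 1 \<le> out_even th m n k" if "k < 2 * m" for k
    by (rule out_even_min[OF th b mn(1) _ that]) (use mth in linarith)
  have sm: "\<bar>(-1)^k * out_amplitude th m n * x\<bar> \<le> out_amplitude th m n" if "\<bar>x\<bar> \<le> 1" for x :: real and k :: nat
    using mult_left_mono[OF that b] b by (simp add: abs_mult power_abs)
  have s1: "sin th \<le> 1" by simp
  have bounds: "r \<le> orbit_seq th m n j \<and> r \<le> 1 - orbit_seq th m n j" if j: "j < ?T" for j
  proof -
    have "j \<le> 4 * n + 3 \<or> (\<exists>k. j = 4 * n + 2 + 2 * k) \<or> (\<exists>k. j = 4 * n + 3 + 2 * k)"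
      by presburger
    then consider "j \<le> 4 * n + 3" | k where "j = 4 * n + 2 + 2 * k" | k where "j = 4 * n + 3 + 2 * k"
      by blast
    then show ?thesis
    proof cases
      case 1
      have "r \<le> in_seq th m n 1" unfolding J(4) using E0[of 0] r1(2) mn by simp
      then show ?thesis using in_seq_bounds[OF th a small(1) 1] r r1 1 by (simp add: orbit_seq_low) linarith
    next
      case (2 k)
      then have "k < 2 * m" using j by presburger
      then have "r \<le> out_even th m n k" using E0 r1(2) by fastforce
      moreover have "out_even th m n k \<le> 1 / (2 * (cos th)^2) + out_amplitude th m n"
      proof -
        have "sin th / (2 * (cos th)^2) \<le> 1 / (2 * (cos th)^2)" by (rule divide_right_mono) auto
        then show ?thesis using sm[of "sin ((2 * real m - 1 - 2 * real k) * th)" k]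
          unfolding out_even_def by (simp add: abs_le_iff)
      qed
      ultimately show ?thesis using high(1)[of k] 2 r by simp
    next
      case (3 k)
      have "\<bar>out_odd th m n k - 1 / (2 * (cos th)^2)\<bar> \<le> out_amplitude th m n"
        using sm[of "cos ((2 * real m - 2 - 2 * real k) * th)" k] by (simp add: out_odd_def)
      then have "r \<le> out_odd th m n k" "r \<le> 1 - out_odd th m n k" using r by linarith+
      then show ?thesis using high(2)[of k] 3 by simp
    qed
  qed
  have T4: "4 < ?T" using mn by simp
  then have T: "1 < ?T" "3 < ?T" "4 < ?T" by simp_all
  have 34: "orbit_seq th m n 3 = in_seq th m n 3" "orbit_seq th m n (Suc 3) = in_seq th m n 4" using mn by (simp_all add: orbit_seq_low)
  obtain q where q: "q < ?T" "orbit_seq th m n q = r \<or> 1 - orbit_seq th m n q = r"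
  proof (cases "1 - in_seq th m n 3 \<le> out_even th m n 1")
    case True
    then show ?thesis using that[of 3] T 34 by (simp add: r_def)
  next
    case False
    \<comment> \<open>for \<open>m = 1\<close> the second phase is so short that this value occurs at index \<open>4 n + 4\<close>, which is index 1 of the next period\<close>
    show ?thesis
    proof (cases "m = 1")
      case True
      have "orbit_seq th m n (4 * n + 2 + 2 * 1) = orbit_seq th m n 1"
        using orbit_seq_closing(2)[OF A mn(1)] True by (simp add: numeral_eq_Suc)
      then show ?thesis using that[of 1] T False unfolding high by (simp add: r_def)
    next
      case m2: False
      then have "4 * n + 2 + 2 * 1 < ?T" using mn by simp
      then show ?thesis using that[of "4 * n + 2 + 2 * 1"] False unfolding high by (simp add: r_def)
    qed
  qed
  show "island_radius (2 * sin th) (in_seq th m n 4, in_seq th m n 3) = r"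
    unfolding 34[symmetric]
    by (rule island_radius_of_periodic_sequence[OF orbit_seq_recurrence[OF A] orbit_seq_closing[OF A mn(1)] T(1) T(2) r(1) bounds q])
  show "in_seq th m n 4 \<in> {0..<1}" "in_seq th m n 3 \<in> {0..<1}"
    using bounds[of 3] bounds[of 4] T 34 r(1) by auto
qed

section \<open>Powers of the linear part and the vertices of the inner regions\<close>

lemma centre_cc:
  assumes "cos th \<noteq> 0"
  shows "centre (2 * sin th) = (centre_coord th, centre_coord th)"
proof -
  have "centre_coord th * (2 - 2 * sin th) = 1" by (rule centre_coord_eq[OF assms])
  then have "1 / (2 - 2 * sin th) = centre_coord th" by (auto simp: divide_eq_eq)
  then show ?thesis by (simp add: centre_def)
qed

text \<open>The recurrence \<open>s\<^sub>k\<^sub>+\<^sub>1 = 2 cos ph s\<^sub>k - s\<^sub>k\<^sub>-\<^sub>1\<close> is the one of \<open>sin (k ph)\<close>.\<close>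
lemma C_power:
  assumes "sin ph \<noteq> 0"
  shows "(C (2 * cos ph) ^^ k) (u, v) =
    ((u * sin ((real k + 1) * ph) - v * sin (real k * ph)) / sin ph,
     (u * sin (real k * ph) - v * sin ((real k - 1) * ph)) / sin ph)"
proof (induction k)
  case 0
  then show ?case using assms by simp
next
  case (Suc k)
  have chebyshev: "2 * cos ph * sin (x + ph) = sin (x + 2 * ph) + sin x" for x
    using sin_add[of "x + ph" ph] sin_diff[of "x + ph" ph] by (simp add: algebra_simps)
  have e: "(real (Suc k) + 1) * ph = real k * ph + 2 * ph" "(real k + 1) * ph = real k * ph + ph"
     "real (Suc k) * ph = real k * ph + ph" "(real (Suc k) - 1) * ph = real k * ph"
     "real k * ph = (real k - 1) * ph + ph"
    by (simp_all add: algebra_simps)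
  have 1: "2 * cos ph * sin ((real k + 1) * ph) - sin (real k * ph) = sin ((real (Suc k) + 1) * ph)"
    using chebyshev[of "real k * ph"] unfolding e(1,2) by simp
  have 2: "2 * cos ph * sin (real k * ph) - sin ((real k - 1) * ph) = sin (real (Suc k) * ph)"
    using chebyshev[of "(real k - 1) * ph"] by (simp add: algebra_simps)
  have "2 * cos ph * ((u * sin ((real k + 1) * ph) - v * sin (real k * ph)) / sin ph)
      - (u * sin (real k * ph) - v * sin ((real k - 1) * ph)) / sin ph
    = (u * (2 * cos ph * sin ((real k + 1) * ph) - sin (real k * ph))
      - v * (2 * cos ph * sin (real k * ph) - sin ((real k - 1) * ph))) / sin ph"
    by (simp add: algebra_simps add_divide_distrib diff_divide_distrib)
  then show ?case unfolding 1 2 using Suc by (simp add: C_def e add.commute)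
qed

lemma C_power_4:
  assumes "cos th \<noteq> 0"
  shows "(C (2 * sin th) ^^ (4 * n)) (u, v) =
    ((u * cos ((4 * real n + 1) * th) + v * sin (4 * real n * th)) / cos th,
     (- u * sin (4 * real n * th) + v * cos ((4 * real n - 1) * th)) / cos th)"
proof -
  have q: "cos (pi/2 - th) = sin th" "sin (pi/2 - th) = cos th" by (simp_all add: cos_diff sin_diff)
  have per: "sin (x + real n * (2 * pi)) = sin x" for x
    using cos_2npi[of n] sin_2npi[of n] by (simp add: sin_add mult_ac)
  have a: "(real (4*n) + 1) * (pi/2 - th) = (pi/2 - (4 * real n + 1) * th) + real n * (2 * pi)"
    "real (4*n) * (pi/2 - th) = - (4 * real n * th) + real n * (2 * pi)"
    "(real (4*n) - 1) * (pi/2 - th) = - (pi/2 + (4 * real n - 1) * th) + real n * (2 * pi)"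
    by (simp_all add: field_simps)
  have s: "sin (pi/2 - x) = cos x" "sin (- (pi/2 + x)) = - cos x" for x by (simp_all add: sin_diff sin_add)
  show ?thesis using C_power[of "pi/2 - th" "4*n" u v] assms
    unfolding q a per s by (simp add: algebra_simps)
qed

text \<open>The implicit equation of the line, which \<open>ell\<close> describes as the image of a parametrised line.\<close>
lemma ell_iff:
  assumes "cos th \<noteq> 0"
  shows "(x, y) \<in> ell (2 * sin th) n \<longleftrightarrow>
    (y - centre_coord th) * cos ((4 * real n + 1) * th) + (x - centre_coord th) * sin (4 * real n * th) = (1 - centre_coord th) * cos th"
proof -
  define A where "A = 4 * real n * th"
  define u v where "u = x - centre_coord th" and "v = y - centre_coord th"
  have e: "(4 * real n + 1) * th = A + th" "(4 * real n - 1) * th = A - th" by (simp_all add: A_def algebra_simps)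
  have det: "cos (A - th) * cos (A + th) + sin A * sin A = cos th * cos th"
  proof -
    have "cos (A - th) * cos (A + th) = (cos A * cos A) * (cos th * cos th) - (sin A * sin A) * (sin th * sin th)"
      by (simp add: cos_add cos_diff algebra_simps)
    also have "cos A * cos A = 1 - sin A * sin A" using cos_squared_eq[of A] by (simp add: power2_eq_square)
    also have "sin th * sin th = 1 - cos th * cos th" using sin_squared_eq[of th] by (simp add: power2_eq_square)
    finally show ?thesis by (simp add: algebra_simps)
  qed
  have mem: "(x, y) \<in> ell (2 * sin th) n \<longleftrightarrow>
     (\<exists>a. u = (a * cos (A + th) + (1 - centre_coord th) * sin A) / cos th \<and> v = (- a * sin A + (1 - centre_coord th) * cos (A - th)) / cos th)"
    (is "_ \<longleftrightarrow> ?R")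
  proof
    assume "(x, y) \<in> ell (2 * sin th) n"
    then obtain w where "(x, y) = centre (2 * sin th) + (C (2 * sin th) ^^ (4 * n)) ((w, 1) - centre (2 * sin th))"
      by (auto simp: ell_def)
    then show ?R unfolding centre_cc[OF assms] diff_Pair C_power_4[OF assms] e A_def[symmetric]
      by (intro exI[of _ "w - centre_coord th"]) (simp add: u_def v_def)
  next
    assume ?R
    then obtain a where a: "u = (a * cos (A + th) + (1 - centre_coord th) * sin A) / cos th" "v = (- a * sin A + (1 - centre_coord th) * cos (A - th)) / cos th"
      by blast
    have "(x, y) = centre (2 * sin th) + (C (2 * sin th) ^^ (4 * n)) ((a + centre_coord th, 1) - centre (2 * sin th))"
      unfolding centre_cc[OF assms] diff_Pair C_power_4[OF assms] e A_def[symmetric]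
      using a by (simp add: u_def v_def)
    then show "(x, y) \<in> ell (2 * sin th) n" unfolding ell_def by (intro image_eqI[of _ _ "(a + centre_coord th, 1)"]) auto
  qed
  also have "?R \<longleftrightarrow> v * cos (A + th) + u * sin A = (1 - centre_coord th) * cos th"
  proof
    assume ?R
    then obtain a where a: "u = (a * cos (A + th) + (1 - centre_coord th) * sin A) / cos th" "v = (- a * sin A + (1 - centre_coord th) * cos (A - th)) / cos th"
      by blast
    have "v * cos (A + th) + u * sin A = (1 - centre_coord th) * (cos (A - th) * cos (A + th) + sin A * sin A) / cos th"
      unfolding a using assms by (simp add: field_simps)
    then show "v * cos (A + th) + u * sin A = (1 - centre_coord th) * cos th" unfolding det using assms by simp
  next
    assume h: "v * cos (A + th) + u * sin A = (1 - centre_coord th) * cos th"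
    have k: "1 - centre_coord th = (v * cos (A + th) + u * sin A) / cos th" using h assms by (simp add: field_simps)
    show ?R
    proof (intro exI[of _ "(u * cos (A - th) - v * sin A) / cos th"] conjI)
      have "(u * cos (A - th) - v * sin A) / cos th * cos (A + th) + (1 - centre_coord th) * sin A
        = u * (cos (A - th) * cos (A + th) + sin A * sin A) / cos th"
        unfolding k by (simp add: algebra_simps add_divide_distrib diff_divide_distrib)
      also have "\<dots> = u * cos th" unfolding det using assms by simp
      finally show "u = ((u * cos (A - th) - v * sin A) / cos th * cos (A + th) + (1 - centre_coord th) * sin A) / cos th"
        using assms by simp
      have "- ((u * cos (A - th) - v * sin A) / cos th) * sin A + (1 - centre_coord th) * cos (A - th)
        = v * (cos (A - th) * cos (A + th) + sin A * sin A) / cos th"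
        unfolding k by (simp add: algebra_simps add_divide_distrib diff_divide_distrib)
      also have "\<dots> = v * cos th" unfolding det using assms by simp
      finally show "v = (- ((u * cos (A - th) - v * sin A) / cos th) * sin A + (1 - centre_coord th) * cos (A - th)) / cos th"
        using assms by simp
    qed
  qed
  finally show ?thesis by (simp add: u_def v_def e A_def)
qed

lemma G_ell_iff:
  assumes "cos th \<noteq> 0"
  shows "(x, y) \<in> G ` ell (2 * sin th) n \<longleftrightarrow>
    (x - centre_coord th) * cos ((4 * real n + 1) * th) + (y - centre_coord th) * sin (4 * real n * th) = (1 - centre_coord th) * cos th"
proof -
  have "(x, y) \<in> G ` ell (2 * sin th) n \<longleftrightarrow> (y, x) \<in> ell (2 * sin th) n" by (force simp: G_def)
  then show ?thesis by (simp add: ell_iff[OF assms])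
qed

lemma cramer_unique:
  fixes a b c d :: real
  assumes "a * d - b * c \<noteq> 0" "a * x + b * y = a * x' + b * y'" "c * x + d * y = c * x' + d * y'"
  shows "x = x' \<and> y = y'"
proof -
  have "(a * d - b * c) * (x - x') = d * ((a * x + b * y) - (a * x' + b * y')) - b * ((c * x + d * y) - (c * x' + d * y'))"
    "(a * d - b * c) * (y - y') = a * ((c * x + d * y) - (c * x' + d * y')) - c * ((a * x + b * y) - (a * x' + b * y'))"
    by (simp_all add: algebra_simps)
  then have "(a * d - b * c) * (x - x') = 0" "(a * d - b * c) * (y - y') = 0"
    by (simp_all only: assms(2,3) diff_self mult_zero_right)
  then show ?thesis using assms(1) by simp
qed

text \<open>The angle \<open>P\<close> is chosen such that sum-to-product formulas factor both sides of the equation of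
  the line; a common factor \<open>cos (P + th/2)\<close> drops out.\<close>
lemma Q0_eq:
  fixes n :: nat and th :: real
  defines "P \<equiv> pi/4 + 2 * real n * th"
  assumes c: "cos th \<noteq> 0" and s: "sin (P + th/2) \<noteq> 0" and c': "cos (P + th/2) \<noteq> 0"
  shows "Q0 (2 * sin th) n = (centre_coord th + (1 - centre_coord th) * (cos (P - th/2) / sin (P + th/2)), 1)"
proof -
  let ?k = "1 - centre_coord th"
  define x where "x = centre_coord th + ?k * (cos (P - th/2) / sin (P + th/2))"
  have A: "4 * real n * th = 2 * P - pi/2" "(4 * real n + 1) * th = 2 * (P + th/2) - pi/2"
    by (simp_all add: P_def algebra_simps)
  have sA: "sin (4 * real n * th) = - cos (2 * P)" unfolding A by (simp add: sin_diff)
  have cA: "cos ((4 * real n + 1) * th) = 2 * sin (P + th/2) * cos (P + th/2)" unfolding A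
    by (simp add: cos_diff sin_double[of "P + th/2", symmetric])
  have ne: "cos ((4 * real n + 1) * th) \<noteq> 0" using s c' cA by simp
  have prod: "2 * cos (P - th/2) * cos (P + th/2) = cos th + cos (2 * P)"
    using cos_add[of "P + th/2" "P - th/2"] cos_diff[of "P + th/2" "P - th/2"] by (simp add: algebra_simps)
  have on: "(x - centre_coord th) * cos ((4 * real n + 1) * th) + (1 - centre_coord th) * sin (4 * real n * th) = ?k * cos th"
  proof -
    have "(x - centre_coord th) * cos ((4 * real n + 1) * th) = ?k * (2 * cos (P - th/2) * cos (P + th/2))"
      unfolding cA x_def using s by simp
    then show ?thesis unfolding prod sA by (simp add: algebra_simps)
  qed
  have "Q0 (2 * sin th) n = (x, 1)"
    unfolding Q0_def
  proof (rule the_equality)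
    show "(x, 1) \<in> ell (2 * sin th) 0 \<inter> G ` ell (2 * sin th) n"
      using on c by (simp add: ell_iff[OF c] G_ell_iff[OF c])
    fix z assume z: "z \<in> ell (2 * sin th) 0 \<inter> G ` ell (2 * sin th) n"
    obtain a b where ab: "z = (a, b)" by force
    have b: "b = 1" using z c by (simp add: ab ell_iff[OF c])
    have "(a - centre_coord th) * cos ((4 * real n + 1) * th) = (x - centre_coord th) * cos ((4 * real n + 1) * th)"
    proof -
      have "(a - centre_coord th) * cos ((4 * real n + 1) * th) + (1 - centre_coord th) * sin (4 * real n * th) = ?k * cos th"
        using z by (simp add: ab b G_ell_iff[OF c])
      then show ?thesis using on by linarith
    qed
    then show "z = (x, 1)" using ne by (simp add: ab b)
  qed
  then show ?thesis by (simp add: x_def)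
qed

text \<open>Cramer's rule, after the same factorisation as for \<open>Q0\<close>; the determinant of the two lines is
  \<open>cos th * sin (2 P + 5 th)\<close>.\<close>
lemma Q1_eq:
  fixes n :: nat and th :: real
  defines "P \<equiv> pi/4 + 2 * real n * th"
  assumes c: "cos th \<noteq> 0" and s: "sin (P + 5/2*th) \<noteq> 0" and c': "cos (P + 5/2*th) \<noteq> 0"
  shows "Q1 (2 * sin th) n =
    (centre_coord th + (1 - centre_coord th) * (cos (P - 5/2*th) / sin (P + 5/2*th)),
     centre_coord th + (1 - centre_coord th) * (sin (P - 3/2*th) / sin (P + 5/2*th)))"
proof -
  let ?k = "1 - centre_coord th"
  define u where "u = cos (P - 5/2*th) / sin (P + 5/2*th)"
  define v where "v = sin (P - 3/2*th) / sin (P + 5/2*th)"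
  have A: "4 * real n * th = 2 * P - pi/2" "(4 * real n + 1) * th = 2 * (P + th/2) - pi/2"
    by (simp_all add: P_def algebra_simps)
  have sA: "sin (4 * real n * th) = - cos (2 * P)" unfolding A by (simp add: sin_diff)
  have cA: "cos ((4 * real n + 1) * th) = sin (2 * (P + th/2))" unfolding A
    by (simp add: cos_diff)
  have pr: "2 * sin x * cos y = sin (x + y) + sin (x - y)" "2 * sin x * sin y = cos (x - y) - cos (x + y)"
    "2 * cos x * cos y = cos (x - y) + cos (x + y)" for x y :: real
    by (simp_all add: sin_add sin_diff cos_add cos_diff)
  let ?S = "sin (P + 5/2*th)"
  have S: "u * ?S = cos (P - 5/2*th)" "v * ?S = sin (P - 3/2*th)" using s by (simp_all add: u_def v_def)
  have 1: "v * cos (5 * th) + u * sin (4 * th) = cos th"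
  proof -
    have "2 * sin (P - 3/2*th) * cos (5*th) = sin (P + 7/2*th) + sin (P - 13/2*th)"
      using pr(1)[of "P - 3/2*th" "5*th"] by (simp add: algebra_simps)
    moreover have "2 * sin (4*th) * cos (P - 5/2*th) = sin (P + 3/2*th) + sin (13/2*th - P)"
      using pr(1)[of "4*th" "P - 5/2*th"] by (simp add: algebra_simps)
    moreover have "sin (13/2*th - P) = - sin (P - 13/2*th)" using sin_minus[of "P - 13/2*th"] by (simp add: algebra_simps)
    moreover have "2 * ?S * cos th = sin (P + 7/2*th) + sin (P + 3/2*th)"
      using pr(1)[of "P + 5/2*th" th] by (simp add: algebra_simps)
    ultimately have "2 * (sin (P - 3/2*th) * cos (5*th) + cos (P - 5/2*th) * sin (4*th)) = 2 * (cos th * ?S)"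
      by (simp add: algebra_simps)
    then have "(v * cos (5 * th) + u * sin (4 * th)) * ?S = cos th * ?S"
      unfolding S[symmetric] by (simp add: algebra_simps)
    then show ?thesis using s by simp
  qed
  have 2: "u * cos ((4 * real n + 1) * th) + v * sin (4 * real n * th) = cos th"
  proof -
    have "2 * sin (2 * (P + th/2)) * cos (P - 5/2*th) = sin (3*P - 3/2*th) + sin (P + 7/2*th)"
      using pr(1)[of "2 * (P + th/2)" "P - 5/2*th"] by (simp add: algebra_simps)
    moreover have "2 * sin (P - 3/2*th) * cos (2*P) = sin (3*P - 3/2*th) + sin (- (P + 3/2*th))"
      using pr(1)[of "P - 3/2*th" "2*P"] by (simp add: algebra_simps)
    moreover have "2 * ?S * cos th = sin (P + 7/2*th) + sin (P + 3/2*th)"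
      using pr(1)[of "P + 5/2*th" th] by (simp add: algebra_simps)
    ultimately have "2 * (cos (P - 5/2*th) * sin (2 * (P + th/2)) - sin (P - 3/2*th) * cos (2*P)) = 2 * (cos th * ?S)"
      unfolding sin_minus by (simp add: algebra_simps)
    then have "(u * sin (2 * (P + th/2)) + v * (- cos (2*P))) * ?S = cos th * ?S"
      unfolding S[symmetric] by (simp add: algebra_simps)
    then show ?thesis using s unfolding sA cA by simp
  qed
  have det: "cos ((4 * real n + 1) * th) * cos (5*th) - sin (4 * real n * th) * sin (4*th)
     = cos th * (2 * sin (P + 5/2*th) * cos (P + 5/2*th))"
  proof -
    have "2 * sin (2 * (P + th/2)) * cos (5*th) = sin (2*P + 6*th) + sin (2*P - 4*th)"
      using pr(1)[of "2 * (P + th/2)" "5*th"] by (simp add: algebra_simps)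
    moreover have "2 * sin (4*th) * cos (2*P) = sin (2*P + 4*th) + sin (- (2*P - 4*th))"
      using pr(1)[of "4*th" "2*P"] by (simp add: algebra_simps)
    moreover have "2 * sin (2*P + 5*th) * cos th = sin (2*P + 6*th) + sin (2*P + 4*th)"
      using pr(1)[of "2*P + 5*th" th] by (simp add: algebra_simps)
    moreover have "2 * sin (P + 5/2*th) * cos (P + 5/2*th) = sin (2*P + 5*th)"
      unfolding sin_double[symmetric] by (simp add: algebra_simps)
    ultimately show ?thesis unfolding sA cA sin_minus by (simp add: algebra_simps)
  qed
  have ne: "cos ((4 * real n + 1) * th) * cos (5*th) - sin (4 * real n * th) * sin (4*th) \<noteq> 0"
    unfolding det using s c' c by simp
  have "Q1 (2 * sin th) n = (centre_coord th + ?k * u, centre_coord th + ?k * v)"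
    unfolding Q1_def
  proof (rule the_equality)
    have "?k * v * cos (5*th) + ?k * u * sin (4*th) = ?k * cos th"
      using 1 by (metis (no_types, opaque_lifting) distrib_left mult.assoc)
    moreover have "?k * u * cos ((4 * real n + 1) * th) + ?k * v * sin (4 * real n * th) = ?k * cos th"
      using 2 by (metis (no_types, opaque_lifting) distrib_left mult.assoc)
    ultimately show mem: "(centre_coord th + ?k * u, centre_coord th + ?k * v) \<in> ell (2 * sin th) 1 \<inter> G ` ell (2 * sin th) n"
      by (simp add: ell_iff[OF c] G_ell_iff[OF c])
    fix z assume z: "z \<in> ell (2 * sin th) 1 \<inter> G ` ell (2 * sin th) n"
    obtain a b where ab: "z = (a, b)" by force
    have "a - centre_coord th = (centre_coord th + ?k * u) - centre_coord th \<and> b - centre_coord th = (centre_coord th + ?k * v) - centre_coord th"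
    proof (rule cramer_unique[OF ne])
      show "cos ((4 * real n + 1) * th) * (a - centre_coord th) + sin (4 * real n * th) * (b - centre_coord th) =
        cos ((4 * real n + 1) * th) * ((centre_coord th + ?k * u) - centre_coord th) + sin (4 * real n * th) * ((centre_coord th + ?k * v) - centre_coord th)"
        using z mem unfolding ab Int_iff G_ell_iff[OF c] by (simp only: mult.commute)
      show "sin (4*th) * (a - centre_coord th) + cos (5*th) * (b - centre_coord th) =
        sin (4*th) * ((centre_coord th + ?k * u) - centre_coord th) + cos (5*th) * ((centre_coord th + ?k * v) - centre_coord th)"
        using z mem unfolding ab Int_iff ell_iff[OF c] by (simp add: mult.commute add.commute)
    qed
    then show "z = (centre_coord th + ?k * u, centre_coord th + ?k * v)" by (simp add: ab)
  qed
  then show ?thesis by (simp add: u_def v_def)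
qed

section \<open>The two symmetry lines\<close>

text \<open>The points from which the recurrence, run backwards through the alternating code, is symmetric
  about the middle of the second phase.  Such a solution has a free cosine part about that middle,
  while its sine part is prescribed by the zeros of the code; the equation fixes the sine part.\<close>
definition out_line :: "real \<Rightarrow> nat \<Rightarrow> point \<Rightarrow> bool" where
  "out_line th m z \<longleftrightarrow>
     (fst z - centre_coord th) * sin ((2 * real m + 1) * th) + (snd z - centre_coord th) * cos ((2 * real m + 2) * th)
       = cos ((2 * real m - 1) * th) / (2 * cos th)"

text \<open>The points from which the recurrence with code 1 is symmetric about the middle of the first
  phase: relative to the centre they are the multiples of one fixed vector.\<close>
definition in_line :: "real \<Rightarrow> nat \<Rightarrow> point \<Rightarrow> bool" where
  "in_line th n z \<longleftrightarrow>
     (fst z - centre_coord th) * sin (pi/4 + 2 * real n * th - 3/2 * th)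
       = (snd z - centre_coord th) * cos (pi/4 + 2 * real n * th - 5/2 * th)"

lemma linear_on_segment:
  fixes a b :: real
  assumes "z \<in> closed_segment x y" "a * fst x + b * snd x = d" "a * fst y + b * snd y = d"
  shows "a * fst z + b * snd z = d"
proof -
  obtain t where t: "z = (1 - t) *\<^sub>R x + t *\<^sub>R y" using assms(1) by (auto simp: closed_segment_def)
  have "a * fst z + b * snd z = (1 - t) * (a * fst x + b * snd x) + t * (a * fst y + b * snd y)"
    unfolding t by (simp add: algebra_simps)
  then show ?thesis unfolding assms(2,3) by (simp add: algebra_simps)
qed

lemma out_line_alt:
  "out_line th m z \<longleftrightarrow> sin ((2 * real m + 1) * th) * fst z + cos ((2 * real m + 2) * th) * snd z
     = cos ((2 * real m - 1) * th) / (2 * cos th) + centre_coord th * (sin ((2 * real m + 1) * th) + cos ((2 * real m + 2) * th))"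
  by (simp only: out_line_def) (auto simp: algebra_simps)

lemma in_line_alt:
  "in_line th n z \<longleftrightarrow> sin (pi/4 + 2 * real n * th - 3/2 * th) * fst z + (- cos (pi/4 + 2 * real n * th - 5/2 * th)) * snd z
     = centre_coord th * (sin (pi/4 + 2 * real n * th - 3/2 * th) - cos (pi/4 + 2 * real n * th - 5/2 * th))"
  by (simp only: in_line_def) (auto simp: algebra_simps)

lemma out_line_segment:
  "\<lbrakk>z \<in> closed_segment x y; out_line th m x; out_line th m y\<rbrakk> \<Longrightarrow> out_line th m z"
  unfolding out_line_alt by (rule linear_on_segment)

lemma in_line_segment:
  "\<lbrakk>z \<in> closed_segment x y; in_line th n x; in_line th n y\<rbrakk> \<Longrightarrow> in_line th n z"
  unfolding in_line_alt by (rule linear_on_segment)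

text \<open>Up to sign the determinant of the two symmetry lines, and at the same time the equation that
  determines the amplitude of the first phase.\<close>
lemma sin_cos_sum_identity:
  fixes P th x :: real
  shows "cos (P - 5/2*th) * sin ((2*x + 1) * th) + sin (P - 3/2*th) * cos ((2*x + 2) * th)
    = sin (P + (2*x - 1/2) * th) * cos th"
proof -
  have pr: "2 * sin x * cos y = sin (x + y) + sin (x - y)" for x y :: real
    by (simp_all add: sin_add sin_diff)
  define y where "y = x * th"
  have e: "(2*x + 1) * th = 2*y + th" "(2*x + 2) * th = 2*y + 2*th" "(2*x - 1/2) * th = 2*y - th/2"
    by (simp_all add: y_def algebra_simps)
  have "2 * sin (2*y + th) * cos (P - 5/2*th) = sin (P + 2*y - 3/2*th) + sin (- (P - 2*y - 7/2*th))"
    using pr[of "2*y + th" "P - 5/2*th"] by (simp add: algebra_simps)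
  moreover have "2 * sin (P - 3/2*th) * cos (2*y + 2*th) = sin (P + 2*y + th/2) + sin (P - 2*y - 7/2*th)"
    using pr[of "P - 3/2*th" "2*y + 2*th"] by (simp add: algebra_simps)
  moreover have "2 * sin (P + (2*y - th/2)) * cos th = sin (P + 2*y + th/2) + sin (P + 2*y - 3/2*th)"
    using pr[of "P + (2*y - th/2)" th] by (simp add: algebra_simps)
  ultimately show ?thesis unfolding e sin_minus by (simp add: algebra_simps)
qed

lemma in_seq_34:
  "in_seq th m n 4 = centre_coord th + amplitude th m n * cos (pi/4 + 2 * real n * th - 5/2 * th)"
  "in_seq th m n 3 = centre_coord th + amplitude th m n * sin (pi/4 + 2 * real n * th - 3/2 * th)"
  using in_seq_mod4(1)[of th m n 1] in_seq_mod4(4)[of th m n 0] by (simp_all add: algebra_simps)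

lemma in_line_inn: "in_line th n (in_seq th m n 4, in_seq th m n 3)"
  by (simp add: in_line_def in_seq_34)

lemma out_line_inn:
  assumes "cos th \<noteq> 0" "sin (pi/4 + (2 * real n + 2 * real m - 1/2) * th) \<noteq> 0"
  shows "out_line th m (in_seq th m n 4, in_seq th m n 3)"
proof -
  define P where "P = pi/4 + 2 * real n * th"
  have e: "pi/4 + (2 * real n + 2 * real m - 1/2) * th = P + (2 * real m - 1/2) * th"
    by (simp add: P_def algebra_simps)
  have "amplitude th m n * cos (P - 5/2*th) * sin ((2 * real m + 1) * th) + amplitude th m n * sin (P - 3/2*th) * cos ((2 * real m + 2) * th)
    = amplitude th m n * (sin (P + (2 * real m - 1/2) * th) * cos th)"
    unfolding sin_cos_sum_identity[symmetric] by (simp add: algebra_simps)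
  also have "\<dots> = cos ((2 * real m - 1) * th) / (2 * cos th)"
    using assms unfolding amplitude_def e by (simp add: field_simps power2_eq_square)
  finally show ?thesis by (simp add: out_line_def in_seq_34 P_def)
qed

lemma lines_meet_once:
  assumes "cos th \<noteq> 0" "sin (pi/4 + (2 * real n + 2 * real m - 1/2) * th) \<noteq> 0"
    and "out_line th m z" "in_line th n z"
  shows "z = (in_seq th m n 4, in_seq th m n 3)"
proof -
  define P where "P = pi/4 + 2 * real n * th"
  have e: "pi/4 + (2 * real n + 2 * real m - 1/2) * th = P + (2 * real m - 1/2) * th"
    by (simp add: P_def algebra_simps)
  let ?a = "sin ((2 * real m + 1) * th)" and ?b = "cos ((2 * real m + 2) * th)"
    and ?c = "sin (P - 3/2 * th)" and ?d = "- cos (P - 5/2 * th)"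
  have "?a * ?d - ?b * ?c = - (sin (P + (2 * real m - 1/2) * th) * cos th)"
    unfolding sin_cos_sum_identity[symmetric] by (simp add: algebra_simps)
  then have ne: "?a * ?d - ?b * ?c \<noteq> 0" using assms(1,2) unfolding e by simp
  have "fst z = in_seq th m n 4 \<and> snd z = in_seq th m n 3"
    by (rule cramer_unique[OF ne])
      (use assms(3,4) out_line_inn[OF assms(1,2)] in_line_inn[of th n m] in
        \<open>simp_all add: out_line_alt in_line_alt P_def\<close>)
  then show ?thesis by (simp add: prod_eq_iff)
qed

lemma theta_sin: "0 \<le> th \<Longrightarrow> th \<le> pi/2 \<Longrightarrow> theta (2 * sin th) = th"
  by (simp add: theta_def arcsin_sin)

lemma multiple_angles:
  fixes th :: real
  shows "sin (2*th) = 2 * sin th * cos th" "cos (2*th) = 1 - 2 * (sin th)^2"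
    "sin (4*th) = 4 * sin th * cos th * (1 - 2 * (sin th)^2)"
    "cos (4*th) = 1 - 8 * (sin th)^2 + 8 * (sin th)^4"
    "sin (5*th) = sin th * (5 - 20 * (sin th)^2 + 16 * (sin th)^4)"
    "cos (5*th) = cos th * (1 - 12 * (sin th)^2 + 16 * (sin th)^4)"
    "sin (3*th) = sin th * (3 - 4 * (sin th)^2)"
    "cos (3*th) = cos th * (1 - 4 * (sin th)^2)"
    "cos (6*th) = 1 - 18 * (sin th)^2 + 48 * (sin th)^4 - 32 * (sin th)^6"
proof -
  have c2: "cos th * cos th = 1 - sin th * sin th" using cos_squared_eq[of th] by (simp add: power2_eq_square)
  show s2: "sin (2*th) = 2 * sin th * cos th" and k2: "cos (2*th) = 1 - 2 * (sin th)^2"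
    by (simp_all add: sin_double cos_double_sin)
  have d4: "4*th = 2*(2*th)" and d5: "5*th = 4*th + th" and d3: "3*th = 2*th + th" and d6: "6*th = 2*(3*th)" by simp_all
  show s4: "sin (4*th) = 4 * sin th * cos th * (1 - 2 * (sin th)^2)"
    unfolding d4 sin_double[of "2*th"] s2 k2 by simp
  show k4: "cos (4*th) = 1 - 8 * (sin th)^2 + 8 * (sin th)^4"
  proof -
    have "(sin (2*th))^2 = 4 * (sin th)^2 * (cos th * cos th)" unfolding s2 by (simp add: field_simps eval_nat_numeral)
    then show ?thesis unfolding d4 cos_double_sin[of "2*th"] c2 by (simp add: field_simps eval_nat_numeral)
  qed
  show "sin (5*th) = sin th * (5 - 20 * (sin th)^2 + 16 * (sin th)^4)"
  proof -
    have "sin (4*th + th) = 4 * sin th * (cos th * cos th) * (1 - 2 * (sin th)^2)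
      + (1 - 8 * (sin th)^2 + 8 * (sin th)^4) * sin th"
      unfolding sin_add s4 k4 by (simp add: field_simps eval_nat_numeral)
    then show ?thesis unfolding d5 c2 by (simp add: field_simps eval_nat_numeral)
  qed
  show "cos (5*th) = cos th * (1 - 12 * (sin th)^2 + 16 * (sin th)^4)"
    unfolding d5 cos_add s4 k4 by (simp add: field_simps eval_nat_numeral)
  show s3: "sin (3*th) = sin th * (3 - 4 * (sin th)^2)"
  proof -
    have "sin (2*th + th) = 2 * sin th * (cos th * cos th) + (1 - 2 * (sin th)^2) * sin th"
      unfolding sin_add s2 k2 by (simp add: field_simps eval_nat_numeral)
    then show ?thesis unfolding d3 c2 by (simp add: field_simps eval_nat_numeral)
  qed
  show "cos (3*th) = cos th * (1 - 4 * (sin th)^2)"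
    unfolding d3 cos_add s2 k2 by (simp add: field_simps eval_nat_numeral)
  show "cos (6*th) = 1 - 18 * (sin th)^2 + 48 * (sin th)^4 - 32 * (sin th)^6"
    unfolding d6 cos_double_sin[of "3*th"] s3 by (simp add: field_simps eval_nat_numeral)
qed

text \<open>With \<open>A = (2 m + 1) th\<close> and after division by \<open>sin A\<close> this is a polynomial identity in
  \<open>s = sin th\<close> and \<open>q = cot A / cos th\<close>.\<close>
lemma P0_on_out_line:
  assumes th: "0 < th" "th < pi/2" and ne: "cos ((2 * real m + 1) * th) \<noteq> 0" "sin ((2 * real m + 1) * th) \<noteq> 0"
  shows "out_line th m (P0 (2 * sin th) m)"
proof -
  define s where "s = sin th"
  define A where "A = (2 * real m + 1) * th"
  define q where "q = cos A / (cos th * sin A)"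
  have c: "cos th \<noteq> 0" using cos_gt_zero[of th] th by simp
  have g: "centre_coord th * (2 - 2 * s) = 1" using centre_coord_eq[OF c] by (simp add: s_def)
  have c2: "cos th * cos th = 1 - s * s" using cos_squared_eq[of th] by (simp add: power2_eq_square s_def)
  have S: "sin A \<noteq> 0" using ne by (simp add: A_def)
  have K: "cos A = q * cos th * sin A" using c S by (simp add: q_def)
  have tq: "tan th / tan A = s * q" using c S ne by (simp add: q_def s_def tan_def A_def field_simps)
  have e: "(2 * real m + 2) * th = A + th" "(2 * real m - 1) * th = A - 2 * th"
    by (simp_all add: A_def algebra_simps)
  have r1: "cos (A + th) = sin A * (q * (1 - s * s) - s)"
    unfolding cos_add K c2[symmetric] by (simp add: s_def algebra_simps)
  have r2: "cos (A - 2*th) / (2 * cos th) = sin A * (q * (1 - 2 * s * s) / 2 + s)"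
    unfolding cos_diff K multiple_angles(1,2) using c by (simp add: s_def power2_eq_square field_simps)
  define U where "U = (1 + 4 * s + s * q) / 2"
  have UV: "P0 (2 * sin th) m = (U, 1)"
    using th by (simp add: P0_def theta_sin A_def[symmetric] tq U_def s_def)
  have "(U - centre_coord th) + (1 - centre_coord th) * (q * (1 - s * s) - s)
    = U + q * (1 - s * s) - s - (centre_coord th * (2 - 2 * s)) * ((1 + q * (1 + s)) / 2)" by (simp add: field_simps eval_nat_numeral)
  also have "\<dots> = q * (1 - 2 * s * s) / 2 + s" unfolding g U_def by (simp add: field_simps eval_nat_numeral)
  finally have "sin A * ((U - centre_coord th) + (1 - centre_coord th) * (q * (1 - s * s) - s)) = sin A * (q * (1 - 2 * s * s) / 2 + s)"
    by simp
  then show ?thesis unfolding out_line_def UV e A_def[symmetric] r1 r2 fst_conv snd_conv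
    by (simp only: distrib_left mult_ac)
qed

text \<open>As for \<open>P0\<close>, with the angle \<open>A = (2 m - 3) th\<close>.\<close>
lemma P1_on_out_line:
  assumes th: "0 < th" "th < pi/2" and m: "3 \<le> m"
    and ne: "cos ((2 * real m - 3) * th) \<noteq> 0" "sin ((2 * real m - 3) * th) \<noteq> 0"
  shows "out_line th m (P1 (2 * sin th) (m - 1))"
proof -
  define s where "s = sin th"
  define A where "A = (2 * real m - 3) * th"
  define q where "q = cos A / (cos th * sin A)"
  have c: "cos th \<noteq> 0" using cos_gt_zero[of th] th by simp
  have g: "centre_coord th * (2 - 2 * s) = 1" using centre_coord_eq[OF c] by (simp add: s_def)
  have c2: "cos th * cos th = 1 - s * s" using cos_squared_eq[of th] by (simp add: power2_eq_square s_def)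
  have S: "sin A \<noteq> 0" using ne by (simp add: A_def)
  have K: "cos A = q * cos th * sin A" using c S by (simp add: q_def)
  have tq: "tan th / tan A = s * q" using c S ne by (simp add: q_def s_def tan_def A_def field_simps)
  have e: "(2 * real m + 1) * th = A + 4 * th" "(2 * real m + 2) * th = A + 5 * th" "(2 * real m - 1) * th = A + 2 * th"
    by (simp_all add: A_def algebra_simps)
  have r0: "sin (A + 4 * th) = sin A * (1 - 8 * s^2 + 8 * s^4 + 4 * s * q * (1 - s^2) * (1 - 2 * s^2))"
  proof -
    have "sin (A + 4 * th) = sin A * (1 - 8 * s^2 + 8 * s^4 + 4 * s * q * (cos th * cos th) * (1 - 2 * s^2))"
      unfolding sin_add K multiple_angles(3,4) s_def[symmetric] by (simp add: field_simps eval_nat_numeral)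
    then show ?thesis unfolding c2 by (simp only: power2_eq_square)
  qed
  have r1: "cos (A + 5 * th) = sin A * (q * (1 - s^2) * (1 - 12 * s^2 + 16 * s^4) - s * (5 - 20 * s^2 + 16 * s^4))"
  proof -
    have "cos (A + 5 * th) = sin A * (q * (cos th * cos th) * (1 - 12 * s^2 + 16 * s^4) - s * (5 - 20 * s^2 + 16 * s^4))"
      unfolding cos_add K multiple_angles(5,6) s_def[symmetric] by (simp add: field_simps eval_nat_numeral)
    then show ?thesis unfolding c2 by (simp only: power2_eq_square)
  qed
  have r2: "cos (A + 2*th) / (2 * cos th) = sin A * (q * (1 - 2 * s * s) / 2 - s)"
    unfolding cos_add K multiple_angles(1,2) using c by (simp add: s_def power2_eq_square field_simps)
  define U where "U = (1 + 4 * s - 4 * s^2 + 16 * s^4 + (1 - 12 * s^2 + 16 * s^4) * (s * q)) / 2"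
  define V where "V = 1 + 4 * s^3 + s * (4 * s^2 - 2) * (s * q)"
  have UV: "P1 (2 * sin th) (m - 1) = (U, V)"
  proof -
    have "(2 * real (m - 1) - 1) * th = A" using m by (simp add: A_def of_nat_diff algebra_simps)
    then show ?thesis using m th unfolding P1_def U_def V_def
      by (simp add: theta_sin tq s_def power_mult_distrib)
  qed
  define X where "X = 1 - 8 * s^2 + 8 * s^4 + 4 * s * q * (1 - s^2) * (1 - 2 * s^2)"
  define Y where "Y = q * (1 - s^2) * (1 - 12 * s^2 + 16 * s^4) - s * (5 - 20 * s^2 + 16 * s^4)"
  \<comment> \<open>\<open>X + Y\<close> is divisible by \<open>2 - 2 s\<close>, the reciprocal of the centre coordinate, which thereby disappears\<close>
  define M where "M = (1 - 4 * s - 12 * s^2 + 8 * s^3 + 16 * s^4 + q * (1 + s) * (1 + 4 * s - 12 * s^2 - 8 * s^3 + 16 * s^4)) / 2"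
  have "X + Y = (2 - 2 * s) * M" unfolding X_def Y_def M_def by (simp add: field_simps eval_nat_numeral)
  moreover have "(U - centre_coord th) * X + (V - centre_coord th) * Y = U * X + V * Y - centre_coord th * (X + Y)" by (simp add: field_simps eval_nat_numeral)
  ultimately have "(U - centre_coord th) * X + (V - centre_coord th) * Y = U * X + V * Y - (centre_coord th * (2 - 2 * s)) * M"
    by (simp only: mult.assoc)
  also have "\<dots> = q * (1 - 2 * s * s) / 2 - s" unfolding g U_def V_def X_def Y_def M_def by (simp add: field_simps eval_nat_numeral)
  finally have "sin A * ((U - centre_coord th) * X + (V - centre_coord th) * Y) = sin A * (q * (1 - 2 * s * s) / 2 - s)" by simp
  then show ?thesis unfolding out_line_def UV e r0 r1 r2 fst_conv snd_conv X_def Y_def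
    by (simp only: distrib_left mult.left_commute)
qed

lemma P1_0_on_out_line:
  assumes th: "0 < th" "th < pi/2" and ne: "cos (4 * th) \<noteq> 0"
  shows "out_line th 1 (P1 (2 * sin th) 0)"
proof -
  define s where "s = sin th"
  have c: "cos th \<noteq> 0" using cos_gt_zero[of th] th by simp
  have g: "centre_coord th * (2 - 2 * s) = 1" using centre_coord_eq[OF c] by (simp add: s_def)
  define d where "d = 1 - 8 * s^2 + 8 * s^4"
  define V where "V = (1 - s - 2 * s^2) / d"
  have d: "cos (4 * th) = d" "d \<noteq> 0" using ne by (simp_all add: d_def multiple_angles s_def)
  have nd: "2 - 2 * s - (2 * s)^2 = 2 * (1 - s - 2 * s^2)" "2 - 4 * (2 * s)^2 + (2 * s)^4 = 2 * d"
    unfolding d_def by (simp_all add: field_simps eval_nat_numeral)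
  have "(2 - 2 * s - (2 * s)^2) / (2 - 4 * (2 * s)^2 + (2 * s)^4) = V" unfolding nd V_def by (rule mult_divide_mult_cancel_left) simp
  then have P: "P1 (2 * sin th) 0 = (1, V)" by (simp add: P1_def s_def)
  have Vd: "V * d = 1 - s - 2 * s^2" using d by (simp add: V_def)
  have "(1 - centre_coord th) * (s * (3 - 4 * s^2)) + (V - centre_coord th) * d = s * (3 - 4 * s^2) + V * d - centre_coord th * (s * (3 - 4 * s^2) + d)" by (simp add: field_simps eval_nat_numeral)
  also have "s * (3 - 4 * s^2) + d = (2 - 2 * s) * ((1 + 4 * s - 4 * s^2 - 8 * s^3) / 2)" unfolding d_def by (simp add: field_simps eval_nat_numeral)
  also have "s * (3 - 4 * s^2) + V * d - centre_coord th * ((2 - 2 * s) * ((1 + 4 * s - 4 * s^2 - 8 * s^3) / 2))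
     = s * (3 - 4 * s^2) + V * d - (centre_coord th * (2 - 2 * s)) * ((1 + 4 * s - 4 * s^2 - 8 * s^3) / 2)" by (simp add: field_simps eval_nat_numeral)
  also have "\<dots> = 1 / 2" unfolding g Vd by (simp add: field_simps eval_nat_numeral)
  finally have "(1 - centre_coord th) * (s * (3 - 4 * s^2)) + (V - centre_coord th) * d = 1 / 2" .
  moreover have "(2 * real 1 + 1) * th = 3 * th" "(2 * real 1 + 2) * th = 4 * th" "(2 * real 1 - 1) * th = th"
    by simp_all
  ultimately show ?thesis using c unfolding out_line_def P
    by (simp only: d(1) multiple_angles(7) s_def[symmetric] fst_conv snd_conv) simp
qed

lemma P1_1_on_out_line:
  assumes th: "0 < th" "th < pi/2" and ne: "cos (6 * th) \<noteq> 0"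
  shows "out_line th 2 (P1 (2 * sin th) 1)"
proof -
  define s where "s = sin th"
  have c: "cos th \<noteq> 0" using cos_gt_zero[of th] th by simp
  have g: "centre_coord th * (2 - 2 * s) = 1" using centre_coord_eq[OF c] by (simp add: s_def)
  define d where "d = 1 - 18 * s^2 + 48 * s^4 - 32 * s^6"
  define V where "V = (1 - 2 * s - 8 * s^2 + 4 * s^3 + 8 * s^4) / d"
  have d: "cos (6 * th) = d" "d \<noteq> 0" using ne by (simp_all add: d_def multiple_angles s_def)
  have nd: "2 - 2 * (2 * s) - 4 * (2 * s)^2 + (2 * s)^3 + (2 * s)^4 = 2 * (1 - 2 * s - 8 * s^2 + 4 * s^3 + 8 * s^4)"
    "2 - 9 * (2 * s)^2 + 6 * (2 * s)^4 - (2 * s)^6 = 2 * d"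
    unfolding d_def by (simp_all add: field_simps eval_nat_numeral)
  have "(2 - 2 * (2 * s) - 4 * (2 * s)^2 + (2 * s)^3 + (2 * s)^4) / (2 - 9 * (2 * s)^2 + 6 * (2 * s)^4 - (2 * s)^6) = V"
    unfolding nd V_def by (rule mult_divide_mult_cancel_left) simp
  then have P: "P1 (2 * sin th) 1 = (1, V)" by (simp add: P1_def s_def)
  have Vd: "V * d = 1 - 2 * s - 8 * s^2 + 4 * s^3 + 8 * s^4" using d by (simp add: V_def)
  have "(1 - centre_coord th) * (s * (5 - 20 * s^2 + 16 * s^4)) + (V - centre_coord th) * d = s * (5 - 20 * s^2 + 16 * s^4) + V * d - centre_coord th * (s * (5 - 20 * s^2 + 16 * s^4) + d)" by (simp add: field_simps eval_nat_numeral)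
  also have "s * (5 - 20 * s^2 + 16 * s^4) + d = (2 - 2 * s) * ((1 + 6 * s - 12 * s^2 - 32 * s^3 + 16 * s^4 + 32 * s^5) / 2)" unfolding d_def by (simp add: field_simps eval_nat_numeral)
  also have "s * (5 - 20 * s^2 + 16 * s^4) + V * d - centre_coord th * ((2 - 2 * s) * ((1 + 6 * s - 12 * s^2 - 32 * s^3 + 16 * s^4 + 32 * s^5) / 2))
     = s * (5 - 20 * s^2 + 16 * s^4) + V * d - (centre_coord th * (2 - 2 * s)) * ((1 + 6 * s - 12 * s^2 - 32 * s^3 + 16 * s^4 + 32 * s^5) / 2)" by (simp add: field_simps eval_nat_numeral)
  also have "\<dots> = (1 - 4 * s^2) / 2" unfolding g Vd by (simp add: field_simps eval_nat_numeral)
  finally have "(1 - centre_coord th) * (s * (5 - 20 * s^2 + 16 * s^4)) + (V - centre_coord th) * d = (1 - 4 * s^2) / 2" .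
  moreover have "(2 * real 2 + 1) * th = 5 * th" "(2 * real 2 + 2) * th = 6 * th" "(2 * real 2 - 1) * th = 3 * th"
    by simp_all
  ultimately show ?thesis using c unfolding out_line_def P
    by (simp only: d(1) multiple_angles(5,8) s_def[symmetric] fst_conv snd_conv) simp
qed

lemma Q_on_in_line:
  fixes n :: nat and th :: real
  defines "P \<equiv> pi/4 + 2 * real n * th"
  assumes "1 \<le> n" "cos th \<noteq> 0" "sin (P + 5/2*th) \<noteq> 0" "cos (P + 5/2*th) \<noteq> 0"
    "sin (P - 3/2*th) \<noteq> 0" "cos (P - 3/2*th) \<noteq> 0"
  shows "in_line th n (Q0 (2 * sin th) (n - 1))" "in_line th n (Q1 (2 * sin th) n)"
proof -
  have e: "pi/4 + 2 * real (n - 1) * th + th/2 = P - 3/2*th" "pi/4 + 2 * real (n - 1) * th - th/2 = P - 5/2*th"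
    using assms(2) by (simp_all add: P_def of_nat_diff algebra_simps)
  show "in_line th n (Q0 (2 * sin th) (n - 1))"
    using Q0_eq[of th "n - 1"] assms unfolding e by (simp add: in_line_def P_def)
  show "in_line th n (Q1 (2 * sin th) n)"
    using Q1_eq[of th n] assms by (simp add: in_line_def P_def)
qed

section \<open>Limits at a fixed angle\<close>

lemma tan_quotient_limit:
  assumes "0 < (a::real)"
  shows "((\<lambda>t. tan t / tan (a * t)) \<longlongrightarrow> 1 / a) (at_right 0)"
proof -
  have "((\<lambda>t. tan t / tan (a * t)) \<longlongrightarrow> inverse a) (at_right 0)"
    using assms by real_asymp
  then show ?thesis by (simp add: inverse_eq_divide)
qed

lemma sin_quotient_limit: "((\<lambda>t::real. sin (a * t) / t) \<longlongrightarrow> a) (at_right 0)"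
  by real_asymp

lemma cos_quotient_limit: "((\<lambda>t::real. (cos (a * t) - 1) / t) \<longlongrightarrow> 0) (at_right 0)"
  by real_asymp

text \<open>The difference quotient of two fractions along a sequence: the numerators are compared with a
  common base \<open>X\<close> and the denominators with a common base \<open>Y\<close>, both of which may move.\<close>
lemma quotient_difference_limit:
  fixes t :: "nat \<Rightarrow> real"
  assumes "\<And>k. t k \<noteq> 0"
    and X: "X \<longlonglongrightarrow> x" and Y: "Y \<longlonglongrightarrow> y" "y \<noteq> 0" and t: "t \<longlonglongrightarrow> 0"
    and A: "(\<lambda>k. (A k - X k) / t k) \<longlonglongrightarrow> a" and A': "(\<lambda>k. (A' k - X k) / t k) \<longlonglongrightarrow> a'"
    and B: "(\<lambda>k. (B k - Y k) / t k) \<longlonglongrightarrow> b" and B': "(\<lambda>k. (B' k - Y k) / t k) \<longlonglongrightarrow> b'"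
  shows "(\<lambda>k. (A k / B k - A' k / B' k) / t k) \<longlonglongrightarrow> ((a - a') * y - x * (b - b')) / (y * y)"
proof -
  have lim: "(\<lambda>k. U k) \<longlonglongrightarrow> z" if "(\<lambda>k. (U k - Z k) / t k) \<longlonglongrightarrow> u" "Z \<longlonglongrightarrow> z" for U Z u z
  proof -
    have "(\<lambda>k. (U k - Z k) / t k * t k + Z k) \<longlonglongrightarrow> u * 0 + z" by (intro tendsto_intros that t)
    then show ?thesis using assms(1) by simp
  qed
  note Bl = lim[OF B Y(1)] lim[OF B' Y(1)]
  have "(\<lambda>k. (((A k - X k) / t k) * B' k - ((A' k - X k) / t k) * B k + X k * ((B' k - Y k) / t k - (B k - Y k) / t k)) / (B k * B' k))
    \<longlonglongrightarrow> (a * y - a' * y + x * (b' - b)) / (y * y)"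
    by (intro tendsto_intros A A' B B' Bl X) (use Y in simp)
  moreover have "\<forall>\<^sub>F k in sequentially. (((A k - X k) / t k) * B' k - ((A' k - X k) / t k) * B k + X k * ((B' k - Y k) / t k - (B k - Y k) / t k)) / (B k * B' k)
     = (A k / B k - A' k / B' k) / t k"
    using tendsto_imp_eventually_ne[OF Bl(1) Y(2)] tendsto_imp_eventually_ne[OF Bl(2) Y(2)]
  proof eventually_elim
    case (elim k)
    then show ?case using assms(1)[of k] by (simp add: field_simps)
  qed
  ultimately have "(\<lambda>k. (A k / B k - A' k / B' k) / t k) \<longlonglongrightarrow> (a * y - a' * y + x * (b' - b)) / (y * y)"
    by (rule Lim_transform_eventually)
  moreover have "a * y - a' * y + x * (b' - b) = (a - a') * y - x * (b - b')" by (simp add: algebra_simps)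
  ultimately show ?thesis by simp
qed

lemma point_on_segment_fst:
  fixes A B z :: point
  assumes line: "a * fst A + b * snd A = d" "a * fst B + b * snd B = d" "a * fst z + b * snd z = d"
    and "b \<noteq> 0" and "fst A < fst z" "fst z < fst B"
  shows "z \<in> closed_segment A B"
proof -
  define s where "s = (fst z - fst A) / (fst B - fst A)"
  have s: "0 \<le> s" "s \<le> 1" "s * (fst B - fst A) = fst z - fst A" using assms(5,6) by (auto simp: s_def)
  have "b * (snd z - snd A) = - a * (fst z - fst A)" "b * (snd B - snd A) = - a * (fst B - fst A)"
    using line by (simp_all add: algebra_simps)
  moreover have "b * (snd z - snd A - s * (snd B - snd A)) = b * (snd z - snd A) - s * (b * (snd B - snd A))"
    by (simp add: algebra_simps)
  ultimately have "b * (snd z - snd A - s * (snd B - snd A)) = - a * (fst z - fst A) - s * (- a * (fst B - fst A))"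
    by (simp only:)
  also have "\<dots> = - a * (fst z - fst A) + a * (s * (fst B - fst A))" by (simp add: algebra_simps)
  also have "\<dots> = 0" unfolding s(3) by simp
  finally have "snd z = snd A + s * (snd B - snd A)" using assms(4) by simp
  moreover have "fst z = fst A + s * (fst B - fst A)" using s(3) by simp
  ultimately have "z = (1 - s) *\<^sub>R A + s *\<^sub>R B" by (simp add: prod_eq_iff algebra_simps)
  then show ?thesis using s by (auto simp: closed_segment_def)
qed

lemma point_on_segment_snd:
  fixes A B z :: point
  assumes line: "a * fst A + b * snd A = d" "a * fst B + b * snd B = d" "a * fst z + b * snd z = d"
    and "a \<noteq> 0" and "snd B < snd z" "snd z < snd A"
  shows "z \<in> closed_segment A B"
proof -
  let ?f = "\<lambda>p::point. (snd p, fst p)"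
  have "?f z \<in> closed_segment (?f B) (?f A)"
    by (rule point_on_segment_fst[of b _ a d]) (use assms in auto)
  then obtain s where s: "0 \<le> s" "s \<le> 1" "?f z = (1 - s) *\<^sub>R ?f B + s *\<^sub>R ?f A"
    by (auto simp: closed_segment_def)
  then have "z = (1 - s) *\<^sub>R B + s *\<^sub>R A" by (simp add: prod_eq_iff)
  then have "z \<in> closed_segment B A" using s by (auto simp: closed_segment_def)
  then show ?thesis by (simp add: closed_segment_commute)
qed

text \<open>The scale on which the islands of a fixed \<open>m\<close> are seen: \<open>th\<close> tends to zero while the angle \<open>2 n th\<close>
  through which the point turns, up to the factor 2, tends to a number strictly between 0 and
  \<open>\<pi>/4\<close>.\<close>
locale fine_scale =
  fixes th :: "nat \<Rightarrow> real" and n :: "nat \<Rightarrow> nat" and bt :: real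
  assumes th_pos: "\<And>k. 0 < th k" and th_0: "th \<longlonglongrightarrow> 0"
    and n_th: "(\<lambda>k. 2 * real (n k) * th k) \<longlonglongrightarrow> bt"
    and bt: "0 < bt" "bt < pi/4"
begin

definition lam where "lam k = 2 * sin (th k)"
definition P where "P k = pi/4 + 2 * real (n k) * th k"
definition tau where "tau = tan (pi/4 - bt)"
abbreviation "p \<equiv> pi/4 + bt"

lemma th_right: "filterlim th (at_right 0) sequentially"
proof -
  have "th k \<in> {0<..} \<and> th k \<noteq> 0" for k using th_pos[of k] by simp
  then show ?thesis using th_0 by (simp add: filterlim_at)
qed

lemma th_ne [simp]: "th k \<noteq> 0"
  using th_pos[of k] by simp

lemma sin_cos_p_pos: "0 < sin p" "0 < cos p"
  using bt by (auto intro!: sin_gt_zero cos_gt_zero)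

lemma tau_eq: "tau = cos p / sin p"
proof -
  have "pi/4 - bt = pi/2 - p" by simp
  moreover have "sin (pi/2 - x) = cos x" "cos (pi/2 - x) = sin x" for x :: real by (simp_all add: sin_diff cos_diff)
  ultimately show ?thesis by (simp only: tau_def tan_def)
qed

lemma tau_01: "0 < tau" "tau < 1"
proof -
  show "0 < tau" using sin_cos_p_pos by (simp add: tau_eq)
  have "tan (pi/4 - bt) < tan (pi/4)" using bt by (intro tan_monotone) auto
  then show "tau < 1" by (simp add: tau_def tan_45)
qed

lemma P_lim: "P \<longlonglongrightarrow> p"
  unfolding P_def[abs_def] by (intro tendsto_intros n_th)

lemma a_th: "(\<lambda>k. a * th k) \<longlonglongrightarrow> 0"
  using tendsto_mult[OF tendsto_const th_0, of a] by simp

lemma sinP: "(\<lambda>k. sin (P k + a * th k)) \<longlonglongrightarrow> sin p"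
  and cosP: "(\<lambda>k. cos (P k + a * th k)) \<longlonglongrightarrow> cos p"
  using tendsto_sin[OF tendsto_add[OF P_lim a_th[of a]]] tendsto_cos[OF tendsto_add[OF P_lim a_th[of a]]] by simp_all

lemma sin_th: "(\<lambda>k. sin (a * th k)) \<longlonglongrightarrow> 0" and cos_th: "(\<lambda>k. cos (a * th k)) \<longlonglongrightarrow> 1"
  using tendsto_sin[OF a_th[of a]] tendsto_cos[OF a_th[of a]] by simp_all

lemmas sin_th1 = sin_th[of 1, simplified] and cos_th1 = cos_th[of 1, simplified]

lemma sin_quot: "(\<lambda>k. sin (a * th k) / th k) \<longlonglongrightarrow> a"
  by (rule filterlim_compose[OF sin_quotient_limit th_right])

lemma cos_quot: "(\<lambda>k. (cos (a * th k) - 1) / th k) \<longlonglongrightarrow> 0"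
  by (rule filterlim_compose[OF cos_quotient_limit th_right])

lemma lam_pos: "\<forall>\<^sub>F k in sequentially. 0 < lam k"
proof -
  have "\<forall>\<^sub>F k in sequentially. th k < pi" using order_tendstoD(2)[OF th_0, of pi] by simp
  then show ?thesis by eventually_elim (use th_pos in \<open>simp add: lam_def sin_gt_zero\<close>)
qed

lemma lam_0: "lam \<longlonglongrightarrow> 0"
  unfolding lam_def[abs_def] using tendsto_mult[OF tendsto_const sin_th1, of 2] by simp

lemma lam_th: "(\<lambda>k. lam k / th k) \<longlonglongrightarrow> 2"
  using tendsto_mult[OF tendsto_const sin_quot[of 1], of 2] by (simp add: lam_def)

lemma per_th_imp_per_lam:
  assumes "(\<lambda>k. f k / th k) \<longlonglongrightarrow> c"
  shows "(\<lambda>k. f k / lam k) \<longlonglongrightarrow> c / 2"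
proof -
  have "(\<lambda>k. (f k / th k) / (lam k / th k)) \<longlonglongrightarrow> c / 2"
    by (intro tendsto_divide assms lam_th) simp
  moreover have "(f k / th k) / (lam k / th k) = f k / lam k" for k
    using th_pos[of k] by simp
  ultimately show ?thesis by simp
qed

lemma d_sin: "(\<lambda>k. (sin (P k + a * th k) - sin (P k)) / th k) \<longlonglongrightarrow> a * cos p"
proof -
  have "(\<lambda>k. sin (P k) * ((cos (a * th k) - 1) / th k) + cos (P k) * (sin (a * th k) / th k)) \<longlonglongrightarrow> sin p * 0 + cos p * a"
    by (intro tendsto_intros sin_quot cos_quot P_lim)
  then show ?thesis
    by (simp add: sin_add algebra_simps add_divide_distrib diff_divide_distrib)
qed

lemma d_cos: "(\<lambda>k. (cos (P k + a * th k) - cos (P k)) / th k) \<longlonglongrightarrow> - a * sin p"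
proof -
  have "(\<lambda>k. cos (P k) * ((cos (a * th k) - 1) / th k) - sin (P k) * (sin (a * th k) / th k)) \<longlonglongrightarrow> cos p * 0 - sin p * a"
    by (intro tendsto_intros sin_quot cos_quot P_lim)
  then show ?thesis
    by (simp add: cos_add algebra_simps add_divide_distrib diff_divide_distrib)
qed

lemma sinP0: "(\<lambda>k. sin (P k)) \<longlonglongrightarrow> sin p" and cosP0: "(\<lambda>k. cos (P k)) \<longlonglongrightarrow> cos p"
  by (intro tendsto_intros P_lim)+

text \<open>The coordinates of the vertices of \<open>Lambda_in\<close> are quotients of this form, and the vertices of one
  region differ only by terms of the order of \<open>th\<close>.\<close>
lemma d_cos_sin:
  "(\<lambda>k. (cos (P k + a * th k) / sin (P k + b * th k) - cos (P k + a' * th k) / sin (P k + b' * th k)) / th k)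
     \<longlonglongrightarrow> (a' - a) - (b - b') * tau^2"
proof -
  have "(\<lambda>k. (cos (P k + a * th k) / sin (P k + b * th k) - cos (P k + a' * th k) / sin (P k + b' * th k)) / th k)
     \<longlonglongrightarrow> ((- a * sin p - - a' * sin p) * sin p - cos p * (b * cos p - b' * cos p)) / (sin p * sin p)"
    by (rule quotient_difference_limit[OF _ cosP0 sinP0 _ th_0 d_cos d_cos d_sin d_sin])
      (use sin_cos_p_pos th_pos in \<open>auto simp: less_imp_neq[THEN not_sym]\<close>)
  moreover have "((- a * sin p - - a' * sin p) * sin p - cos p * (b * cos p - b' * cos p)) / (sin p * sin p)
      = (a' - a) - (b - b') * tau^2"
    using sin_cos_p_pos by (simp add: tau_eq field_simps power2_eq_square)
  ultimately show ?thesis by simp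
qed

lemma d_sin_sin:
  "(\<lambda>k. (sin (P k + a * th k) / sin (P k + b * th k) - sin (P k + a' * th k) / sin (P k + b' * th k)) / th k)
     \<longlonglongrightarrow> (a - a' - b + b') * tau"
proof -
  have "(\<lambda>k. (sin (P k + a * th k) / sin (P k + b * th k) - sin (P k + a' * th k) / sin (P k + b' * th k)) / th k)
     \<longlonglongrightarrow> ((a * cos p - a' * cos p) * sin p - sin p * (b * cos p - b' * cos p)) / (sin p * sin p)"
    by (rule quotient_difference_limit[OF _ sinP0 sinP0 _ th_0 d_sin d_sin d_sin d_sin])
      (use sin_cos_p_pos th_pos in \<open>auto simp: less_imp_neq[THEN not_sym]\<close>)
  moreover have "((a * cos p - a' * cos p) * sin p - sin p * (b * cos p - b' * cos p)) / (sin p * sin p)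
      = (a - a' - b + b') * tau"
    using sin_cos_p_pos by (simp add: tau_eq field_simps)
  ultimately show ?thesis by simp
qed

lemma centre_coord_lim: "(\<lambda>k. centre_coord (th k)) \<longlonglongrightarrow> 1/2"
proof -
  have "(\<lambda>k. (1 + sin (th k)) / (2 * (cos (th k))^2)) \<longlonglongrightarrow> (1 + 0) / (2 * 1^2)"
    by (intro tendsto_intros sin_th1 cos_th1) auto
  then show ?thesis by (simp add: centre_coord_def[abs_def])
qed

lemma small_th: "\<forall>\<^sub>F k in sequentially. a * th k < e" if "0 < e"
  using order_tendstoD(2)[OF a_th that] .

lemma n_large: "\<forall>\<^sub>F k in sequentially. 1 \<le> n k"
proof -
  have "\<forall>\<^sub>F k in sequentially. 0 < 2 * real (n k) * th k" using order_tendstoD(1)[OF n_th bt(1)] .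
  then show ?thesis by eventually_elim (auto simp: Suc_le_eq intro!: gr0I)
qed

lemma n_small: "\<forall>\<^sub>F k in sequentially. (2 * real (n k) + a) * th k \<le> pi/4"
proof -
  have "(\<lambda>k. 2 * real (n k) * th k + a * th k) \<longlonglongrightarrow> bt + 0" by (intro tendsto_add n_th a_th)
  then have "\<forall>\<^sub>F k in sequentially. 2 * real (n k) * th k + a * th k < pi/4"
    using order_tendstoD(2) bt(2) by fastforce
  then show ?thesis by eventually_elim (simp add: algebra_simps)
qed

lemma amplitude_angle: "pi/4 + (2 * real (n k) + 2 * real m - 1/2) * th k = P k + (2 * real m - 1/2) * th k"
  by (simp add: P_def algebra_simps)

lemma amplitude_lim: "(\<lambda>k. amplitude (th k) m (n k)) \<longlonglongrightarrow> 1 / (2 * sin p)"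
proof -
  have "(\<lambda>k. cos ((2 * real m - 1) * th k) / (2 * (cos (th k))^2 * sin (P k + (2 * real m - 1/2) * th k)))
     \<longlonglongrightarrow> 1 / (2 * 1^2 * sin p)"
    using sin_cos_p_pos by (intro tendsto_intros cos_th cos_th1 sinP) auto
  then show ?thesis unfolding amplitude_def amplitude_angle by simp
qed

lemma in_seq4_lim: "(\<lambda>k. in_seq (th k) m (n k) 4) \<longlonglongrightarrow> (1 + tau) / 2"
proof -
  have "(\<lambda>k. centre_coord (th k) + amplitude (th k) m (n k) * cos (P k + (-5/2) * th k)) \<longlonglongrightarrow> 1/2 + 1 / (2 * sin p) * cos p"
    by (intro tendsto_intros centre_coord_lim amplitude_lim cosP)
  moreover have "pi/4 + 2 * real (n k) * th k - 5/2 * th k = P k + (-5/2) * th k" for k by (simp add: P_def)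
  ultimately show ?thesis unfolding in_seq_34 by (simp add: tau_eq add_divide_distrib mult.commute)
qed

lemma out_amplitude_lim: "(\<lambda>k. out_amplitude (th k) m (n k)) \<longlonglongrightarrow> tau / 2"
proof -
  have "(\<lambda>k. (sin (th k) / (2 * (cos (th k))^2) + amplitude (th k) m (n k) * cos (P k + 3/2 * th k)) / cos ((2 * real m - 2) * th k))
    \<longlonglongrightarrow> (0 / (2 * 1^2) + 1 / (2 * sin p) * cos p) / 1"
    by (intro tendsto_intros sin_th1 cos_th1 cos_th amplitude_lim cosP) auto
  moreover have "pi/4 + (2 * real (n k) + 3/2) * th k = P k + 3/2 * th k" for k
    by (simp add: P_def algebra_simps)
  ultimately show ?thesis by (simp add: out_amplitude_def tau_eq mult.commute)
qed

text \<open>Up to terms of higher order, \<open>in_seq 3\<close> is the centre, which exceeds \<open>1/2\<close> by \<open>lam / 4\<close>, plus one half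
  of a quotient of two sines whose arguments differ by \<open>(2 m + 1) th\<close>.\<close>
lemma in_seq3_lim: "(\<lambda>k. (1 - in_seq (th k) m (n k) 3) / lam k) \<longlonglongrightarrow> ((2 * real m + 1) * tau - 1) / 4"
proof -
  define K where "K k = cos ((2 * real m - 1) * th k) / (cos (th k))^2" for k
  define R where "R k = sin (P k + (-3/2) * th k) / sin (P k + (2 * real m - 1/2) * th k)" for k
  have in_seq: "in_seq (th k) m (n k) 3 = centre_coord (th k) + K k * R k / 2" for k
    unfolding in_seq_34 amplitude_def amplitude_angle K_def R_def P_def by simp
  have Klim: "(\<lambda>k. (1 - K k) / th k) \<longlonglongrightarrow> 0"
  proof -
    have "(\<lambda>k. ((cos (1 * th k) - 1) / th k * (cos (th k) + 1) - (cos ((2 * real m - 1) * th k) - 1) / th k) / (cos (th k))^2)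
      \<longlonglongrightarrow> (0 * (1 + 1) - 0) / 1^2"
      by (intro tendsto_intros cos_quot cos_th1) auto
    moreover have "\<forall>\<^sub>F k in sequentially. ((cos (1 * th k) - 1) / th k * (cos (th k) + 1) - (cos ((2 * real m - 1) * th k) - 1) / th k) / (cos (th k))^2
      = (1 - K k) / th k"
      using tendsto_imp_eventually_ne[OF cos_th1, of 0, simplified]
    proof eventually_elim
      case (elim k)
      then show ?case using th_pos[of k] by (simp add: K_def field_simps power2_eq_square)
    qed
    ultimately show ?thesis using Lim_transform_eventually by fastforce
  qed
  have Rl: "R \<longlonglongrightarrow> 1"
  proof -
    have "R \<longlonglongrightarrow> sin p / sin p" unfolding R_def[abs_def]
      by (intro tendsto_divide sinP) (use sin_cos_p_pos in auto)
    then show ?thesis using sin_cos_p_pos by simp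
  qed
  have Rlim: "(\<lambda>k. (1 - R k) / th k) \<longlonglongrightarrow> (2 * real m + 1) * tau"
  proof -
    have "(\<lambda>k. (sin (P k + 0 * th k) / sin (P k + 0 * th k) - R k) / th k) \<longlonglongrightarrow> (2 * real m + 1) * tau"
      using d_sin_sin[of 0 0 "-3/2" "2 * real m - 1/2"] unfolding R_def by (simp add: algebra_simps)
    moreover have "\<forall>\<^sub>F k in sequentially. (sin (P k + 0 * th k) / sin (P k + 0 * th k) - R k) / th k = (1 - R k) / th k"
      using tendsto_imp_eventually_ne[OF sinP0, of 0] sin_cos_p_pos by (auto elim: eventually_mono)
    ultimately show ?thesis using Lim_transform_eventually by fastforce
  qed
  have "(\<lambda>k. ((1 - K k) / th k * R k + (1 - R k) / th k) / 2) \<longlonglongrightarrow> (0 * 1 + (2 * real m + 1) * tau) / 2"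
    by (intro tendsto_intros Klim Rl Rlim) simp
  then have 1: "(\<lambda>k. ((1 - K k * R k) / 2) / lam k) \<longlonglongrightarrow> (2 * real m + 1) * tau / 4"
    by (intro per_th_imp_per_lam[where c="(2 * real m + 1) * tau / 2", simplified]) (simp add: algebra_simps add_divide_distrib diff_divide_distrib)
  have 2: "(\<lambda>k. (1/2 - centre_coord (th k)) / lam k) \<longlonglongrightarrow> -1/4"
  proof -
    have "(\<lambda>k. - (1 / (4 * (1 - sin (th k))))) \<longlonglongrightarrow> - (1 / (4 * (1 - 0)))"
      by (intro tendsto_intros sin_th1) simp
    moreover have "\<forall>\<^sub>F k in sequentially. - (1 / (4 * (1 - sin (th k)))) = (1/2 - centre_coord (th k)) / lam k"
      using lam_pos tendsto_imp_eventually_ne[OF cos_th1, of 0, simplified]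
    proof eventually_elim
      case (elim k)
      have s: "sin (th k) \<noteq> 1" using elim(2) cos_squared_eq[of "th k"] by auto
      have c: "centre_coord (th k) = 1 / (2 - 2 * sin (th k))" using centre_coord_eq[OF elim(2)] s by (simp add: field_simps)
      show ?case using elim s unfolding c lam_def by (simp add: field_simps)
    qed
    ultimately show ?thesis using Lim_transform_eventually by fastforce
  qed
  have "(\<lambda>k. (1/2 - centre_coord (th k)) / lam k + ((1 - K k * R k) / 2) / lam k) \<longlonglongrightarrow> -1/4 + (2 * real m + 1) * tau / 4"
    by (intro tendsto_add 1 2)
  moreover have "(1/2 - centre_coord (th k)) / lam k + ((1 - K k * R k) / 2) / lam k = (1 - in_seq (th k) m (n k) 3) / lam k" for k
    unfolding in_seq by (simp add: add_divide_distrib diff_divide_distrib)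
  ultimately show ?thesis by (simp add: diff_divide_distrib)
qed

lemma out_even1_lim: "(\<lambda>k. out_even (th k) m (n k) 1 / lam k) \<longlonglongrightarrow> (1 - (2 * real m - 3) * tau) / 4"
proof -
  have "(\<lambda>k. sin (1 * th k) / th k / (2 * (cos (th k))^2) - out_amplitude (th k) m (n k) * (sin ((2 * real m - 3) * th k) / th k))
     \<longlonglongrightarrow> 1 / (2 * 1^2) - tau / 2 * (2 * real m - 3)"
    by (intro tendsto_intros sin_quot out_amplitude_lim cos_th1) auto
  then have "(\<lambda>k. out_even (th k) m (n k) 1 / th k) \<longlonglongrightarrow> 1/2 - tau / 2 * (2 * real m - 3)"
    unfolding out_even_def by (simp add: algebra_simps add_divide_distrib diff_divide_distrib)
  from per_th_imp_per_lam[OF this] show ?thesis by (simp add: field_simps)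
qed

end

section \<open>The outer regions after rescaling\<close>

context fine_scale
begin

text \<open>Convergence in the strip below the line \<open>y = 1\<close>, stretched by \<open>1 / lam\<close> in the vertical direction.\<close>
definition rescaled :: "(nat \<Rightarrow> point) \<Rightarrow> real \<Rightarrow> real \<Rightarrow> bool" where
  "rescaled A x y \<longleftrightarrow> (\<lambda>k. fst (A k)) \<longlonglongrightarrow> x \<and> (\<lambda>k. (snd (A k) - 1) / lam k) \<longlonglongrightarrow> y"

lemma cross_neg_if_rescaled:
  assumes "rescaled A xa ya" "rescaled B xb yb" "rescaled E xc yc" "rescaled H xd yd"
    and neg: "(xb - xa) * (yc - yd) - (yb - ya) * (xc - xd) < 0"
  shows "\<forall>\<^sub>F k in sequentially. cross (B k - A k) (E k - H k) < 0"
proof -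
  let ?y = "\<lambda>A k. (snd (A k) - 1) / lam k"
  have "(\<lambda>k. (fst (B k) - fst (A k)) * (?y E k - ?y H k) - (?y B k - ?y A k) * (fst (E k) - fst (H k)))
     \<longlonglongrightarrow> (xb - xa) * (yc - yd) - (yb - ya) * (xc - xd)"
    using assms(1-4) unfolding rescaled_def by (intro tendsto_intros) auto
  from order_tendstoD(2)[OF this neg] lam_pos show ?thesis
  proof eventually_elim
    case (elim k)
    have "cross (B k - A k) (E k - H k)
      = lam k * ((fst (B k) - fst (A k)) * (?y E k - ?y H k) - (?y B k - ?y A k) * (fst (E k) - fst (H k)))"
      using elim(2) by (simp add: cross_def field_simps)
    then show ?case using elim by (simp add: mult_pos_neg)
  qed
qed

lemma theta_lam: "\<forall>\<^sub>F k in sequentially. theta (lam k) = th k"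
proof -
  have "\<forall>\<^sub>F k in sequentially. 1 * th k < pi/2" by (rule small_th) simp
  then show ?thesis
    by eventually_elim (use th_pos in \<open>auto simp: lam_def less_imp_le intro!: theta_sin\<close>)
qed

lemma lam_right: "filterlim lam (at_right 0) sequentially"
  unfolding filterlim_at using lam_0 lam_pos by (auto elim: eventually_mono)

lemma tan_quot: "0 < a \<Longrightarrow> (\<lambda>k. tan (th k) / tan (a * th k)) \<longlonglongrightarrow> 1 / a"
  by (rule filterlim_compose[OF tan_quotient_limit th_right])

lemma rescaled_P0: "rescaled (\<lambda>k. P0 (lam k) m) ((1 + 1 / (2 * real m + 1)) / 2) 0"
proof -
  have "(\<lambda>k. (1 + 2 * lam k + tan (th k) / tan ((2 * real m + 1) * th k)) / 2) \<longlonglongrightarrow> (1 + 2 * 0 + 1 / (2 * real m + 1)) / 2"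
    by (intro tendsto_intros lam_0 tan_quot) auto
  moreover have "\<forall>\<^sub>F k in sequentially. (1 + 2 * lam k + tan (th k) / tan ((2 * real m + 1) * th k)) / 2 = fst (P0 (lam k) m)"
    using theta_lam by eventually_elim (simp add: P0_def)
  ultimately have "(\<lambda>k. fst (P0 (lam k) m)) \<longlonglongrightarrow> (1 + 2 * 0 + 1 / (2 * real m + 1)) / 2"
    by (rule Lim_transform_eventually)
  then show ?thesis by (simp add: rescaled_def P0_def)
qed

lemma rescaled_P1:
  assumes "2 \<le> m"
  shows "rescaled (\<lambda>k. P1 (lam k) m) ((1 + 1 / (2 * real m - 1)) / 2) (- (1 / (2 * real m - 1)))"
proof -
  let ?q = "\<lambda>k. tan (th k) / tan ((2 * real m - 1) * th k)"
  have q: "?q \<longlonglongrightarrow> 1 / (2 * real m - 1)" using assms by (intro tan_quot) auto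
  have "(\<lambda>k. (1 + 2 * lam k - (lam k)^2 + (lam k)^4 + (1 - 3 * (lam k)^2 + (lam k)^4) * ?q k) / 2)
     \<longlonglongrightarrow> (1 + 2 * 0 - 0^2 + 0^4 + (1 - 3 * 0^2 + 0^4) * (1 / (2 * real m - 1))) / 2"
    by (intro tendsto_intros lam_0 q) auto
  moreover have "\<forall>\<^sub>F k in sequentially. (1 + 2 * lam k - (lam k)^2 + (lam k)^4 + (1 - 3 * (lam k)^2 + (lam k)^4) * ?q k) / 2 = fst (P1 (lam k) m)"
    using theta_lam by eventually_elim (use assms in \<open>simp add: P1_def\<close>)
  ultimately have 1: "(\<lambda>k. fst (P1 (lam k) m)) \<longlonglongrightarrow> (1 + 2 * 0 - 0^2 + 0^4 + (1 - 3 * 0^2 + 0^4) * (1 / (2 * real m - 1))) / 2"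
    by (rule Lim_transform_eventually)
  have "(\<lambda>k. (lam k)^2 / 2 + 1 / 2 * ((lam k)^2 - 2) * ?q k) \<longlonglongrightarrow> 0^2 / 2 + 1 / 2 * (0^2 - 2) * (1 / (2 * real m - 1))"
    by (intro tendsto_intros lam_0 q) auto
  moreover have "\<forall>\<^sub>F k in sequentially. (lam k)^2 / 2 + 1 / 2 * ((lam k)^2 - 2) * ?q k = (snd (P1 (lam k) m) - 1) / lam k"
    using theta_lam lam_pos
  proof eventually_elim
    case (elim k)
    define q where "q = ?q k"
    have "snd (P1 (lam k) m) = 1 + (lam k)^3 / 2 + lam k / 2 * ((lam k)^2 - 2) * q"
      using assms elim(1) by (simp add: P1_def q_def)
    then have "snd (P1 (lam k) m) - 1 = lam k * ((lam k)^2 / 2 + 1 / 2 * ((lam k)^2 - 2) * q)"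
      by (simp add: field_simps power2_eq_square power3_eq_cube)
    then have "snd (P1 (lam k) m) - 1 = lam k * ((lam k)^2 / 2 + 1 / 2 * ((lam k)^2 - 2) * ?q k)"
      by (simp only: q_def)
    then show ?case using elim(2) by simp
  qed
  ultimately have 2: "(\<lambda>k. (snd (P1 (lam k) m) - 1) / lam k) \<longlonglongrightarrow> 0^2 / 2 + 1 / 2 * (0^2 - 2) * (1 / (2 * real m - 1))"
    by (rule Lim_transform_eventually)
  show ?thesis using 1 2 by (simp add: rescaled_def)
qed

lemma rescaled_of_lam:
  assumes "((\<lambda>x. fst (f x)) \<longlongrightarrow> a) (at_right 0)" "((\<lambda>x. (snd (f x) - 1) / x) \<longlongrightarrow> b) (at_right 0)"
  shows "rescaled (\<lambda>k. f (lam k)) a b"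
  using filterlim_compose[OF assms(1) lam_right] filterlim_compose[OF assms(2) lam_right]
  by (simp add: rescaled_def)

lemma rescaled_P1_1: "rescaled (\<lambda>k. P1 (lam k) 1) 1 (-1)"
  by (rule rescaled_of_lam) (simp_all add: P1_def, real_asymp)

lemma rescaled_P1_0: "rescaled (\<lambda>k. P1 (lam k) 0) 1 (-1/2)"
  by (rule rescaled_of_lam) (simp_all add: P1_def, real_asymp)

lemma rescaled_Pa: "rescaled (\<lambda>k. Pa (lam k)) 1 (-1)"
  by (rule rescaled_of_lam) (simp_all add: Pa_def, real_asymp+)

lemma rescaled_Pb: "rescaled (\<lambda>k. Pb (lam k)) 1 (-1)"
  by (rule rescaled_of_lam) (simp_all add: Pb_def D_def, real_asymp)

lemma rescaled_Pc: "rescaled (\<lambda>k. Pc (lam k)) 1 (-1)"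
  by (rule rescaled_of_lam) (simp_all add: Pc_def D_def, real_asymp+)

lemma rescaled_corner: "rescaled (\<lambda>k. (1, 1)) 1 0"
  by (simp add: rescaled_def)

lemma eventually_lam: "eventually Pr (at_right 0) \<Longrightarrow> \<forall>\<^sub>F k in sequentially. Pr (lam k)"
  using lam_right by (auto simp: filterlim_iff)

lemma rescaled_fst_less:
  assumes "rescaled A xa ya" "rescaled B xb yb" "xa < xb"
  shows "\<forall>\<^sub>F k in sequentially. fst (A k) < fst (B k)"
proof -
  have "(\<lambda>k. fst (B k) - fst (A k)) \<longlonglongrightarrow> xb - xa"
    using assms by (intro tendsto_diff) (auto simp: rescaled_def)
  then have "\<forall>\<^sub>F k in sequentially. 0 < fst (B k) - fst (A k)"
    using assms(3) by (intro order_tendstoD(1)) auto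
  then show ?thesis by eventually_elim simp
qed

lemma rescaled_snd_less:
  assumes "rescaled A xa ya" "rescaled B xb yb" "ya < yb"
  shows "\<forall>\<^sub>F k in sequentially. snd (A k) < snd (B k)"
proof -
  have "(\<lambda>k. (snd (B k) - 1) / lam k - (snd (A k) - 1) / lam k) \<longlonglongrightarrow> yb - ya"
    using assms by (intro tendsto_diff) (auto simp: rescaled_def)
  then have "\<forall>\<^sub>F k in sequentially. 0 < (snd (B k) - 1) / lam k - (snd (A k) - 1) / lam k"
    using assms(3) by (intro order_tendstoD(1)) auto
  then show ?thesis using lam_pos by eventually_elim (simp add: field_simps)
qed

text \<open>For \<open>3 \<le> m\<close> the rescaled region converges to a nondegenerate quadrilateral, whose turns decide.
  The limits of the regions for \<open>m = 1\<close> and \<open>m = 2\<close> have collinear or coinciding vertices, all with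
  abscissa 1; there the sign of the turn is read off from the exact coordinates.\<close>
lemma diagonal_in_Lambda_out:
  assumes "1 \<le> m"
  shows "\<forall>\<^sub>F k in sequentially. closed_segment (P0 (lam k) m) (P1 (lam k) (m - 1)) \<subseteq> Lambda_out (lam k) m"
proof -
  consider "m = 1" | "m = 2" | "3 \<le> m" using assms by linarith
  then show ?thesis
  proof cases
    case 1
    note P = rescaled_P0[of 1] 
    have b: "\<forall>\<^sub>F k in sequentially. fst (Pa (lam k)) < 1"
      by (rule eventually_lam, simp add: Pa_def, real_asymp)
    have c: "\<forall>\<^sub>F k in sequentially. snd (P1 (lam k) 0) < 1"
      using rescaled_snd_less[OF rescaled_P1_0 rescaled_corner] by simp
    have "\<forall>\<^sub>F k in sequentially. cross ((1,1) - P0 (lam k) 1) (P1 (lam k) 0 - (1,1)) < 0"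
      by (rule cross_neg_if_rescaled[OF P rescaled_corner rescaled_P1_0 rescaled_corner]) simp
    moreover have "\<forall>\<^sub>F k in sequentially. cross (Pa (lam k) - P1 (lam k) 0) (P0 (lam k) 1 - Pa (lam k)) < 0"
      by (rule cross_neg_if_rescaled[OF rescaled_P1_0 rescaled_Pa P rescaled_Pa]) simp
    moreover have "\<forall>\<^sub>F k in sequentially. cross (P0 (lam k) 1 - Pa (lam k)) ((1,1) - P0 (lam k) 1) < 0"
      by (rule cross_neg_if_rescaled[OF rescaled_Pa P rescaled_corner P]) simp
    ultimately show ?thesis using b c
    proof eventually_elim
      case (elim k)
      have "0 < (1 - snd (P1 (lam k) 0)) * (1 - fst (Pa (lam k)))" using elim(4,5) by (intro mult_pos_pos) simp_all
      moreover have "fst (P1 (lam k) 0) = 1" by (simp add: P1_def)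
      then have "cross (P1 (lam k) 0 - (1,1)) (Pa (lam k) - P1 (lam k) 0)
          = - ((1 - snd (P1 (lam k) 0)) * (1 - fst (Pa (lam k))))"
        by (simp add: cross_def algebra_simps)
      ultimately have "cross (P1 (lam k) 0 - (1,1)) (Pa (lam k) - P1 (lam k) 0) < 0" by simp
      then show ?case using elim(1-3) 1 by (auto simp: Lambda_out_def intro!: diagonal_in_polygon4)
    qed
  next
    case 2
    note a = rescaled_P0[of 2] and b = rescaled_P0[of 1] and f = rescaled_P1[of 2, simplified]
    note c = rescaled_Pb and d = rescaled_P1_1 and e = rescaled_Pc
    have "\<forall>\<^sub>F k in sequentially. snd (P1 (lam k) 1) < snd (Pb (lam k))"
      by (rule eventually_lam, simp add: P1_def Pb_def D_def, real_asymp)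
    moreover have "\<forall>\<^sub>F k in sequentially. snd (Pc (lam k)) < snd (P1 (lam k) 1)"
      by (rule eventually_lam, simp add: P1_def Pc_def D_def, real_asymp)
    moreover have "\<forall>\<^sub>F k in sequentially. fst (Pc (lam k)) < 1"
      by (rule eventually_lam, simp add: Pc_def D_def, real_asymp)
    moreover have "\<forall>\<^sub>F k in sequentially. fst (P0 (lam k) 1) < fst (Pb (lam k))"
      by (rule rescaled_fst_less[OF b c]) simp
    moreover have "\<forall>\<^sub>F k in sequentially. fst (P0 (lam k) 2) < fst (Pb (lam k))"
      by (rule rescaled_fst_less[OF a c]) simp
    moreover have "\<forall>\<^sub>F k in sequentially. fst (P1 (lam k) 2) < fst (Pc (lam k))"
      by (rule rescaled_fst_less[OF f e]) simp
    moreover have "\<forall>\<^sub>F k in sequentially. snd (Pc (lam k)) < snd (P1 (lam k) 2)"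
      by (rule rescaled_snd_less[OF e f]) simp
    moreover have "\<forall>\<^sub>F k in sequentially. snd (P1 (lam k) 1) < snd (P0 (lam k) 2)"
      by (rule rescaled_snd_less[OF d a]) simp
    moreover have "\<forall>\<^sub>F k in sequentially. cross (P0 (lam k) 1 - P0 (lam k) 2) (Pb (lam k) - P0 (lam k) 1) < 0"
      by (rule cross_neg_if_rescaled[OF a b c b]) simp
    moreover have "\<forall>\<^sub>F k in sequentially. cross (P1 (lam k) 2 - Pc (lam k)) (P0 (lam k) 2 - P1 (lam k) 2) < 0"
      by (rule cross_neg_if_rescaled[OF e f a f]) simp
    moreover have "\<forall>\<^sub>F k in sequentially. cross (P0 (lam k) 2 - P1 (lam k) 2) (P0 (lam k) 1 - P0 (lam k) 2) < 0"
      by (rule cross_neg_if_rescaled[OF f a b a]) simp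
    moreover have "\<forall>\<^sub>F k in sequentially. cross (P0 (lam k) 1 - P0 (lam k) 2) (P1 (lam k) 1 - P0 (lam k) 2) < 0"
      by (rule cross_neg_if_rescaled[OF a b d a]) simp
    moreover have "\<forall>\<^sub>F k in sequentially. cross (P0 (lam k) 2 - P1 (lam k) 2) (P1 (lam k) 1 - P1 (lam k) 2) < 0"
      by (rule cross_neg_if_rescaled[OF f a d f]) simp
    ultimately show ?thesis
    proof eventually_elim
      case (elim k)
      define a b c d e f where v: "a = P0 (lam k) 2" "b = P0 (lam k) 1" "c = Pb (lam k)"
        "d = P1 (lam k) 1" "e = Pc (lam k)" "f = P1 (lam k) 2"
      have x: "fst c = 1" "fst d = 1" "snd b = 1" "snd a = 1" by (simp_all add: v Pb_def P1_def P0_def)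
      note el = elim[folded v]
      have p: "0 < (1 - fst b) * (snd c - snd d)" "0 < (snd c - snd d) * (1 - fst e)"
          "0 < (1 - fst e) * (snd f - snd e)" "0 < (snd d - snd e) * (fst e - fst f)"
          "0 < (snd c - snd d) * (1 - fst a)" "0 < (1 - fst e) * (snd a - snd d)" "0 < (snd d - snd e) * (1 - fst a)"
        using el(1-8) x by (simp_all add: zero_less_mult_iff)
      have "cross (c - b) (d - c) = - ((1 - fst b) * (snd c - snd d))"
        "cross (d - c) (e - d) = - ((snd c - snd d) * (1 - fst e))"
        "cross (e - d) (f - e) = - ((1 - fst e) * (snd f - snd e)) - (snd d - snd e) * (fst e - fst f)"
        "cross (d - c) (a - c) = - ((snd c - snd d) * (1 - fst a))"
        "cross (e - d) (a - d) = - ((1 - fst e) * (snd a - snd d)) - (snd d - snd e) * (1 - fst a)"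
        using x by (simp_all add: cross_def algebra_simps)
      then have "cross (c - b) (d - c) < 0" "cross (d - c) (e - d) < 0" "cross (e - d) (f - e) < 0"
        "cross (d - c) (a - c) \<le> 0" "cross (e - d) (a - d) \<le> 0" using p by linarith+
      with el(9-13) have "closed_segment a d \<subseteq> polygon [a, b, c, d, e, f]"
        by (intro subsetI diagonal_in_polygon6) (auto intro: less_imp_le)
      then show ?case using 2 by (simp add: Lambda_out_def v)
    qed
  next
    case 3
    define x y z where "x = 1 / (2 * real m + 1)" and "y = 1 / (2 * real m - 1)" and "z = 1 / (2 * real m - 3)"
    have m1: "2 * real (m - 1) + 1 = 2 * real m - 1" "2 * real (m - 1) - 1 = 2 * real m - 3"
      using 3 by (simp_all add: of_nat_diff)
    have pos: "0 < x" "x < y" "y < z" using 3 by (auto simp: x_def y_def z_def divide_simps)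
    have a: "rescaled (\<lambda>k. P0 (lam k) m) ((1 + x) / 2) 0"
      and b: "rescaled (\<lambda>k. P0 (lam k) (m - 1)) ((1 + y) / 2) 0"
      and c: "rescaled (\<lambda>k. P1 (lam k) (m - 1)) ((1 + z) / 2) (- z)"
      and d: "rescaled (\<lambda>k. P1 (lam k) m) ((1 + y) / 2) (- y)"
      using rescaled_P0[of m] rescaled_P0[of "m - 1"] rescaled_P1[of m] rescaled_P1[of "m - 1"] 3
      unfolding m1 x_def y_def z_def by auto
    have q: "0 < (y - x) * z" "0 < y * (z - y)" "0 < x * (z - y)" "0 < y * (y - x)" using pos by simp_all
    have "\<forall>\<^sub>F k in sequentially. cross (P0 (lam k) (m - 1) - P0 (lam k) m) (P1 (lam k) (m - 1) - P0 (lam k) (m - 1)) < 0"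
      by (rule cross_neg_if_rescaled[OF a b c b]) (use q in \<open>simp add: field_simps\<close>)
    moreover have "\<forall>\<^sub>F k in sequentially. cross (P1 (lam k) (m - 1) - P0 (lam k) (m - 1)) (P1 (lam k) m - P1 (lam k) (m - 1)) < 0"
      by (rule cross_neg_if_rescaled[OF b c d c]) (use q in \<open>simp add: field_simps\<close>)
    moreover have "\<forall>\<^sub>F k in sequentially. cross (P1 (lam k) m - P1 (lam k) (m - 1)) (P0 (lam k) m - P1 (lam k) m) < 0"
      by (rule cross_neg_if_rescaled[OF c d a d]) (use q in \<open>simp add: field_simps\<close>)
    moreover have "\<forall>\<^sub>F k in sequentially. cross (P0 (lam k) m - P1 (lam k) m) (P0 (lam k) (m - 1) - P0 (lam k) m) < 0"
      by (rule cross_neg_if_rescaled[OF d a b a]) (use q in \<open>simp add: field_simps\<close>)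
    ultimately show ?thesis
      by eventually_elim (use 3 in \<open>auto simp: Lambda_out_def intro!: diagonal_in_polygon4\<close>)
  qed
qed

end

section \<open>Existence and size of the islands\<close>

context fine_scale
begin

lemma ev_ne:
  "\<forall>\<^sub>F k in sequentially. sin (P k + a * th k) \<noteq> 0" "\<forall>\<^sub>F k in sequentially. cos (P k + a * th k) \<noteq> 0"
  using tendsto_imp_eventually_ne[OF sinP, of 0 a] tendsto_imp_eventually_ne[OF cosP, of 0 a] sin_cos_p_pos by auto

lemma ev_cos_th: "\<forall>\<^sub>F k in sequentially. cos (a * th k) \<noteq> 0"
  using tendsto_imp_eventually_ne[OF cos_th, of 0 a] by simp

lemma ev_sin_th: "0 < a \<Longrightarrow> \<forall>\<^sub>F k in sequentially. sin (a * th k) \<noteq> 0"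
proof -
  assume a: "0 < a"
  have "\<forall>\<^sub>F k in sequentially. a * th k < pi" by (rule small_th) simp
  then show ?thesis
  proof eventually_elim
    case (elim k)
    then have "0 < sin (a * th k)" using a th_pos[of k] by (intro sin_gt_zero) auto
    then show ?case by simp
  qed
qed

text \<open>The vertices of \<open>Lambda_in\<close> in the form of \<open>Q0_eq\<close> and \<open>Q1_eq\<close>: the parameters are the offsets of the
  angles from \<open>P\<close>, in multiples of \<open>th\<close>.\<close>
definition in_pt :: "real \<Rightarrow> real \<Rightarrow> real \<Rightarrow> real \<Rightarrow> nat \<Rightarrow> point" where
  "in_pt a b c d k =
     (centre_coord (th k) + (1 - centre_coord (th k)) * (cos (P k + a * th k) / sin (P k + b * th k)),
      centre_coord (th k) + (1 - centre_coord (th k)) * (sin (P k + c * th k) / sin (P k + d * th k)))"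

lemma ev_Q_in_pt:
  "\<forall>\<^sub>F k in sequentially. Q0 (lam k) (n k) = in_pt (-1/2) (1/2) (1/2) (1/2) k"
  "\<forall>\<^sub>F k in sequentially. Q1 (lam k) (n k) = in_pt (-5/2) (5/2) (-3/2) (5/2) k"
  "\<forall>\<^sub>F k in sequentially. Q0 (lam k) (n k - 1) = in_pt (-5/2) (-3/2) (-3/2) (-3/2) k"
  "\<forall>\<^sub>F k in sequentially. Q1 (lam k) (n k - 1) = in_pt (-9/2) (1/2) (-7/2) (1/2) k"
proof -
  show "\<forall>\<^sub>F k in sequentially. Q0 (lam k) (n k) = in_pt (-1/2) (1/2) (1/2) (1/2) k"
    using ev_ne[of "1/2"] ev_cos_th[of 1]
    by eventually_elim (use Q0_eq in \<open>simp add: P_def lam_def in_pt_def\<close>)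
  show "\<forall>\<^sub>F k in sequentially. Q1 (lam k) (n k) = in_pt (-5/2) (5/2) (-3/2) (5/2) k"
    using ev_ne[of "5/2"] ev_cos_th[of 1]
    by eventually_elim (use Q1_eq in \<open>simp add: P_def lam_def in_pt_def\<close>)
  have shift: "pi/4 + 2 * real (n k - 1) * th k + a = P k + (a - 2 * th k)"
    "pi/4 + 2 * real (n k - 1) * th k - a = P k + (- a - 2 * th k)" if "1 \<le> n k" for a k
    using that by (simp_all add: P_def of_nat_diff algebra_simps)
  have e: "th k / 2 - 2 * th k = (-3/2) * th k" "- (th k / 2) - 2 * th k = (-5/2) * th k"
    "5/2 * th k - 2 * th k = 1/2 * th k" "- (5/2 * th k) - 2 * th k = (-9/2) * th k"
    "- (3/2 * th k) - 2 * th k = (-7/2) * th k" for k by simp_all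
  show "\<forall>\<^sub>F k in sequentially. Q0 (lam k) (n k - 1) = in_pt (-5/2) (-3/2) (-3/2) (-3/2) k"
    using ev_ne[of "-3/2"] ev_cos_th[of 1] n_large
  proof eventually_elim
    case (elim k)
    then show ?case using Q0_eq[of "th k" "n k - 1"] unfolding shift[OF elim(4)] e by (simp add: lam_def in_pt_def)
  qed
  show "\<forall>\<^sub>F k in sequentially. Q1 (lam k) (n k - 1) = in_pt (-9/2) (1/2) (-7/2) (1/2) k"
    using ev_ne[of "1/2"] ev_cos_th[of 1] n_large
  proof eventually_elim
    case (elim k)
    then show ?case using Q1_eq[of "th k" "n k - 1"] unfolding shift[OF elim(4)] e by (simp add: lam_def in_pt_def)
  qed
qed

lemma in_pt_turn:
  assumes neg: "((a1 - a2) - (b2 - b1) * tau^2) * ((c3 - c2 - d3 + d2) * tau)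
      - ((c2 - c1 - d2 + d1) * tau) * ((a2 - a3) - (b3 - b2) * tau^2) < 0"
  shows "\<forall>\<^sub>F k in sequentially.
    cross (in_pt a2 b2 c2 d2 k - in_pt a1 b1 c1 d1 k) (in_pt a3 b3 c3 d3 k - in_pt a2 b2 c2 d2 k) < 0"
proof -
  define x y where "x a b k = cos (P k + a * th k) / sin (P k + b * th k)"
    and "y a b k = sin (P k + a * th k) / sin (P k + b * th k)" for a b k
  define e where "e k = (x a2 b2 k - x a1 b1 k) / th k * ((y c3 d3 k - y c2 d2 k) / th k)
      - (y c2 d2 k - y c1 d1 k) / th k * ((x a3 b3 k - x a2 b2 k) / th k)" for k
  have "e \<longlonglongrightarrow> ((a1 - a2) - (b2 - b1) * tau^2) * ((c3 - c2 - d3 + d2) * tau)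
      - ((c2 - c1 - d2 + d1) * tau) * ((a2 - a3) - (b3 - b2) * tau^2)"
    unfolding e_def[abs_def] x_def y_def by (intro tendsto_intros d_cos_sin d_sin_sin)
  from order_tendstoD(2)[OF this neg] order_tendstoD(2)[OF centre_coord_lim, of 1, simplified]
  show ?thesis
  proof eventually_elim
    case (elim k)
    let ?g = "1 - centre_coord (th k)"
    have "?g^2 * (th k)^2 * e k < 0"
      using elim th_pos[of k] by (intro mult_pos_neg) auto
    moreover have "(th k)^2 * e k = (x a2 b2 k - x a1 b1 k) * (y c3 d3 k - y c2 d2 k)
        - (y c2 d2 k - y c1 d1 k) * (x a3 b3 k - x a2 b2 k)"
      by (simp add: e_def field_simps power2_eq_square)
    moreover have "cross (in_pt a2 b2 c2 d2 k - in_pt a1 b1 c1 d1 k) (in_pt a3 b3 c3 d3 k - in_pt a2 b2 c2 d2 k)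
      = ?g^2 * ((x a2 b2 k - x a1 b1 k) * (y c3 d3 k - y c2 d2 k) - (y c2 d2 k - y c1 d1 k) * (x a3 b3 k - x a2 b2 k))"
      unfolding cross_def in_pt_def x_def[symmetric] y_def[symmetric]
      by (simp add: power2_eq_square algebra_simps)
    ultimately show ?case by (simp add: mult.assoc)
  qed
qed

text \<open>Divided by \<open>th\<close>, the region converges to a parallelogram with two horizontal sides.\<close>
lemma diagonal_in_Lambda_in:
  "\<forall>\<^sub>F k in sequentially. closed_segment (Q0 (lam k) (n k - 1)) (Q1 (lam k) (n k)) \<subseteq> Lambda_in (lam k) (n k)"
proof -
  have "0 < tau * tau^2" using tau_01 by simp
  then have pos: "0 < tau" "- tau < tau * tau^2" using tau_01 by linarith+
  let ?A = "in_pt (-1/2) (1/2) (1/2) (1/2)" and ?B = "in_pt (-5/2) (-3/2) (-3/2) (-3/2)"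
    and ?C = "in_pt (-9/2) (1/2) (-7/2) (1/2)" and ?D = "in_pt (-5/2) (5/2) (-3/2) (5/2)"
  have "\<forall>\<^sub>F k in sequentially. cross (?B k - ?A k) (?C k - ?B k) < 0"
    "\<forall>\<^sub>F k in sequentially. cross (?C k - ?B k) (?D k - ?C k) < 0"
    "\<forall>\<^sub>F k in sequentially. cross (?D k - ?C k) (?A k - ?D k) < 0"
    "\<forall>\<^sub>F k in sequentially. cross (?A k - ?D k) (?B k - ?A k) < 0"
    by (rule in_pt_turn, use pos in \<open>simp add: algebra_simps\<close>)+
  then show ?thesis using ev_Q_in_pt
    by eventually_elim (auto simp: Lambda_in_def intro!: diagonal_in_polygon4)
qed

lemma in_pt_fst: "(\<lambda>k. fst (in_pt a b c d k)) \<longlonglongrightarrow> (1 + tau) / 2"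
proof -
  have "(\<lambda>k. fst (in_pt a b c d k)) \<longlonglongrightarrow> 1/2 + (1 - 1/2) * (cos p / sin p)"
    unfolding in_pt_def fst_conv by (intro tendsto_intros centre_coord_lim cosP sinP) (use sin_cos_p_pos in simp)
  then show ?thesis unfolding tau_eq[symmetric] by (simp add: add_divide_distrib)
qed

lemma Q0_pred_fst: "(\<lambda>k. fst (Q0 (lam k) (n k - 1))) \<longlonglongrightarrow> (1 + tau) / 2"
  by (rule Lim_transform_eventually[OF in_pt_fst eventually_mono[OF ev_Q_in_pt(3)]])
    (erule arg_cong[where f = fst, OF sym])

lemma Q1_fst: "(\<lambda>k. fst (Q1 (lam k) (n k))) \<longlonglongrightarrow> (1 + tau) / 2"
  by (rule Lim_transform_eventually[OF in_pt_fst eventually_mono[OF ev_Q_in_pt(2)]])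
    (erule arg_cong[where f = fst, OF sym])

lemma Q0_pred_snd: "\<forall>\<^sub>F k in sequentially. snd (Q0 (lam k) (n k - 1)) = 1"
  using ev_Q_in_pt(3) ev_ne(1)[of "-3/2"] by eventually_elim (simp add: in_pt_def)

lemma Q1_snd: "(\<lambda>k. (1 - snd (Q1 (lam k) (n k))) / lam k) \<longlonglongrightarrow> tau"
proof -
  have "(\<lambda>k. (1 - centre_coord (th k)) * ((sin (P k + 1/2 * th k) / sin (P k + 1/2 * th k) - sin (P k + (-3/2) * th k) / sin (P k + 5/2 * th k)) / th k))
     \<longlonglongrightarrow> (1 - 1/2) * ((1/2 - (-3/2) - 1/2 + 5/2) * tau)"
    by (intro tendsto_intros centre_coord_lim d_sin_sin)
  moreover have "\<forall>\<^sub>F k in sequentially. (1 - centre_coord (th k)) * ((sin (P k + 1/2 * th k) / sin (P k + 1/2 * th k) - sin (P k + (-3/2) * th k) / sin (P k + 5/2 * th k)) / th k)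
    = (1 - snd (Q1 (lam k) (n k))) / th k"
    using ev_Q_in_pt(2) ev_ne(1)[of "1/2"]
  proof eventually_elim
    case (elim k)
    show ?case using elim(2) unfolding elim(1) in_pt_def by (simp add: algebra_simps diff_divide_distrib add_divide_distrib)
  qed
  ultimately have "(\<lambda>k. (1 - snd (Q1 (lam k) (n k))) / th k) \<longlonglongrightarrow> (1 - 1/2) * ((1/2 - (-3/2) - 1/2 + 5/2) * tau)"
    by (rule Lim_transform_eventually)
  from per_th_imp_per_lam[OF this] show ?thesis by simp
qed

lemma P0_on: "\<forall>\<^sub>F k in sequentially. out_line (th k) m (P0 (lam k) m)"
proof -
  have "\<forall>\<^sub>F k in sequentially. 1 * th k < pi/2" by (rule small_th) simp
  then show ?thesis using ev_cos_th[of "2 * real m + 1"] ev_sin_th[of "2 * real m + 1", simplified]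
    by eventually_elim (use th_pos in \<open>simp add: lam_def P0_on_out_line\<close>)
qed

lemma P1_on:
  assumes "1 \<le> m"
  shows "\<forall>\<^sub>F k in sequentially. out_line (th k) m (P1 (lam k) (m - 1))"
proof -
  have s: "\<forall>\<^sub>F k in sequentially. 1 * th k < pi/2" by (rule small_th) simp
  consider "m = 1" | "m = 2" | "3 \<le> m" using assms by linarith
  then show ?thesis
  proof cases
    case 1
    show ?thesis using s ev_cos_th[of 4]
      by eventually_elim (use th_pos P1_0_on_out_line 1 in \<open>simp add: lam_def\<close>)
  next
    case 2
    show ?thesis using s ev_cos_th[of 6]
      by eventually_elim (use th_pos P1_1_on_out_line 2 in \<open>simp add: lam_def\<close>)
  next
    case 3
    have "\<forall>\<^sub>F k in sequentially. sin ((2 * real m - 3) * th k) \<noteq> 0" by (rule ev_sin_th) (use 3 in auto)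
    with s ev_cos_th[of "2 * real m - 3"] show ?thesis
    proof eventually_elim
      case (elim k)
      show ?case unfolding lam_def by (rule P1_on_out_line) (use elim th_pos 3 in auto)
    qed
  qed
qed

lemma Q_on: "\<forall>\<^sub>F k in sequentially. in_line (th k) (n k) (Q0 (lam k) (n k - 1)) \<and> in_line (th k) (n k) (Q1 (lam k) (n k))"
  using n_large ev_cos_th[of 1] ev_ne[of "5/2"] ev_ne[of "-3/2"]
  by eventually_elim (use Q_on_in_line in \<open>simp add: lam_def P_def\<close>)

lemma amplitude_angle_ne: "\<forall>\<^sub>F k in sequentially. sin (pi/4 + (2 * real (n k) + 2 * real m - 1/2) * th k) \<noteq> 0"
  unfolding amplitude_angle by (rule ev_ne)

abbreviation orbit_pt where "orbit_pt m k \<equiv> (in_seq (th k) m (n k) 4, in_seq (th k) m (n k) 3)"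

text \<open>\<open>Z\<close> is an arbitrary choice of a regular fixed point, so it must be known that there is only one.\<close>
lemma ev_unique:
  assumes "1 \<le> m"
  shows "\<forall>\<^sub>F k in sequentially. \<forall>z. regular_fixed_point (lam k) m (n k) z \<longrightarrow> z = orbit_pt m k"
  using P0_on[of m] P1_on[OF assms] Q_on amplitude_angle_ne[of m] ev_cos_th[of 1]
proof eventually_elim
  case (elim k)
  show ?case
  proof (intro allI impI)
    fix z assume "regular_fixed_point (lam k) m (n k) z"
    then show "z = orbit_pt m k" using elim
      by (intro lines_meet_once) (auto simp: regular_fixed_point_def intro: out_line_segment in_line_segment)
  qed
qed

text \<open>The limit of the island radius divided by \<open>lam\<close>; where it is negative, small parameters have no island.\<close>
definition rho where "rho m = min ((2 * real m + 1) * tau - 1) (1 - (2 * real m - 3) * tau) / 4"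

lemma radius_min_lim:
  "(\<lambda>k. min (1 - in_seq (th k) m (n k) 3) (out_even (th k) m (n k) 1) / lam k) \<longlonglongrightarrow> rho m"
proof -
  have "(\<lambda>k. min ((1 - in_seq (th k) m (n k) 3) / lam k) (out_even (th k) m (n k) 1 / lam k)) \<longlonglongrightarrow>
     min (((2 * real m + 1) * tau - 1) / 4) ((1 - (2 * real m - 3) * tau) / 4)"
    by (intro tendsto_min in_seq3_lim out_even1_lim)
  moreover have "\<forall>\<^sub>F k in sequentially. min ((1 - in_seq (th k) m (n k) 3) / lam k) (out_even (th k) m (n k) 1 / lam k)
     = min (1 - in_seq (th k) m (n k) 3) (out_even (th k) m (n k) 1) / lam k"
    using lam_pos by eventually_elim (simp add: min_def divide_le_cancel)
  ultimately show ?thesis unfolding rho_def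
    using Lim_transform_eventually by (fastforce simp: min_def)
qed

lemma ev_radius:
  assumes m: "1 \<le> m" and pos: "0 < rho m"
  shows "\<forall>\<^sub>F k in sequentially. orbit_pt m k \<in> Omega \<and>
    island_radius (lam k) (orbit_pt m k) = min (1 - in_seq (th k) m (n k) 3) (out_even (th k) m (n k) 1)"
proof -
  define r where "r k = min (1 - in_seq (th k) m (n k) 3) (out_even (th k) m (n k) 1)" for k
  have rl: "(\<lambda>k. r k / lam k) \<longlonglongrightarrow> rho m" using radius_min_lim unfolding r_def .
  have "(\<lambda>k. r k / lam k * lam k) \<longlonglongrightarrow> rho m * 0" by (intro tendsto_mult rl lam_0)
  moreover have "\<forall>\<^sub>F k in sequentially. r k / lam k * lam k = r k" using lam_pos by eventually_elim simp
  ultimately have r0: "r \<longlonglongrightarrow> 0" using Lim_transform_eventually by fastforce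
  have rpos: "\<forall>\<^sub>F k in sequentially. 0 < r k"
    using order_tendstoD(1)[OF rl pos] lam_pos by eventually_elim (simp add: zero_less_divide_iff)
  have oo: "(\<lambda>k. 1 / (2 * (cos (th k))^2)) \<longlonglongrightarrow> 1/2"
    using tendsto_divide[OF tendsto_const tendsto_mult[OF tendsto_const tendsto_power[OF cos_th1, of 2]], of 2 1] by simp
  have 1: "\<forall>\<^sub>F k in sequentially. 0 < centre_coord (th k) - r k"
    using order_tendstoD(1)[OF tendsto_diff[OF centre_coord_lim r0], of 0] by simp
  have 2: "\<forall>\<^sub>F k in sequentially. centre_coord (th k) + r k < 1"
    using order_tendstoD(2)[OF tendsto_add[OF centre_coord_lim r0], of 1] by simp
  have 3: "\<forall>\<^sub>F k in sequentially. 0 < 1 / (2 * (cos (th k))^2) - out_amplitude (th k) m (n k) - r k"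
    using order_tendstoD(1)[OF tendsto_diff[OF tendsto_diff[OF oo out_amplitude_lim] r0], of 0] tau_01 by simp
  have 4: "\<forall>\<^sub>F k in sequentially. 1 / (2 * (cos (th k))^2) + out_amplitude (th k) m (n k) + r k < 1"
    using order_tendstoD(2)[OF tendsto_add[OF tendsto_add[OF oo out_amplitude_lim] r0], of 1] tau_01 by simp
  have 5: "\<forall>\<^sub>F k in sequentially. 0 < amplitude (th k) m (n k)"
    using order_tendstoD(1)[OF amplitude_lim, of 0] sin_cos_p_pos by simp
  have 6: "\<forall>\<^sub>F k in sequentially. 0 < out_amplitude (th k) m (n k)"
    using order_tendstoD(1)[OF out_amplitude_lim, of 0] tau_01 by simp
  have 7: "\<forall>\<^sub>F k in sequentially. 2 * real m * th k < pi/2" by (rule small_th) simp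
  from rpos 1 2 3 4 5 6 7 n_large n_small[of "3/2"] amplitude_angle_ne[of m] show ?thesis
  proof eventually_elim
    case (elim k)
    have r: "0 < r k" "r k \<le> centre_coord (th k)" "centre_coord (th k) \<le> 1 - r k" "r k \<le> 1 / (2 * (cos (th k))^2) - out_amplitude (th k) m (n k)"
      "1 / (2 * (cos (th k))^2) + out_amplitude (th k) m (n k) \<le> 1 - r k"
      using elim(1-5) by linarith+
    note R = regular_orbit_radius[OF m elim(9) th_pos elim(10,8) less_imp_le[OF elim(6)] elim(11) less_imp_le[OF elim(7)] r[unfolded r_def]]
    then show ?case by (simp add: Omega_def lam_def)
  qed
qed

text \<open>On its symmetry line, the exact fixed point belongs to the segment as soon as one coordinate lies
  strictly between those of the end points; the abscissa is used for the outer and the ordinate for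
  the inner segment.\<close>
lemma regular_eventually:
  assumes m: "1 \<le> m" and pos: "0 < rho m"
  shows "\<forall>\<^sub>F k in sequentially. regular_fixed_point (lam k) m (n k) (orbit_pt m k)"
proof -
  have t: "1 < (2 * real m + 1) * tau" "(2 * real m - 3) * tau < 1" using pos by (auto simp: rho_def)
  have o1: "\<forall>\<^sub>F k in sequentially. fst (P0 (lam k) m) < in_seq (th k) m (n k) 4"
  proof -
    have "(\<lambda>k. in_seq (th k) m (n k) 4 - fst (P0 (lam k) m)) \<longlonglongrightarrow> (1 + tau) / 2 - (1 + 1 / (2 * real m + 1)) / 2"
      using rescaled_P0[of m] by (intro tendsto_diff in_seq4_lim) (simp add: rescaled_def)
    moreover have "0 < (1 + tau) / 2 - (1 + 1 / (2 * real m + 1)) / 2" using t by (simp add: field_simps)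
    ultimately have "\<forall>\<^sub>F k in sequentially. 0 < in_seq (th k) m (n k) 4 - fst (P0 (lam k) m)" by (rule order_tendstoD(1))
    then show ?thesis by eventually_elim simp
  qed
  have o2: "\<forall>\<^sub>F k in sequentially. in_seq (th k) m (n k) 4 < fst (P1 (lam k) (m - 1))"
  proof (cases "3 \<le> m")
    case True
    have m1: "2 * real (m - 1) - 1 = 2 * real m - 3" using True by (simp add: of_nat_diff)
    have "(\<lambda>k. fst (P1 (lam k) (m - 1)) - in_seq (th k) m (n k) 4) \<longlonglongrightarrow> (1 + 1 / (2 * real m - 3)) / 2 - (1 + tau) / 2"
      using rescaled_P1[of "m - 1"] True unfolding m1 by (intro tendsto_diff in_seq4_lim) (simp add: rescaled_def)
    moreover have "0 < (1 + 1 / (2 * real m - 3)) / 2 - (1 + tau) / 2" using t True by (simp add: field_simps)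
    ultimately have "\<forall>\<^sub>F k in sequentially. 0 < fst (P1 (lam k) (m - 1)) - in_seq (th k) m (n k) 4" by (rule order_tendstoD(1))
    then show ?thesis by eventually_elim simp
  next
    case False
    then have "fst (P1 (lam k) (m - 1)) = 1" for k using m by (auto simp: P1_def)
    then show ?thesis using order_tendstoD(2)[OF in_seq4_lim, of 1] tau_01 by simp
  qed
  have i1: "\<forall>\<^sub>F k in sequentially. in_seq (th k) m (n k) 3 < 1"
  proof -
    have "\<forall>\<^sub>F k in sequentially. 0 < (1 - in_seq (th k) m (n k) 3) / lam k"
      by (rule order_tendstoD(1)[OF in_seq3_lim]) (use t in simp)
    then show ?thesis using lam_pos by eventually_elim (simp add: zero_less_divide_iff)
  qed
  have i2: "\<forall>\<^sub>F k in sequentially. snd (Q1 (lam k) (n k)) < in_seq (th k) m (n k) 3"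
  proof -
    have "(\<lambda>k. (1 - snd (Q1 (lam k) (n k))) / lam k - (1 - in_seq (th k) m (n k) 3) / lam k) \<longlonglongrightarrow>
      tau - ((2 * real m + 1) * tau - 1) / 4" by (intro tendsto_diff Q1_snd in_seq3_lim)
    moreover have "0 < tau - ((2 * real m + 1) * tau - 1) / 4" using t by (simp add: field_simps)
    ultimately have "\<forall>\<^sub>F k in sequentially. 0 < (1 - snd (Q1 (lam k) (n k))) / lam k - (1 - in_seq (th k) m (n k) 3) / lam k"
      by (rule order_tendstoD(1))
    then show ?thesis using lam_pos by eventually_elim (simp add: diff_divide_distrib[symmetric] zero_less_divide_iff)
  qed
  from o1 o2 i1 i2 P0_on[of m] P1_on[OF m] Q_on amplitude_angle_ne[of m] ev_cos_th[of 1] ev_cos_th[of "2 * real m + 2"]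
    ev_ne(1)[of "-3/2"] ev_radius[OF m pos] diagonal_in_Lambda_out[OF m] diagonal_in_Lambda_in Q0_pred_snd
  show ?thesis
  proof eventually_elim
    case (elim k)
    have out: "orbit_pt m k \<in> closed_segment (P0 (lam k) m) (P1 (lam k) (m - 1))"
      using elim(1,2,5,6,8,9,10) out_line_inn[of "th k" "n k" m] unfolding out_line_alt
      by (intro point_on_segment_fst) (assumption | simp)+
    have inside: "orbit_pt m k \<in> closed_segment (Q0 (lam k) (n k - 1)) (Q1 (lam k) (n k))"
      using elim(3,4,7,11,15) in_line_inn[of "th k" "n k" m] unfolding in_line_alt
      by (intro point_on_segment_snd[where a = "sin (pi/4 + 2 * real (n k) * th k - 3/2 * th k)"
            and b = "- cos (pi/4 + 2 * real (n k) * th k - 5/2 * th k)"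
            and d = "centre_coord (th k) * (sin (pi/4 + 2 * real (n k) * th k - 3/2 * th k) - cos (pi/4 + 2 * real (n k) * th k - 5/2 * th k))"])
        (auto simp: P_def)
    show ?case using out inside elim(12,13,14) by (auto simp: regular_fixed_point_def)
  qed
qed

lemma in_range: "\<forall>\<^sub>F k in sequentially. m \<le> M (lam k) \<and> n k \<le> N (lam k) - 1"
proof -
  have "\<forall>\<^sub>F k in sequentially. (4 * real m + 2) * th k < pi" by (rule small_th) simp
  then show ?thesis using n_small[of "5/2"] n_large theta_lam
  proof eventually_elim
    case (elim k)
    have "real m \<le> pi / (4 * th k) - 1/2" using elim(1) th_pos[of k] by (simp add: field_simps)
    then have "int m \<le> \<lfloor>pi / (4 * th k) - 1/2\<rfloor>" by (simp add: le_floor_iff)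
    moreover have "real (n k) + 1 \<le> pi / (8 * th k) - 1/4" using elim(2) th_pos[of k] by (simp add: field_simps)
    then have "int (n k) + 1 \<le> \<lfloor>pi / (8 * th k) - 1/4\<rfloor>" by (simp add: le_floor_iff)
    ultimately show ?case unfolding M_def N_def elim(4) by (intro conjI) linarith+
  qed
qed

lemma regular_limit:
  assumes m: "1 \<le> m" and pos: "0 < rho m"
  shows "\<forall>\<^sub>F k in sequentially. (m, n k) \<in> regular_pairs (lam k)"
    and "(\<lambda>k. island_radius (lam k) (Z (lam k) m (n k)) / lam k) \<longlonglongrightarrow> rho m"
proof -
  show "\<forall>\<^sub>F k in sequentially. (m, n k) \<in> regular_pairs (lam k)"
    using regular_eventually[OF assms] in_range[of m] n_large
    by eventually_elim (use m in \<open>auto simp: regular_pairs_def\<close>)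
  have "\<forall>\<^sub>F k in sequentially. min (1 - in_seq (th k) m (n k) 3) (out_even (th k) m (n k) 1) / lam k
     = island_radius (lam k) (Z (lam k) m (n k)) / lam k"
    using regular_eventually[OF assms] ev_unique[OF m] ev_radius[OF assms]
  proof eventually_elim
    case (elim k)
    have "Z (lam k) m (n k) = orbit_pt m k" unfolding Z_def using elim(1,2) by (metis someI)
    then show ?case using elim(3) by simp
  qed
  with radius_min_lim show "(\<lambda>k. island_radius (lam k) (Z (lam k) m (n k)) / lam k) \<longlonglongrightarrow> rho m"
    by (rule Lim_transform_eventually)
qed

lemma segment_fst_bounds:
  fixes z :: point
  assumes "z \<in> closed_segment x y"
  shows "min (fst x) (fst y) \<le> fst z" "fst z \<le> max (fst x) (fst y)"
proof -
  obtain t where t: "z = (1 - t) *\<^sub>R x + t *\<^sub>R y" "0 \<le> t" "t \<le> 1" using assms by (auto simp: closed_segment_def)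
  then have "fst z \<in> closed_segment (fst x) (fst y)" by (auto simp: closed_segment_def)
  then show "min (fst x) (fst y) \<le> fst z" "fst z \<le> max (fst x) (fst y)"
    by (auto simp: closed_segment_eq_real_ivl split: if_splits)
qed

text \<open>The inner segment shrinks to the abscissa \<open>(1 + tau) / 2\<close>, which is then outside the range of
  abscissas of the outer one.\<close>
lemma nonregular_limit:
  assumes m: "1 \<le> m" and neg: "rho m < 0"
  shows "\<forall>\<^sub>F k in sequentially. (m, n k) \<notin> regular_pairs (lam k)"
proof -
  let ?a = "(1 + 1 / (2 * real m + 1)) / 2"
  have P0l: "(\<lambda>k. fst (P0 (lam k) m)) \<longlonglongrightarrow> ?a" using rescaled_P0[of m] by (simp add: rescaled_def)
  obtain b where P1l: "(\<lambda>k. fst (P1 (lam k) (m - 1))) \<longlonglongrightarrow> b"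
    and b: "?a < b" "m < 3 \<Longrightarrow> b = 1" "3 \<le> m \<Longrightarrow> b = (1 + 1 / (2 * real m - 3)) / 2"
  proof (cases "3 \<le> m")
    case True
    have m1: "2 * real (m - 1) - 1 = 2 * real m - 3" using True by (simp add: of_nat_diff)
    show ?thesis
    proof (rule that)
      show "(\<lambda>k. fst (P1 (lam k) (m - 1))) \<longlonglongrightarrow> (1 + 1 / (2 * real m - 3)) / 2"
        using rescaled_P1[of "m - 1"] True unfolding m1 by (simp add: rescaled_def)
      have "1 / (2 * real m + 1) < 1 / (2 * real m - 3)"
        by (rule divide_strict_left_mono) (use True in auto)
      then show "?a < (1 + 1 / (2 * real m - 3)) / 2" by simp
    qed (use True in auto)
  next
    case False
    then have "fst (P1 (lam k) (m - 1)) = 1" for k using m by (auto simp: P1_def)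
    then show ?thesis using that[of 1] False m by (auto simp: divide_simps)
  qed
  have inmin: "(\<lambda>k. min (fst (Q0 (lam k) (n k - 1))) (fst (Q1 (lam k) (n k)))) \<longlonglongrightarrow> (1 + tau) / 2"
    and inmax: "(\<lambda>k. max (fst (Q0 (lam k) (n k - 1))) (fst (Q1 (lam k) (n k)))) \<longlonglongrightarrow> (1 + tau) / 2"
    using tendsto_min[OF Q0_pred_fst Q1_fst] tendsto_max[OF Q0_pred_fst Q1_fst] by simp_all
  have outmin: "(\<lambda>k. min (fst (P0 (lam k) m)) (fst (P1 (lam k) (m - 1)))) \<longlonglongrightarrow> ?a"
    and outmax: "(\<lambda>k. max (fst (P0 (lam k) m)) (fst (P1 (lam k) (m - 1)))) \<longlonglongrightarrow> b"
    using tendsto_min[OF P0l P1l] tendsto_max[OF P0l P1l] b(1) by simp_all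
  consider "(2 * real m + 1) * tau < 1" | "1 < (2 * real m - 3) * tau"
    using neg by (auto simp: rho_def min_less_iff_disj)
  then have "\<forall>\<^sub>F k in sequentially.
     0 < min (fst (P0 (lam k) m)) (fst (P1 (lam k) (m - 1))) - max (fst (Q0 (lam k) (n k - 1))) (fst (Q1 (lam k) (n k)))
   \<or> 0 < min (fst (Q0 (lam k) (n k - 1))) (fst (Q1 (lam k) (n k))) - max (fst (P0 (lam k) m)) (fst (P1 (lam k) (m - 1)))"
  proof cases
    case 1
    then have "0 < ?a - (1 + tau) / 2" by (simp add: field_simps)
    from order_tendstoD(1)[OF tendsto_diff[OF outmin inmax] this] show ?thesis by (rule eventually_mono) simp
  next
    case 2
    have "3 \<le> m"
    proof (rule ccontr)
      assume "\<not> 3 \<le> m"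
      then have "2 * real m - 3 \<le> 1" by simp
      then have "(2 * real m - 3) * tau \<le> 1 * tau" using tau_01 by (intro mult_right_mono) auto
      then show False using 2 tau_01 by linarith
    qed
    moreover from this have "1 / (2 * real m - 3) < tau" using 2 by (simp add: divide_less_eq mult.commute)
    ultimately have "0 < (1 + tau) / 2 - b" using b(3) by simp
    from order_tendstoD(1)[OF tendsto_diff[OF inmin outmax] this] show ?thesis by (rule eventually_mono) simp
  qed
  then show ?thesis
  proof eventually_elim
    case (elim k)
    show ?case
    proof
      assume "(m, n k) \<in> regular_pairs (lam k)"
      then obtain z where "z \<in> closed_segment (P0 (lam k) m) (P1 (lam k) (m - 1))"
        "z \<in> closed_segment (Q0 (lam k) (n k - 1)) (Q1 (lam k) (n k))"
        by (auto simp: regular_pairs_def regular_fixed_point_def)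
      from segment_fst_bounds[OF this(1)] segment_fst_bounds[OF this(2)] elim show False by linarith
    qed
  qed
qed

end

section \<open>A radius bound for all pairs\<close>

lemma le_tan:
  fixes x :: real
  assumes "0 \<le> x" "x < pi/2"
  shows "x \<le> tan x"
proof -
  have "tan 0 - 0 \<le> tan x - x"
  proof (rule DERIV_nonneg_imp_nondecreasing[OF assms(1)])
    fix y assume y: "0 \<le> y" "y \<le> x"
    then have c: "0 < cos y" using assms by (intro cos_gt_zero_pi) auto
    have "((\<lambda>x. tan x - x) has_real_derivative (inverse ((cos y)^2) - 1)) (at y)"
      using c by (auto intro!: derivative_eq_intros)
    moreover have "0 \<le> inverse ((cos y)^2) - 1"
      using c by (simp add: field_simps power_le_one)
    ultimately show "\<exists>d. ((\<lambda>x. tan x - x) has_real_derivative d) (at y) \<and> 0 \<le> d" by blast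
  qed
  then show ?thesis by simp
qed

lemma F_in_Omega: "z \<in> Omega \<Longrightarrow> F lam z \<in> Omega"
proof -
  assume "z \<in> Omega"
  moreover have "0 \<le> x - of_int \<lfloor>x\<rfloor>" "x - of_int \<lfloor>x\<rfloor> < 1" for x :: real by linarith+
  ultimately show ?thesis by (auto simp: Omega_def F_def split: prod.splits)
qed

lemma orbit_in_Omega: "z \<in> Omega \<Longrightarrow> orbit lam z \<subseteq> Omega"
proof -
  assume "z \<in> Omega"
  then have "(F lam ^^ k) z \<in> Omega" for k by (induction k) (auto intro: F_in_Omega)
  then show ?thesis by (auto simp: orbit_def)
qed

lemma island_radius_nonneg:
  assumes "z \<in> Omega"
  shows "0 \<le> island_radius lam z"
  unfolding island_radius_def
proof (rule cINF_greatest)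
  show "orbit lam z \<noteq> {}" by (simp add: orbit_def)
  fix w assume "w \<in> orbit lam z"
  then have "w \<in> Omega" using orbit_in_Omega[OF assms] by blast
  then show "0 \<le> (case w of (x, y) \<Rightarrow> min x (1 - x))" by (auto simp: Omega_def)
qed

lemma island_radius_le:
  assumes "z \<in> Omega" "(x, y) \<in> orbit lam z"
  shows "island_radius lam z \<le> min x (1 - x)"
proof -
  have "bdd_below ((\<lambda>(x, y). min x (1 - x)) ` orbit lam z)"
  proof (rule bdd_belowI2[of _ 0])
    fix w assume "w \<in> orbit lam z"
    then have "w \<in> Omega" using orbit_in_Omega[OF assms(1)] by blast
    then show "0 \<le> (case w of (x, y) \<Rightarrow> min x (1 - x))" by (auto simp: Omega_def)
  qed
  from cINF_lower[OF this assms(2)] show ?thesis by (simp add: island_radius_def)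
qed

text \<open>The first coordinate of the third iterate is \<open>lam x\<^sub>2 - x\<^sub>1\<close> modulo 1, and this number equals
  \<open>lam\<^sup>2 x\<^sub>1 - lam (2 x - 1) - (1 - y)\<close>, which is small near the point \<open>(1/2, 1)\<close>.\<close>
lemma third_iterate_bound:
  assumes z: "(x, y) \<in> Omega" and lam: "0 < lam" "lam < 1/10" and x: "1/2 \<le> x" and y: "3/5 \<le> y"
  shows "island_radius lam (x, y) \<le> lam * lam + lam * (2 * x - 1) + (1 - y)"
proof -
  have o: "x < 1" "y < 1" using z by (auto simp: Omega_def)
  have tenth: "0 \<le> lam * u" "lam * u \<le> 1/10" "lam * u \<le> lam" if "0 \<le> u" "u \<le> 1" for u
  proof -
    show "0 \<le> lam * u" using that lam by simp
    show "lam * u \<le> lam" using mult_left_mono[OF that(2), of lam] lam by simp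
    then show "lam * u \<le> 1/10" using lam by linarith
  qed
  have lx: "0 \<le> lam * x" "lam * x \<le> 1/10" using tenth[of x] x o by auto
  define x1 where "x1 = lam * x - y + 1"
  have x1: "0 \<le> x1" "x1 \<le> 1" "x1 < 1" using lx y o by (auto simp: x1_def)
  have l1: "0 \<le> lam * x1" "lam * x1 \<le> 1/10" "lam * x1 \<le> lam" using tenth[of x1] x1 by auto
  define x2 where "x2 = lam * x1 - x + 1"
  have x2: "0 \<le> x2" "x2 < 1" using l1 x o by (auto simp: x2_def)
  have F1: "F lam (x, y) = (x1, x)" by (rule F_step[of _ _ _ _ 1]) (use x1 in \<open>auto simp: x1_def\<close>)
  have F2: "F lam (x1, x) = (x2, x1)" by (rule F_step[of _ _ _ _ 1]) (use x2 in \<open>auto simp: x2_def\<close>)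
  define s where "s = lam * x2 - x1"
  define x3 where "x3 = s - of_int \<lfloor>s\<rfloor>"
  have F3: "F lam (x2, x1) = (x3, x2)" by (simp add: F_def x3_def s_def)
  have "(F lam ^^ 3) (x, y) = (x3, x2)" by (simp add: numeral_3_eq_3 F1 F2 F3)
  then have "(x3, x2) \<in> orbit lam (x, y)" unfolding orbit_def by (metis rangeI)
  then have "island_radius lam (x, y) \<le> min x3 (1 - x3)" by (rule island_radius_le[OF z])
  also have "\<dots> \<le> \<bar>s\<bar>"
  proof (cases "0 \<le> s")
    case True
    then have "0 \<le> \<lfloor>s\<rfloor>" by simp
    then have "x3 \<le> s" by (simp add: x3_def)
    then show ?thesis using True by simp
  next
    case False
    then have "\<lfloor>s\<rfloor> \<le> -1" by linarith
    then have "real_of_int \<lfloor>s\<rfloor> \<le> -1" by linarith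
    then show ?thesis using False by (simp add: x3_def)
  qed
  also have "s = lam * (lam * x1) - lam * (2 * x - 1) - (1 - y)"
    by (simp add: s_def x2_def x1_def algebra_simps)
  also have "\<bar>lam * (lam * x1) - lam * (2 * x - 1) - (1 - y)\<bar> \<le> lam * (lam * x1) + lam * (2 * x - 1) + (1 - y)"
  proof -
    have "0 \<le> lam * (lam * x1)" "0 \<le> lam * (2 * x - 1)" using mult_nonneg_nonneg[OF _ l1(1), of lam] mult_nonneg_nonneg[of lam "2 * x - 1"] lam x by simp_all
    then show ?thesis using o by linarith
  qed
  also have "lam * (lam * x1) \<le> lam * lam" using l1(3) lam by (intro mult_left_mono) auto
  finally show ?thesis by simp
qed

lemma coordinates_on_segment:
  fixes z :: point
  assumes "z \<in> closed_segment A B"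
    and "a \<le> fst A" "a \<le> fst B" "fst A \<le> b" "fst B \<le> b" "c \<le> snd A" "c \<le> snd B"
  shows "a \<le> fst z" "fst z \<le> b" "c \<le> snd z"
proof -
  obtain t where t: "z = (1 - t) *\<^sub>R A + t *\<^sub>R B" "0 \<le> t" "t \<le> 1" using assms(1) by (auto simp: closed_segment_def)
  have conv: "l \<le> (1 - t) * u + t * v" if "l \<le> u" "l \<le> v" for l u v :: real
  proof -
    have "(1 - t) * l + t * l \<le> (1 - t) * u + t * v" using that t by (intro add_mono mult_left_mono) auto
    then show ?thesis by (simp add: algebra_simps)
  qed
  have "- b \<le> (1 - t) * (- fst A) + t * (- fst B)" by (rule conv) (use assms in auto)
  then show "a \<le> fst z" "fst z \<le> b" "c \<le> snd z"
    using conv[of a "fst A" "fst B"] conv[of c "snd A" "snd B"] assms by (auto simp: t(1))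
qed

text \<open>The right end point \<open>k * th = \<pi>/2\<close> is included: there the tangent, and with it the quotient, is 0
  by convention.\<close>
lemma cot_quotient_bounds:
  assumes th: "0 < th" and half: "1/2 \<le> cos th" "0 < cos th" and k: "1 \<le> k" "k * th \<le> pi/2"
  shows "0 \<le> tan th / tan (k * th)" "tan th / tan (k * th) \<le> 2 / k"
proof -
  have "th \<le> k * th" using k th by simp
  then have th2: "th \<le> pi/2" using k by simp
  have "sin th \<ge> 0" using th th2 by (intro sin_ge_zero) auto
  have tan: "0 \<le> tan th" "tan th \<le> 2 * th"
  proof -
    show "0 \<le> tan th" using \<open>sin th \<ge> 0\<close> half by (simp add: tan_def)
    have "tan th \<le> sin th / (1/2)" unfolding tan_def using half \<open>sin th \<ge> 0\<close> by (intro divide_left_mono) auto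
    then show "tan th \<le> 2 * th" using sin_x_le_x[of th] th by simp
  qed
  have "0 \<le> tan th / tan (k * th) \<and> tan th / tan (k * th) \<le> 2 / k"
  proof (cases "k * th = pi/2")
    case True
    have "tan (k * th) = 0" unfolding True by (simp add: tan_def)
    then show ?thesis using k by simp
  next
    case False
    then have lt: "k * th < pi/2" using k by simp
    have pos: "0 < k * th" using k th by simp
    have "k * th \<le> tan (k * th)" by (rule le_tan) (use pos lt in auto)
    then have "tan th / tan (k * th) \<le> (2 * th) / (k * th)" using tan pos by (intro frac_le) auto
    also have "\<dots> = 2 / k" using th by simp
    finally show ?thesis using tan pos \<open>k * th \<le> tan (k * th)\<close> by simp
  qed
  then show "0 \<le> tan th / tan (k * th)" "tan th / tan (k * th) \<le> 2 / k" by auto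
qed

lemma theta_bounds:
  assumes "0 < lam" "lam < 1/10"
  shows "0 < theta lam" "1/2 \<le> cos (theta lam)" "2 * sin (theta lam) = lam" "lam \<le> 2 * theta lam"
proof -
  have b: "-1 \<le> lam/2" "lam/2 \<le> 1" using assms by auto
  show s: "2 * sin (theta lam) = lam" using sin_arcsin[OF b] by (simp add: theta_def)
  show p: "0 < theta lam" using arcsin_less_arcsin[of 0 "lam/2"] assms by (simp add: theta_def)
  show "lam \<le> 2 * theta lam" using sin_x_le_x[of "theta lam"] p s by simp
  have "(lam/2)^2 \<le> (1/20)^2" using assms by (intro power_mono) auto
  then have "(1/2)^2 \<le> 1 - (lam/2)^2" by (simp add: power2_eq_square)
  then show "1/2 \<le> cos (theta lam)" unfolding theta_def cos_arcsin[OF b] by (rule real_le_rsqrt)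
qed

text \<open>For \<open>m = 1\<close> and \<open>m = 2\<close> the upper bounds for the abscissas are trivial, since \<open>4 / m\<close> is at least 2.\<close>
lemma P0_P1_bounds:
  assumes lam: "0 < lam" "lam < 1/10" and m: "1 \<le> m" "m \<le> M lam"
  shows "lam \<le> 2 / real m"
    and "1/2 \<le> fst (P0 lam m)" "fst (P0 lam m) \<le> 1/2 + 4 / real m"
    and "1/2 \<le> fst (P1 lam (m - 1))" "fst (P1 lam (m - 1)) \<le> 1/2 + 4 / real m"
    and "1 - 4 * lam / real m \<le> snd (P1 lam (m - 1))"
proof -
  define th where "th = theta lam"
  note T = theta_bounds[OF lam, folded th_def]
  have c: "0 < cos th" using T(2) by linarith
  have "real m \<le> pi / (4 * th) - 1/2" using m unfolding M_def th_def[symmetric] by linarith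
  then have mth: "(2 * real m + 1) * th \<le> pi/2" using T(1) by (simp add: field_simps)
  show lm: "lam \<le> 2 / real m"
  proof -
    have "2 * real m * th \<le> (2 * real m + 1) * th" using T(1) by (intro mult_right_mono) auto
    then have "4 * (real m * th) \<le> pi" using mth by simp
    then have "th \<le> 1 / real m" using m pi_less_4 by (simp add: field_simps)
    then show ?thesis using T(4) by simp
  qed
  define q0 where "q0 = tan th / tan ((2 * real m + 1) * th)"
  have q0: "0 \<le> q0" "q0 \<le> 2 / (2 * real m + 1)"
    using cot_quotient_bounds[OF T(1,2) c _ mth] by (auto simp: q0_def)
  have q0': "2 / (2 * real m + 1) \<le> 2 / real m" using m by (intro divide_left_mono) auto
  have X0: "fst (P0 lam m) = (1 + 2 * lam + q0) / 2" by (simp add: P0_def q0_def th_def)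
  show "1/2 \<le> fst (P0 lam m)" using q0 lam by (simp add: X0)
  show "fst (P0 lam m) \<le> 1/2 + 4 / real m" using q0 q0' lm m unfolding X0 by (simp add: field_simps)
  have sq: "lam^2 \<le> lam/10" "0 \<le> lam^2" using lam by (auto simp: power2_eq_square)
  have p3: "0 \<le> lam^3" using lam by simp
  have p4: "lam^4 \<le> lam^2" "0 \<le> lam^4" using lam by (auto intro!: power_decreasing)
  have p6: "0 \<le> lam^6" using lam by simp
  have "(1/2 \<le> fst (P1 lam (m - 1)) \<and> fst (P1 lam (m - 1)) \<le> 1/2 + 4 / real m) \<and> 1 - 4 * lam / real m \<le> snd (P1 lam (m - 1))"
  proof -
    consider "m = 1" | "m = 2" | "3 \<le> m" using m(1) by linarith
    then show ?thesis
    proof cases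
      case 1
      have den: "0 < 2 - 4 * lam^2 + lam^4" "2 - 4 * lam^2 + lam^4 \<le> 2" using sq p4 lam by linarith+
      have "(1 - 4 * lam) * (2 - 4 * lam^2 + lam^4) \<le> (1 - 4 * lam) * 2"
        using den lam by (intro mult_left_mono) auto
      also have "\<dots> \<le> 2 - lam - lam^2" using sq lam by simp
      finally have "1 - 4 * lam \<le> (2 - lam - lam^2) / (2 - 4 * lam^2 + lam^4)" using den by (simp add: le_divide_eq)
      then show ?thesis using 1 by (simp add: P1_def)
    next
      case 2
      have p64: "6 * lam^4 \<le> 6 * lam^2" using p4 by simp
      have p66: "lam^6 \<le> lam^2" using lam by (auto intro!: power_decreasing)
      have den: "0 < 2 - 9 * lam^2 + 6 * lam^4 - lam^6" "2 - 9 * lam^2 + 6 * lam^4 - lam^6 \<le> 2" using sq p4 p6 p64 p66 lam by linarith+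
      have "(1 - 2 * lam) * (2 - 9 * lam^2 + 6 * lam^4 - lam^6) \<le> (1 - 2 * lam) * 2"
        using den lam by (intro mult_left_mono) auto
      also have "(1 - 2 * lam) * 2 = 2 - 4 * lam" by simp
      also have "\<dots> \<le> 2 - 2 * lam - 4 * lam^2 + lam^3 + lam^4" using sq p3 p4 lam by linarith
      finally have "1 - 2 * lam \<le> (2 - 2 * lam - 4 * lam^2 + lam^3 + lam^4) / (2 - 9 * lam^2 + 6 * lam^4 - lam^6)"
        using den by (simp add: le_divide_eq)
      then show ?thesis using 2 by (simp add: P1_def)
    next
      case 3
      define q where "q = tan th / tan ((2 * real m - 3) * th)"
      have "(2 * real m - 3) * th \<le> (2 * real m + 1) * th" using T(1) by (intro mult_right_mono) auto
      then have "(2 * real m - 3) * th \<le> pi/2" using mth by linarith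
      then have q: "0 \<le> q" "q \<le> 2 / (2 * real m - 3)"
        using cot_quotient_bounds[OF T(1,2) c, of "2 * real m - 3"] 3 by (auto simp: q_def)
      have "2 / (2 * real m - 3) \<le> 2 / real m" using 3 by (intro divide_left_mono) auto
      then have qm: "q \<le> 2 / real m" using q by linarith
      have "(2 * real (m - 1) - 1) * th = (2 * real m - 3) * th" using 3 by (simp add: of_nat_diff)
      then have P: "P1 lam (m - 1) = ((1 + 2 * lam - lam^2 + lam^4 + (1 - 3 * lam^2 + lam^4) * q) / 2,
          1 + lam^3 / 2 + lam / 2 * (lam^2 - 2) * q)"
        using 3 by (simp add: P1_def q_def th_def)
      have f: "0 \<le> 1 - 3 * lam^2 + lam^4" "1 - 3 * lam^2 + lam^4 \<le> 1" using sq p4 lam by linarith+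
      have fq: "0 \<le> (1 - 3 * lam^2 + lam^4) * q" "(1 - 3 * lam^2 + lam^4) * q \<le> 1 * q"
        using mult_nonneg_nonneg[OF f(1) q(1)] mult_right_mono[OF f(2) q(1)] by simp_all
      define w where "w = (1 - 3 * lam^2 + lam^4) * q"
      have w: "0 \<le> w" "w \<le> q" using fq by (simp_all add: w_def)
      have Pw: "fst (P1 lam (m - 1)) = (1 + 2 * lam - lam^2 + lam^4 + w) / 2" by (simp only: P w_def fst_conv)
      have "0 \<le> 2 * lam - lam^2 + lam^4 + w" using w sq p4(2) lam by linarith
      then have X: "1/2 \<le> fst (P1 lam (m - 1))" unfolding Pw by simp
      have "2 * lam - lam^2 + lam^4 + w \<le> 3 * (2 / real m)"
        using w qm lm p4 by linarith
      then have "2 * lam - lam^2 + lam^4 + w \<le> 6 / real m" by simp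
      moreover have "6 / real m \<le> 8 / real m" using m by (simp add: divide_right_mono)
      ultimately have X': "fst (P1 lam (m - 1)) \<le> 1/2 + 4 / real m" unfolding Pw by simp
      have "lam / 2 * (2 - lam^2) * q \<le> lam * q" using lam q by (intro mult_right_mono) (auto simp: power2_eq_square algebra_simps)
      also have "\<dots> \<le> lam * (2 / real m)" using qm lam by (intro mult_left_mono) auto
      also have "\<dots> \<le> 4 * lam / real m" using lam m by (simp add: field_simps)
      finally have "lam / 2 * (2 - lam^2) * q \<le> 4 * lam / real m" .
      moreover have "snd (P1 lam (m - 1)) = 1 + lam^3 / 2 - lam / 2 * (2 - lam^2) * q" unfolding P by (simp add: algebra_simps)
      ultimately have "1 - 4 * lam / real m \<le> snd (P1 lam (m - 1))" using p3 by linarith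
      then show ?thesis using X X' by blast
    qed
  qed
  then show "1/2 \<le> fst (P1 lam (m - 1))" "fst (P1 lam (m - 1)) \<le> 1/2 + 4 / real m"
    "1 - 4 * lam / real m \<le> snd (P1 lam (m - 1))" by auto
qed

text \<open>The segment that contains the fixed point approaches \<open>(1/2, 1)\<close> like \<open>1 / m\<close> in the horizontal and
  like \<open>lam / m\<close> in the vertical direction.\<close>
lemma island_radius_bound:
  assumes lam: "0 < lam" "lam < 1/10" and m: "1 \<le> m" "m \<le> M lam"
    and z: "regular_fixed_point lam m n z"
  shows "0 \<le> island_radius lam z" "island_radius lam z \<le> 14 * lam / real m"
proof -
  note B = P0_P1_bounds[OF lam m]
  obtain x y where xy: "z = (x, y)" by force
  have zO: "(x, y) \<in> Omega" using z by (simp add: regular_fixed_point_def xy)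
  show "0 \<le> island_radius lam z" using island_radius_nonneg zO by (simp add: xy)
  have "(x, y) \<in> closed_segment (P0 lam m) (P1 lam (m - 1))" using z by (simp add: regular_fixed_point_def xy)
  from coordinates_on_segment[OF this B(2,4,3,5) _ B(6)]
  have c: "1/2 \<le> x" "x \<le> 1/2 + 4 / real m" "1 - 4 * lam / real m \<le> y" using lam by (simp_all add: P0_def)
  have "4 * lam / real m \<le> 4 * lam" using lam m by (simp add: field_simps)
  then have "3/5 \<le> y" using c(3) lam by linarith
  from third_iterate_bound[OF zO lam c(1) this]
  have "island_radius lam z \<le> lam * lam + lam * (2 * x - 1) + (1 - y)" by (simp add: xy)
  also have "\<dots> \<le> lam * (2 / real m) + lam * (8 / real m) + 4 * lam / real m"
    using B(1) c lam by (intro add_mono mult_left_mono) auto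
  also have "\<dots> = 14 * lam / real m" by (simp add: add_divide_distrib[symmetric])
  finally show "island_radius lam z \<le> 14 * lam / real m" .
qed

section \<open>Summation over all orbits\<close>

definition contrib :: "real \<Rightarrow> nat \<Rightarrow> nat \<Rightarrow> real" where
  "contrib lam m n = (if (m, n) \<in> regular_pairs lam
     then area lam (island lam (Z lam m n)) * real (period m n) else 0)"

definition row_area :: "real \<Rightarrow> nat \<Rightarrow> real" where
  "row_area lam m = (\<Sum>n<N lam. contrib lam m n)"

lemma regular_pairs_subset: "regular_pairs lam \<subseteq> {1..M lam} \<times> {..<N lam}"
  by (auto simp: regular_pairs_def)

lemma A_reg_eq_rows: "A_reg lam = (\<Sum>j. row_area lam (Suc j))"
proof -
  have "A_reg lam = (\<Sum>(m, n)\<in>{1..M lam} \<times> {..<N lam}. contrib lam m n)"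
    unfolding A_reg_def
    by (rule sum.mono_neutral_cong_left) (use regular_pairs_subset[of lam] in \<open>auto simp: contrib_def\<close>)
  also have "\<dots> = (\<Sum>m\<in>{1..M lam}. row_area lam m)"
    by (simp add: sum.cartesian_product row_area_def)
  also have "\<dots> = (\<Sum>j<M lam. row_area lam (Suc j))"
    by (rule sum.reindex_bij_witness[of _ Suc "\<lambda>m. m - 1"]) auto
  also have "\<dots> = (\<Sum>j. row_area lam (Suc j))"
  proof (rule suminf_finite[symmetric])
    fix j assume "j \<notin> {..<M lam}"
    then have "(Suc j, n) \<notin> regular_pairs lam" for n by (auto simp: regular_pairs_def)
    then show "row_area lam (Suc j) = 0" by (simp add: row_area_def contrib_def)
  qed simp
  finally show ?thesis .
qed

lemma N_M_bound:
  assumes "0 < lam" "lam < 1/10"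
  shows "real (N lam) * lam \<le> pi/4" "real (M lam) * lam \<le> pi/2"
proof -
  note T = theta_bounds[OF assms]
  have nat_le: "real (nat \<lfloor>x\<rfloor>) \<le> y" if "x \<le> y" "0 \<le> y" for x y :: real
    using that by linarith
  have "real (N lam) \<le> pi / (8 * theta lam)" unfolding N_def using T(1) by (intro nat_le) auto
  then have "real (N lam) * lam \<le> pi / (8 * theta lam) * (2 * theta lam)" using T assms by (intro mult_mono) auto
  then show "real (N lam) * lam \<le> pi/4" using T(1) by simp
  have "real (M lam) \<le> pi / (4 * theta lam)" unfolding M_def using T(1) by (intro nat_le) auto
  then have "real (M lam) * lam \<le> pi / (4 * theta lam) * (2 * theta lam)" using T assms by (intro mult_mono) auto
  then show "real (M lam) * lam \<le> pi/2" using T(1) by simp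
qed

text \<open>The period is of the order of \<open>1 / lam\<close> at most and the radius is at most \<open>14 lam / m\<close>.\<close>
lemma contrib_bound:
  assumes lam: "0 < lam" "lam < 1/10"
  shows "0 \<le> contrib lam m n" "contrib lam m n \<le> 588 * pi^2 * lam / (real m)^2"
proof -
  have "0 \<le> contrib lam m n \<and> contrib lam m n \<le> 588 * pi^2 * lam / (real m)^2"
  proof (cases "(m, n) \<in> regular_pairs lam")
    case True
    then have m: "1 \<le> m" "m \<le> M lam" "1 \<le> n" "n \<le> N lam - 1" and ex: "\<exists>z. regular_fixed_point lam m n z"
      by (auto simp: regular_pairs_def)
    define r where "r = island_radius lam (Z lam m n)"
    have "regular_fixed_point lam m n (Z lam m n)" unfolding Z_def using ex by (rule someI_ex)
    note r = island_radius_bound[OF lam m(1,2) this, folded r_def]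
    have c: "contrib lam m n = pi * (1 - lam^2/4) * r^2 * real (period m n)"
      using True lam by (simp add: contrib_def area_island r_def)
    have "lam^2 \<le> 1" using lam by (auto simp: power_le_one)
    then have k: "0 \<le> 1 - lam^2/4" "1 - lam^2/4 \<le> 1" by auto
    have r2: "r^2 \<le> (14 * lam / real m)^2" using r by (intro power_mono) auto
    have "real (period m n) \<le> 4 * (real (M lam) + real (N lam))" using m unfolding period_def by simp
    then have "real (period m n) * lam \<le> 4 * (real (M lam) + real (N lam)) * lam" using lam by (intro mult_right_mono) auto
    also have "\<dots> \<le> 3 * pi" using N_M_bound[OF lam] by (simp add: algebra_simps)
    finally have t: "real (period m n) * lam \<le> 3 * pi" .
    have "contrib lam m n \<le> pi * 1 * (14 * lam / real m)^2 * real (period m n)"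
      unfolding c using k r2 by (intro mult_mono mult_nonneg_nonneg) auto
    also have "\<dots> = (196 * pi * lam / (real m)^2) * (real (period m n) * lam)"
      by (simp add: power2_eq_square)
    also have "\<dots> \<le> (196 * pi * lam / (real m)^2) * (3 * pi)"
      using t lam by (intro mult_left_mono) auto
    also have "\<dots> = 588 * pi^2 * lam / (real m)^2" by (simp add: power2_eq_square)
    finally show ?thesis using k unfolding c by simp
  qed (use lam in \<open>simp add: contrib_def\<close>)
  then show "0 \<le> contrib lam m n" "contrib lam m n \<le> 588 * pi^2 * lam / (real m)^2" by auto
qed

text \<open>The step function of the angle \<open>x = n lam\<close> whose integral is \<open>row_area\<close>.\<close>
definition step_density :: "real \<Rightarrow> nat \<Rightarrow> real \<Rightarrow> real" where
  "step_density lam m x = (\<Sum>n<N lam. contrib lam m n / lam * indicator {real n * lam..<(real n + 1) * lam} x)"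

lemma step_density_integral:
  assumes "0 < lam"
  shows "integral\<^sup>L lborel (step_density lam m) = row_area lam m"
proof -
  have i: "integrable lborel (indicator {real n * lam..<(real n + 1) * lam} :: real \<Rightarrow> real)" for n
    by (rule integrable_real_indicator) (use assms in \<open>auto simp: mult_right_mono\<close>)
  have "measure lborel {real n * lam..<(real n + 1) * lam} = lam" for n
    using assms by (simp add: algebra_simps)
  then have "integral\<^sup>L lborel (\<lambda>x. contrib lam m n / lam * indicator {real n * lam..<(real n + 1) * lam} x) = contrib lam m n" for n
    using assms by simp
  moreover have "integral\<^sup>L lborel (step_density lam m) = (\<Sum>n<N lam. integral\<^sup>L lborel (\<lambda>x. contrib lam m n / lam * indicator {real n * lam..<(real n + 1) * lam} x))"
    unfolding step_density_def[abs_def] by (rule Bochner_Integration.integral_sum) (intro integrable_mult_right i)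
  ultimately show ?thesis by (simp add: row_area_def)
qed

lemma step_density_measurable: "step_density lam m \<in> borel_measurable lborel"
  unfolding step_density_def[abs_def] by measurable

lemma in_cell_iff:
  assumes "0 < lam" "0 \<le> x"
  shows "x \<in> {real n * lam..<(real n + 1) * lam} \<longleftrightarrow> n = nat \<lfloor>x / lam\<rfloor>"
proof -
  have "x \<in> {real n * lam..<(real n + 1) * lam} \<longleftrightarrow> real n \<le> x / lam \<and> x / lam < real n + 1"
    using assms by (simp add: field_simps)
  also have "\<dots> \<longleftrightarrow> \<lfloor>x / lam\<rfloor> = int n" by (simp add: floor_eq_iff)
  also have "\<dots> \<longleftrightarrow> n = nat \<lfloor>x / lam\<rfloor>" using assms by auto
  finally show ?thesis .
qed

lemma step_density_eq:
  assumes "0 < lam" "0 \<le> x"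
  shows "step_density lam m x = contrib lam m (nat \<lfloor>x / lam\<rfloor>) / lam"
proof -
  let ?n = "nat \<lfloor>x / lam\<rfloor>"
  have "step_density lam m x = (\<Sum>n<N lam. if n = ?n then contrib lam m n / lam else 0)"
    unfolding step_density_def using in_cell_iff[OF assms] by (intro sum.cong) (auto simp: indicator_def)
  also have "\<dots> = (if ?n < N lam then contrib lam m ?n / lam else 0)" by simp
  also have "\<dots> = contrib lam m ?n / lam"
    using regular_pairs_subset[of lam] by (auto simp: contrib_def)
  finally show ?thesis .
qed

lemma step_density_bound:
  assumes lam: "0 < lam" "lam < 1/10"
  shows "norm (step_density lam m x) \<le> 588 * pi^2 / (real m)^2 * indicator {0..pi/4} x"
proof (cases "0 \<le> x \<and> x \<le> pi/4")
  case True
  then have "step_density lam m x = contrib lam m (nat \<lfloor>x / lam\<rfloor>) / lam" using step_density_eq[of lam x m] lam by simp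
  moreover have "contrib lam m (nat \<lfloor>x / lam\<rfloor>) / lam \<le> (588 * pi^2 * lam / (real m)^2) / lam"
    using contrib_bound[OF lam] lam by (intro divide_right_mono) auto
  ultimately show ?thesis using True contrib_bound(1)[OF lam] lam by simp
next
  case False
  have "x \<notin> {real n * lam..<(real n + 1) * lam}" if "n < N lam" for n
  proof
    assume x: "x \<in> {real n * lam..<(real n + 1) * lam}"
    have "0 \<le> real n * lam" using lam by simp
    moreover have "(real n + 1) * lam \<le> real (N lam) * lam" using that lam by (intro mult_right_mono) auto
    ultimately show False using False x N_M_bound(1)[OF lam] by auto
  qed
  then have "step_density lam m x = 0" by (simp add: step_density_def)
  then show ?thesis using False by simp
qed

definition limit_piece :: "real \<Rightarrow> real \<Rightarrow> real \<Rightarrow> real \<Rightarrow> real" where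
  "limit_piece a \<alpha> \<beta> eta = indicator {\<alpha>..\<beta>} eta * ((a * tan eta - 1)^2 * (pi/4 - eta))"

text \<open>This is \<open>4 \<pi> (\<pi>/4 - eta) \<rho>\<^sup>2\<close> where \<open>\<rho>\<close>, as a function of \<open>eta = \<pi>/4 - \<beta>\<close>, is positive, and 0
  elsewhere; it is split where the minimum in \<open>\<rho>\<close> changes its branch.\<close>
definition limit_density :: "nat \<Rightarrow> real \<Rightarrow> real" where
  "limit_density m eta = pi/4 * (limit_piece (2 * real m + 1) (arccot (2 * real m + 1)) (arccot (2 * real m - 1)) eta
     + (if m = 1 then 0 else limit_piece (2 * real m - 3) (arccot (2 * real m - 1)) (arccot (2 * real m - 3)) eta))"

lemma arccot_bounds: "0 < arccot x" "1 \<le> x \<Longrightarrow> arccot x \<le> pi/4"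
proof -
  show "0 < arccot x" using arctan_ubound[of x] by (simp add: arccot_def)
  assume "1 \<le> x"
  then have "arctan 1 \<le> arctan x" by (simp only: arctan_le_iff)
  then show "arccot x \<le> pi/4" unfolding arccot_def arctan_one by linarith
qed

lemma arccot_less_iff:
  assumes "0 < eta" "eta < pi/2" "0 < y"
  shows "eta < arccot y \<longleftrightarrow> y * tan eta < 1" "arccot y < eta \<longleftrightarrow> 1 < y * tan eta"
proof -
  have t: "0 < tan eta" using assms tan_gt_zero by simp
  have "arctan (1 / tan eta) = pi/2 - eta"
    using arctan_inverse[of "tan eta"] t assms by (simp add: arctan_tan sgn_real_def inverse_eq_divide)
  then have e: "eta = pi/2 - arctan (1 / tan eta)" by simp
  have "eta < arccot y \<longleftrightarrow> arctan y < arctan (1 / tan eta)"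
    "arccot y < eta \<longleftrightarrow> arctan (1 / tan eta) < arctan y"
    unfolding arccot_def using e by linarith+
  then show "eta < arccot y \<longleftrightarrow> y * tan eta < 1" "arccot y < eta \<longleftrightarrow> 1 < y * tan eta"
    using t by (simp_all add: arctan_less_iff field_simps)
qed

lemma limit_piece_integral:
  assumes "0 \<le> \<alpha>" "\<beta> \<le> pi/4"
  shows "integrable lborel (limit_piece a \<alpha> \<beta>)"
    "integral\<^sup>L lborel (limit_piece a \<alpha> \<beta>) = integral {\<alpha>..\<beta>} (\<lambda>eta. (a * tan eta - 1)^2 * (pi/4 - eta))"
proof -
  have "continuous_on {\<alpha>..\<beta>} (\<lambda>eta. (a * tan eta - 1)^2 * (pi/4 - eta))"
  proof (intro continuous_intros ballI)
    fix x assume "x \<in> {\<alpha>..\<beta>}"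
    then have "- (pi/2) < x" "x < pi/2" using assms pi_gt_zero unfolding atLeastAtMost_iff by linarith+
    then have "0 < cos x" by (rule cos_gt_zero_pi)
    then show "cos x \<noteq> 0" by simp
  qed
  then have "set_integrable lborel {\<alpha>..\<beta>} (\<lambda>eta. (a * tan eta - 1)^2 * (pi/4 - eta))"
    by (rule borel_integrable_atLeastAtMost')
  from this set_borel_integral_eq_integral(2)[OF this]
  show "integrable lborel (limit_piece a \<alpha> \<beta>)"
    "integral\<^sup>L lborel (limit_piece a \<alpha> \<beta>) = integral {\<alpha>..\<beta>} (\<lambda>eta. (a * tan eta - 1)^2 * (pi/4 - eta))"
    by (simp_all add: set_integrable_def set_lebesgue_integral_def limit_piece_def[abs_def])
qed

text \<open>The index starts at 1, and the first row is the term of \<open>A_reg_limit\<close> outside the series.\<close>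
definition row_limit :: "nat \<Rightarrow> real" where
  "row_limit m = (if m = 1 then I 2 1 2 else limit_summand m)"

lemma limit_density_integral:
  assumes m: "1 \<le> m"
  shows "integrable lborel (limit_density m)" "integral\<^sup>L lborel (limit_density m) = row_limit m"
proof -
  let ?f = "limit_piece (2 * real m + 1) (arccot (2 * real m + 1)) (arccot (2 * real m - 1))"
  let ?g = "limit_piece (2 * real m - 3) (arccot (2 * real m - 1)) (arccot (2 * real m - 3))"
  have f: "integrable lborel ?f" "integral\<^sup>L lborel ?f
    = integral {arccot (2 * real m + 1)..arccot (2 * real m - 1)} (\<lambda>eta. ((2 * real m + 1) * tan eta - 1)^2 * (pi/4 - eta))"
    by (rule limit_piece_integral; use m arccot_bounds in \<open>simp add: less_imp_le\<close>)+
  have "integrable lborel (limit_density m) \<and> integral\<^sup>L lborel (limit_density m) = row_limit m"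
  proof (cases "m = 1")
    case True
    then have "limit_density m = (\<lambda>eta. pi/4 * ?f eta)" by (simp add: limit_density_def[abs_def])
    then show ?thesis using f True by (simp add: row_limit_def I_def)
  next
    case False
    have g: "integrable lborel ?g" "integral\<^sup>L lborel ?g
      = integral {arccot (2 * real m - 1)..arccot (2 * real m - 3)} (\<lambda>eta. ((2 * real m - 3) * tan eta - 1)^2 * (pi/4 - eta))"
      by (rule limit_piece_integral; use m False arccot_bounds in \<open>simp add: less_imp_le\<close>)+
    have "limit_density m = (\<lambda>eta. pi/4 * (?f eta + ?g eta))" using False by (simp add: limit_density_def[abs_def])
    moreover have e: "2 * (real m + 1) - 1 = 2 * real m + 1" "2 * (real m - 1) - 1 = 2 * real m - 3" by simp_all
    ultimately show ?thesis using f g False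
      by (simp add: row_limit_def limit_summand_def I_def e) (simp add: algebra_simps)
  qed
  then show "integrable lborel (limit_density m)" "integral\<^sup>L lborel (limit_density m) = row_limit m" by auto
qed

lemma theta_tendsto:
  assumes "S \<longlonglongrightarrow> 0"
  shows "(\<lambda>k. theta (S k)) \<longlonglongrightarrow> 0"
proof -
  have "((\<lambda>x. arcsin (x/2)) \<longlongrightarrow> arcsin (0/2)) (at 0)"
    by (rule isContD) (auto intro!: continuous_intros isCont_arcsin isCont_o2[of 0 "\<lambda>x. x/2" arcsin])
  then have "isCont (\<lambda>x. arcsin (x/2)) 0" by (simp add: isCont_def)
  from isCont_tendsto_compose[OF this assms] show ?thesis by (simp add: theta_def)
qed

text \<open>The excluded values of \<open>x\<close> are those where \<open>\<rho>\<close> vanishes or changes its branch and the ends of the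
  range of the angle.\<close>
lemma step_density_pointwise_limit:
  assumes S: "\<And>k. 0 < S k" "\<And>k. S k < 1/10" "S \<longlonglongrightarrow> 0" and m: "1 \<le> m"
    and x: "x \<noteq> 0" "x \<noteq> pi/4" "x \<noteq> pi/4 - arccot (2 * real m + 1)" "x \<noteq> pi/4 - arccot (2 * real m - 1)"
       "x \<noteq> pi/4 - arccot (2 * real m - 3)"
  shows "(\<lambda>k. step_density (S k) m x) \<longlonglongrightarrow> limit_density m (pi/4 - x)"
proof (cases "0 < x \<and> x < pi/4")
  case False
  then consider "x < 0" | "pi/4 < x" using x by linarith
  then have "limit_density m (pi/4 - x) = 0"
  proof cases
    case 1
    then show ?thesis using m arccot_bounds[of "2 * real m - 1"] arccot_bounds[of "2 * real m - 3"]
      by (auto simp: limit_density_def limit_piece_def)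
  next
    case 2
    then show ?thesis using arccot_bounds(1)[of "2 * real m + 1"] arccot_bounds(1)[of "2 * real m - 1"]
      by (auto simp: limit_density_def limit_piece_def indicator_def)
  qed
  moreover have "step_density (S k) m x = 0" for k
    using step_density_bound[OF S(1,2), of k m x] False x by (auto simp: indicator_def split: if_splits)
  ultimately show ?thesis by simp
next
  case True
  define th where "th k = theta (S k)" for k
  define n where "n k = nat \<lfloor>x / S k\<rfloor>" for k
  have T: "0 < th k" "2 * sin (th k) = S k" for k using theta_bounds[OF S(1,2)] by (simp_all add: th_def)
  have th0: "th \<longlonglongrightarrow> 0" using theta_tendsto[OF S(3)] by (simp add: th_def[abs_def])
  have nS: "(\<lambda>k. real (n k) * S k) \<longlonglongrightarrow> x"
  proof (rule tendsto_sandwich)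
    have b: "real (n k) * S k \<le> x \<and> x - S k \<le> real (n k) * S k" for k
    proof -
      have "x \<in> {real (n k) * S k..<(real (n k) + 1) * S k}"
        using in_cell_iff[of "S k" x "n k"] S(1) True by (simp add: n_def)
      then show ?thesis by (simp add: algebra_simps)
    qed
    show "\<forall>\<^sub>F k in sequentially. x - S k \<le> real (n k) * S k" "\<forall>\<^sub>F k in sequentially. real (n k) * S k \<le> x"
      using b by auto
    show "(\<lambda>k. x - S k) \<longlonglongrightarrow> x" using tendsto_diff[OF tendsto_const S(3)] by simp
  qed simp
  have "filterlim th (at_right 0) sequentially"
    using th0 T(1) by (auto simp: filterlim_at intro!: always_eventually less_imp_neq[THEN not_sym])
  from filterlim_compose[OF sin_quotient_limit this, of 1]
  have "(\<lambda>k. sin (th k) / th k) \<longlonglongrightarrow> 1" by simp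
  from tendsto_divide[OF nS this] have "(\<lambda>k. real (n k) * S k / (sin (th k) / th k)) \<longlonglongrightarrow> x" by simp
  moreover have "real (n k) * S k / (sin (th k) / th k) = 2 * real (n k) * th k" for k
    using T[of k] S(1)[of k] by (simp add: field_simps flip: T(2))
  ultimately have nth: "(\<lambda>k. 2 * real (n k) * th k) \<longlonglongrightarrow> x" by simp
  interpret fine_scale th n x
    by unfold_locales (use T th0 nth True in auto)
  have lamS: "lam k = S k" for k using T(2) by (simp add: lam_def)
  have st: "step_density (S k) m x = contrib (S k) m (n k) / S k" for k
    using step_density_eq[of "S k" x m] S(1) True by (simp add: n_def)
  define eta where "eta = pi/4 - x"
  have eta: "0 < eta" "eta < pi/2" "eta < pi/4" using True by (auto simp: eta_def)
  have tau: "tau = tan eta" by (simp add: tau_def eta_def)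
  note t01 = tau_01
  have mR: "1 \<le> real m" using m by simp
  have up: "eta < arccot (2 * real m + 1) \<longleftrightarrow> (2 * real m + 1) * tau < 1" "arccot (2 * real m + 1) < eta \<longleftrightarrow> 1 < (2 * real m + 1) * tau"
    and mid: "eta < arccot (2 * real m - 1) \<longleftrightarrow> (2 * real m - 1) * tau < 1" "arccot (2 * real m - 1) < eta \<longleftrightarrow> 1 < (2 * real m - 1) * tau"
    using arccot_less_iff[OF eta(1,2), of "2 * real m + 1"] arccot_less_iff[OF eta(1,2), of "2 * real m - 1"] mR
    unfolding tau by auto
  have low: "eta < arccot (2 * real m - 3) \<longleftrightarrow> (2 * real m - 3) * tau < 1" "arccot (2 * real m - 3) < eta \<longleftrightarrow> 1 < (2 * real m - 3) * tau"
    if "2 \<le> m" using arccot_less_iff[OF eta(1,2), of "2 * real m - 3"] that unfolding tau by auto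
  have ne: "eta \<noteq> arccot (2 * real m + 1)" "eta \<noteq> arccot (2 * real m - 1)" "eta \<noteq> arccot (2 * real m - 3)"
    using x(3-5) by (auto simp: eta_def)
  have one: "(2 * real m - 1) * tau < 1" "(2 * real m - 3) * tau < 1" if "m = 1" using that t01 by auto
  show ?thesis
  proof (cases "0 < rho m")
    case pos: True
    have t: "1 < (2 * real m + 1) * tau" "(2 * real m - 3) * tau < 1" using pos by (auto simp: rho_def)
    \<comment> \<open>written in the shape in which the limit rules produce it\<close>
    have d: "limit_density m eta = pi * (1 - 0^2/4) * (rho m)^2 * (4 * x + (4 * real m - 1) * 0)"
    proof (cases "(2 * real m - 1) * tau < 1")
      case True
      have "rho m = ((2 * real m + 1) * tau - 1) / 4" using True by (simp add: rho_def min_def algebra_simps)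
      then have r: "(2 * real m + 1) * tau - 1 = 4 * rho m" by simp
      moreover have "limit_density m eta = pi/4 * (((2 * real m + 1) * tau - 1)^2 * x)"
        using True mid(1) up(2) t(1) by (auto simp: limit_density_def limit_piece_def tau eta_def[symmetric] indicator_def) (auto simp: eta_def)
      ultimately show ?thesis unfolding r by (simp add: power2_eq_square)
    next
      case False
      then have m2: "2 \<le> m" using one(1) m by (cases "m = 1") auto
      have b: "arccot (2 * real m - 1) < eta" using False mid(1) ne(2) by auto
      then have "1 < (2 * real m - 1) * tau" using mid(2) by simp
      then have "rho m = (1 - (2 * real m - 3) * tau) / 4" by (simp add: rho_def min_def algebra_simps)
      then have r: "(2 * real m - 3) * tau - 1 = - (4 * rho m)" by simp
      moreover have "limit_density m eta = pi/4 * (((2 * real m - 3) * tau - 1)^2 * x)"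
        using b low(1)[OF m2] t(2) m2 by (auto simp: limit_density_def limit_piece_def tau indicator_def) (auto simp: eta_def)
      ultimately show ?thesis unfolding r by (simp add: power2_eq_square)
    qed
    have "(\<lambda>k. pi * (1 - (S k)^2/4) * (island_radius (S k) (Z (S k) m (n k)) / S k)^2 * (4 * (real (n k) * S k) + (4 * real m - 1) * S k))
      \<longlonglongrightarrow> limit_density m eta"
      unfolding d using regular_limit(2)[OF m pos] unfolding lamS by (intro tendsto_intros S(3) nS) auto
    moreover have "\<forall>\<^sub>F k in sequentially. pi * (1 - (S k)^2/4) * (island_radius (S k) (Z (S k) m (n k)) / S k)^2 * (4 * (real (n k) * S k) + (4 * real m - 1) * S k)
       = step_density (S k) m x"
      using regular_limit(1)[OF m pos] unfolding lamS
    proof eventually_elim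
      case (elim k)
      define r where "r = island_radius (S k) (Z (S k) m (n k))"
      have "S k < 2" "S k \<noteq> 0" using S(1,2)[of k] by auto
      have "real (period m (n k)) = 4 * real (n k) + (4 * real m - 1)" using m by (simp add: period_def of_nat_diff)
      then have "step_density (S k) m x = pi * (1 - (S k)^2/4) * r^2 * (4 * real (n k) + (4 * real m - 1)) / S k"
        using elim area_island[OF S(1) \<open>S k < 2\<close>] by (simp add: st contrib_def r_def)
      also have "\<dots> = pi * (1 - (S k)^2/4) * (r / S k)^2 * ((4 * real (n k) + (4 * real m - 1)) * S k)"
        using \<open>S k \<noteq> 0\<close> by (simp add: power2_eq_square)
      finally show ?case unfolding r_def by (simp add: algebra_simps)
    qed
    ultimately show ?thesis unfolding eta_def by (rule Lim_transform_eventually)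
  next
    case False
    have "rho m \<noteq> 0"
    proof
      assume "rho m = 0"
      then consider "(2 * real m + 1) * tau = 1" | "(2 * real m - 3) * tau = 1"
        by (auto simp: rho_def min_def split: if_splits)
      then show False
      proof cases
        case 1 then show False using up ne(1) by auto
      next
        case 2
        then have "m \<noteq> 1" using one(2) by auto
        then show False using 2 low ne(3) m by auto
      qed
    qed
    then have neg: "rho m < 0" using False by simp
    have "limit_density m eta = 0"
    proof -
      consider "(2 * real m + 1) * tau < 1" | "1 < (2 * real m - 3) * tau"
        using neg by (auto simp: rho_def min_less_iff_disj)
      then show ?thesis
      proof cases
        case 1
        then have "(2 * real m - 1) * tau < 1" using t01 mR by (simp add: algebra_simps)
        then show ?thesis using 1 up mid by (auto simp: limit_density_def limit_piece_def indicator_def)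
      next
        case 2
        then have m2: "2 \<le> m" using one(2) m by (cases "m = 1") auto
        have "1 < (2 * real m - 1) * tau" using 2 t01 by (simp add: algebra_simps)
        then show ?thesis using 2 mid low[OF m2] m2 by (auto simp: limit_density_def limit_piece_def indicator_def)
      qed
    qed
    moreover have "\<forall>\<^sub>F k in sequentially. 0 = step_density (S k) m x"
      using nonregular_limit[OF m neg] unfolding lamS by eventually_elim (simp add: st contrib_def)
    ultimately show ?thesis unfolding eta_def
      using Lim_transform_eventually[OF tendsto_const, of 0] by fastforce
  qed
qed

lemma row_tendsto:
  assumes S: "\<And>k. 0 < S k" "\<And>k. S k < 1/10" "S \<longlonglongrightarrow> 0" and m: "1 \<le> m"
  shows "(\<lambda>k. row_area (S k) m) \<longlonglongrightarrow> row_limit m"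
proof -
  let ?f = "\<lambda>x. limit_density m (pi/4 - x)"
  have refl: "integral\<^sup>L lborel (limit_density m) = integral\<^sup>L lborel ?f"
    using lborel_integral_real_affine[of "-1" "limit_density m" "pi/4"] by simp
  have fm: "?f \<in> borel_measurable lborel"
    using lborel_integrable_real_affine[OF limit_density_integral(1)[OF m], of "-1" "pi/4"]
    by (intro borel_measurable_integrable) simp
  have "(\<lambda>k. integral\<^sup>L lborel (step_density (S k) m)) \<longlonglongrightarrow> integral\<^sup>L lborel ?f"
  proof (rule integral_dominated_convergence[OF fm step_density_measurable])
    show "integrable lborel (\<lambda>x. 588 * pi^2 / (real m)^2 * indicator {0..pi/4} x)"
      by (intro integrable_mult_right integrable_real_indicator) auto
    let ?E = "{0, pi/4, pi/4 - arccot (2 * real m + 1), pi/4 - arccot (2 * real m - 1), pi/4 - arccot (2 * real m - 3)}"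
    have "AE x in lborel. x \<notin> ?E" by (rule AE_not_in[OF finite_imp_null_set_lborel]) simp
    then show "AE x in lborel. (\<lambda>k. step_density (S k) m x) \<longlonglongrightarrow> ?f x"
      by eventually_elim (rule step_density_pointwise_limit[OF S m]; simp)
    show "AE x in lborel. norm (step_density (S k) m x) \<le> 588 * pi^2 / (real m)^2 * indicator {0..pi/4} x" for k
      by (intro AE_I2 step_density_bound S)
  qed
  then show ?thesis using step_density_integral[OF S(1)] limit_density_integral(2)[OF m] refl by simp
qed

lemma row_bound:
  assumes lam: "0 < lam" "lam < 1/10"
  shows "norm (row_area lam m) \<le> 147 * pi^3 / (real m)^2"
proof -
  have "0 \<le> row_area lam m" unfolding row_area_def using contrib_bound[OF lam] by (intro sum_nonneg) auto
  have "row_area lam m \<le> (\<Sum>n<N lam. 588 * pi^2 * lam / (real m)^2)"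
    unfolding row_area_def using contrib_bound[OF lam] by (intro sum_mono) auto
  also have "\<dots> = 588 * pi^2 / (real m)^2 * (real (N lam) * lam)" by simp
  also have "\<dots> \<le> 588 * pi^2 / (real m)^2 * (pi/4)"
    using N_M_bound[OF lam] by (intro mult_left_mono) auto
  also have "\<dots> = 147 * pi^3 / (real m)^2" by (simp add: power2_eq_square power3_eq_cube)
  finally show ?thesis using \<open>0 \<le> row_area lam m\<close> by simp
qed

lemma rows_sum_tendsto:
  assumes S: "\<And>k. 0 < S k" "\<And>k. S k < 1/10" "S \<longlonglongrightarrow> 0"
  shows "summable (\<lambda>j. row_limit (Suc j))" "(\<lambda>k. A_reg (S k)) \<longlonglongrightarrow> (\<Sum>j. row_limit (Suc j))"
proof -
  have "summable (\<lambda>j. inverse ((real (Suc j))^2))"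
    using inverse_power_summable[of 2, where 'a=real] by (subst summable_Suc_iff) simp
  then have sm: "summable (\<lambda>j. 147 * pi^3 / (real (Suc j))^2)"
    unfolding divide_inverse by (rule summable_mult)
  have "(\<forall>\<^sub>F k in sequentially. summable (\<lambda>j. norm (row_area (S k) (Suc j)))) \<and> summable (\<lambda>j. norm (row_limit (Suc j))) \<and>
     (\<lambda>k. \<Sum>j. row_area (S k) (Suc j)) \<longlonglongrightarrow> (\<Sum>j. row_limit (Suc j))"
  proof (rule tannerys_theorem[OF _ _ sm])
    show "(\<lambda>k. row_area (S k) (Suc j)) \<longlonglongrightarrow> row_limit (Suc j)" for j by (rule row_tendsto[OF S]) simp
    show "\<forall>\<^sub>F (j, k) in sequentially \<times>\<^sub>F sequentially. norm (row_area (S k) (Suc j)) \<le> 147 * pi^3 / (real (Suc j))^2"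
      using row_bound[OF S(1,2)] by (intro always_eventually) (auto simp del: of_nat_Suc)
  qed simp
  then show "summable (\<lambda>j. row_limit (Suc j))" "(\<lambda>k. A_reg (S k)) \<longlonglongrightarrow> (\<Sum>j. row_limit (Suc j))"
    by (auto simp: A_reg_eq_rows dest: summable_rabs_cancel)
qed

lemma limit_density_nonneg: "1 \<le> m \<Longrightarrow> 0 \<le> limit_density m eta"
  using arccot_bounds(2)[of "2 * real m - 1"] arccot_bounds(2)[of "2 * real m - 3"]
  by (auto simp: limit_density_def limit_piece_def indicator_def intro!: mult_nonneg_nonneg add_nonneg_nonneg)

lemma row_limit_nonneg: "1 \<le> m \<Longrightarrow> 0 \<le> row_limit m"
  using limit_density_integral(2)[of m] by (metis limit_density_nonneg integral_nonneg_AE AE_I2)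

text \<open>The density of the first row is positive between \<open>arccot 3\<close> and \<open>\<pi>/4\<close>.\<close>
lemma row_limit_1_pos: "0 < row_limit 1"
proof -
  let ?f = "\<lambda>eta. (3 * tan eta - 1)^2 * (pi/4 - eta)"
  let ?\<alpha> = "arccot 3"
  have ab: "0 < ?\<alpha>" "arccot 1 = pi/4" using arccot_bounds by (auto simp: arccot_def arctan_one)
  have lt: "?\<alpha> < pi/4" using arctan_less_iff[of 1 3] ab(2) by (simp add: arccot_def)
  have "integral\<^sup>L lborel (limit_density 1) \<noteq> 0"
  proof
    assume "integral\<^sup>L lborel (limit_density 1) = 0"
    then have "AE x in lborel. limit_density 1 x = 0"
      using integral_nonneg_eq_0_iff_AE[OF limit_density_integral(1), of 1] limit_density_nonneg[of 1] by simp
    moreover have "limit_density 1 x \<noteq> 0" if "x \<in> {?\<alpha><..<pi/4}" for x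
    proof -
      have "1 < 3 * tan x" using arccot_less_iff(2)[of x 3] that ab by auto
      then show ?thesis using that ab by (auto simp: limit_density_def limit_piece_def indicator_def)
    qed
    ultimately have "AE x in lborel. x \<notin> {?\<alpha><..<pi/4}" by (auto elim: eventually_mono)
    then have "{?\<alpha><..<pi/4} \<in> null_sets lborel" by (subst AE_iff_null_sets) auto
    then have "emeasure lborel {?\<alpha><..<pi/4} = 0" by (rule null_setsD1)
    then show False using lt by simp
  qed
  then show ?thesis using limit_density_integral(2)[of 1] row_limit_nonneg[of 1] by simp
qed

theorem theorem22:
  shows "summable (\<lambda>k. limit_summand (k + 2)) \<and>
         0 < A_reg_limit \<and>
         (A_reg \<longlongrightarrow> A_reg_limit) (at_right 0)"
proof -
  \<comment> \<open>the summability does not involve \<open>lam\<close>; any sequence of parameters tending to 0 yields it\<close>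
  define S0 where "S0 k = (1/20) / (real k + 1)" for k
  have "S0 \<longlonglongrightarrow> 0" unfolding S0_def[abs_def] by real_asymp
  moreover have "0 < S0 k" "S0 k < 1/10" for k by (auto simp: S0_def divide_less_eq)
  ultimately have sm: "summable (\<lambda>j. row_limit (Suc j))" by (intro rows_sum_tendsto(1))
  have tail: "row_limit (Suc (Suc j)) = limit_summand (j + 2)" for j by (simp add: row_limit_def)
  have sm': "summable (\<lambda>j. limit_summand (j + 2))"
    using sm summable_Suc_iff[of "\<lambda>j. row_limit (Suc j)"] by (simp only: tail)
  have eq: "(\<Sum>j. row_limit (Suc j)) = A_reg_limit"
    using suminf_split_head[OF sm] by (simp add: tail A_reg_limit_def) (simp add: row_limit_def)
  have "0 < row_limit (Suc 0)" using row_limit_1_pos by simp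
  moreover have "0 \<le> limit_summand (j + 2)" for j
    unfolding tail[symmetric] by (rule row_limit_nonneg) simp
  then have "0 \<le> (\<Sum>j. limit_summand (j + 2))" by (rule suminf_nonneg[OF sm'])
  ultimately have pos: "0 < A_reg_limit" by (simp add: A_reg_limit_def row_limit_def)
  have "(A_reg \<longlongrightarrow> A_reg_limit) (at_right 0)"
  proof (rule tendsto_at_right_sequentially[of 0 "1/10"])
    fix S :: "nat \<Rightarrow> real" assume "\<And>k. 0 < S k" "\<And>k. S k < 1/10" "S \<longlonglongrightarrow> 0"
    then show "(\<lambda>k. A_reg (S k)) \<longlonglongrightarrow> A_reg_limit" using rows_sum_tendsto(2)[of S] unfolding eq by blast
  qed simp
  with sm' pos show ?thesis by blast
qed

end
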